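(* Let $\Gamma$ be a finite simple graph with vertex set $V=\{1,\dots,n\}$, and suppose the 4-cliques of $\Gamma$ are almost disjoint, i.e. no two (distinct) 4-cliques of $\Gamma$ intersect in a 3-clique of $\Gamma$. Then the homomorphism $$\rho_{\mathcal X(\Gamma)}\colon P_\Gamma \longrightarrow \prod_{X\in\mathcal X(\Gamma)} P_X$$ is injective, where $\mathcal X(\Gamma)$ is the set of maximal cliques of $\Gamma$.
   Context: $B_n$ is the Artin braid group on $n$ strands with standard generators $\sigma_1,\dots,\sigma_{n-1}$, and $P_n\subseteq B_n$ is the pure braid group, generated by the Artin generators $a_{ij}=\sigma_{j-1}\cdots\sigma_{i+1}\sigma_i^2\sigma_{i+1}^{-1}\cdots\sigma_{j-1}^{-1}$, $1\le i<j\le n$. For a finite simple graph $\Gamma$ with vertex set $V=\{1,\dots,n\}$ and edge set $E_\Gamma\subseteq\binom{V}{2}$, the graphic pure braid group $P_\Gamma$ is the quotient of $P_n$ by the normal closure of $\{a_{ij}\mid i<j,\ \{i,j\}\notin E_\Gamma\}$ (equivalently, $P_\Gamma\cong\pi_1(\mathbb C^n\setminus\bigcup_{\{i,j\}\in E_\Gamma}\{x_i=x_j\})$). The image of $a_{ij}$ in $P_\Gamma$ is again denoted $a_{ij}$. For $X\subseteq V$, $\Gamma_X$ is the induced subgraph on $X$, $P_{\Gamma_X}$ is defined in the same way (relabelling the vertices in an order-preserving way), and $\rho_X\colon P_\Gamma\to P_{\Gamma_X}$ is the quotient map sending $a_{ij}$ to $a_{ij}$ if $\{i,j\}\subseteq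 X$ and to $1$ otherwise. A subset $X\subseteq V$ is a clique if $\binom{X}{2}\subseteq E_\Gamma$, and a $k$-clique if moreover $|X|=k$; for a clique $X$, $P_{\Gamma_X}\cong P_{|X|}$ is denoted $P_X$. For a family $\mathcal X$ of cliques, $\rho_{\mathcal X}=\prod_{X\in\mathcal X}\rho_X\colon P_\Gamma\to\prod_{X\in\mathcal X}P_X$. *)

theory Defs
  imports "HOL-Algebra.Sym_Groups" "HOL-Algebra.Product_Groups" "HOL-Library.Ramsey"
begin

section \<open>Groups given by generators and relations\<close>

text \<open>A letter \<open>(s, True)\<close> stands for the generator \<open>s\<close>, and \<open>(s, False)\<close> for its inverse.
  A relation \<open>l = r\<close> is a pair \<open>(l, r)\<close> of words.\<close>

type_synonym 'a word = "('a \<times> bool) list"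

abbreviation words :: "'a set \<Rightarrow> 'a word set" where
  "words S \<equiv> lists (S \<times> UNIV)"

inductive_set word_cong :: "'a set \<Rightarrow> ('a word \<times> 'a word) set \<Rightarrow> ('a word \<times> 'a word) set"
  for S :: "'a set" and R :: "('a word \<times> 'a word) set" where
  refl: "w \<in> words S \<Longrightarrow> (w, w) \<in> word_cong S R"
| sym: "(u, v) \<in> word_cong S R \<Longrightarrow> (v, u) \<in> word_cong S R"
| trans: "(u, v) \<in> word_cong S R \<Longrightarrow> (v, w) \<in> word_cong S R \<Longrightarrow> (u, w) \<in> word_cong S R"
| cancel: "u \<in> words S \<Longrightarrow> v \<in> words S \<Longrightarrow> s \<in> S \<Longrightarrow>
    (u @ [(s, b), (s, \<not> b)] @ v, u @ v) \<in> word_cong S R"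
| rel: "u \<in> words S \<Longrightarrow> v \<in> words S \<Longrightarrow> (l, r) \<in> R \<Longrightarrow> (u @ l @ v, u @ r @ v) \<in> word_cong S R"

definition presented_group :: "'a set \<Rightarrow> ('a word \<times> 'a word) set \<Rightarrow> 'a word set monoid" where
  "presented_group S R =
    \<lparr>carrier = words S // word_cong S R,
     monoid.mult = (\<lambda>A B. \<Union>u\<in>A. \<Union>v\<in>B. word_cong S R `` {u @ v}),
     one = word_cong S R `` {[]}\<rparr>"

context
  fixes S :: "'a set" and R :: "('a word \<times> 'a word) set"
  assumes R: "R \<subseteq> words S \<times> words S"
begin

lemma word_cong_in_words: "(u, v) \<in> word_cong S R \<Longrightarrow> u \<in> words S \<and> v \<in> words S"
  by (induction rule: word_cong.induct) (use R in \<open>auto simp: append_in_lists_conv\<close>)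

lemma equiv_word_cong: "equiv (words S) (word_cong S R)"
proof (rule equivI)
  show "word_cong S R \<subseteq> words S \<times> words S"
    using word_cong_in_words by (fast intro: SigmaI)
qed (auto intro!: refl_onI symI transI intro: word_cong.intros)

lemma word_cong_append:
  assumes "(u, u') \<in> word_cong S R" "(v, v') \<in> word_cong S R"
  shows "(u @ v, u' @ v') \<in> word_cong S R"
proof -
  have left: "(x @ z, y @ z) \<in> word_cong S R"
    if "(x, y) \<in> word_cong S R" "z \<in> words S" for x y z
    using that
  proof (induction rule: word_cong.induct)
    case (refl w)
    then show ?case by (intro word_cong.refl) auto
  next
    case (cancel u v s b)
    with word_cong.cancel[of u S "v @ z" s b R] show ?case by simp
  next
    case (rel u v l r)
    with word_cong.rel[of u S "v @ z" l r R] show ?case by simp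
  qed (auto intro: word_cong.intros)
  have right: "(z @ x, z @ y) \<in> word_cong S R"
    if "(x, y) \<in> word_cong S R" "z \<in> words S" for x y z
    using that
  proof (induction rule: word_cong.induct)
    case (refl w)
    then show ?case by (intro word_cong.refl) auto
  next
    case (cancel u v s b)
    with word_cong.cancel[of "z @ u" S v s b R] show ?case by simp
  next
    case (rel u v l r)
    with word_cong.rel[of "z @ u" S v l r R] show ?case by simp
  qed (auto intro: word_cong.intros)
  show ?thesis
    using left[OF assms(1), of v] right[OF assms(2), of u'] word_cong_in_words assms
    by (blast intro: word_cong.trans)
qed

lemma mult_presented_group:
  assumes "u \<in> words S" "v \<in> words S"
  shows "(word_cong S R `` {u}) \<otimes>\<^bsub>presented_group S R\<^esub> (word_cong S R `` {v})
    = word_cong S R `` {u @ v}"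
proof -
  have "(\<lambda>u v. word_cong S R `` {u @ v}) respects2 word_cong S R"
    by (intro congruent2I[OF equiv_word_cong equiv_word_cong])
       (auto intro!: equiv_class_eq[OF equiv_word_cong] intro: word_cong_append word_cong.refl
         dest: word_cong_in_words)
  from UN_equiv_class2[OF equiv_word_cong equiv_word_cong this assms]
  show ?thesis by (simp add: presented_group_def)
qed

lemma word_cong_inverse:
  "w \<in> words S \<Longrightarrow> (rev (map (apsnd Not) w) @ w, []) \<in> word_cong S R"
proof (induction w)
  case (Cons x w)
  obtain s b where x: "x = (s, b)" by (cases x)
  have *: "rev (map (apsnd Not) w) \<in> words S" using Cons.prems by (auto simp: in_lists_conv_set)
  have "(rev (map (apsnd Not) w) @ [(s, \<not> b), (s, \<not> \<not> b)] @ w, rev (map (apsnd Not) w) @ w)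
      \<in> word_cong S R"
    by (rule word_cong.cancel) (use Cons.prems x * in auto)
  then show ?case using Cons x by (auto intro: word_cong.trans)
qed (auto intro: word_cong.refl)

lemma group_presented_group: "group (presented_group S R)" (is "group ?G")
proof (rule groupI)
  note c = presented_group_def
  have car: "A \<in> carrier ?G \<longleftrightarrow> (\<exists>w\<in>words S. A = word_cong S R `` {w})" for A
    by (auto simp: c quotient_def)
  have one: "\<one>\<^bsub>?G\<^esub> = word_cong S R `` {[]}" by (simp add: c)
  show "A \<otimes>\<^bsub>?G\<^esub> B \<in> carrier ?G" if "A \<in> carrier ?G" "B \<in> carrier ?G" for A B
    using that unfolding car by (metis mult_presented_group append_in_lists_conv)
  show "\<one>\<^bsub>?G\<^esub> \<in> carrier ?G" unfolding car one by blast
  show "(A \<otimes>\<^bsub>?G\<^esub> B) \<otimes>\<^bsub>?G\<^esub> C = A \<otimes>\<^bsub>?G\<^esub> (B \<otimes>\<^bsub>?G\<^esub> C)"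
    if ABC: "A \<in> carrier ?G" "B \<in> carrier ?G" "C \<in> carrier ?G" for A B C
  proof -
    obtain u v w where "u \<in> words S" "A = word_cong S R `` {u}"
      "v \<in> words S" "B = word_cong S R `` {v}" "w \<in> words S" "C = word_cong S R `` {w}"
      using ABC[unfolded car] by (elim bexE)
    then show ?thesis
      by (simp add: mult_presented_group append_in_lists_conv del: in_lists_conv_set)
  qed
  show "\<one>\<^bsub>?G\<^esub> \<otimes>\<^bsub>?G\<^esub> A = A" if "A \<in> carrier ?G" for A
    using that mult_presented_group[of "[]"] unfolding car one by force
  show "\<exists>B\<in>carrier ?G. B \<otimes>\<^bsub>?G\<^esub> A = \<one>\<^bsub>?G\<^esub>" if A: "A \<in> carrier ?G" for A
  proof -
    obtain w where w: "w \<in> words S" "A = word_cong S R `` {w}" using A car by blast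
    let ?w = "rev (map (apsnd Not) w)"
    have "?w \<in> words S" using w by (auto simp: in_lists_conv_set)
    then show ?thesis unfolding w(2) one
      using w word_cong_inverse[OF w(1)] car mult_presented_group equiv_class_eq[OF equiv_word_cong]
      by metis
  qed
qed

end

definition normal_closure :: "('a, 'b) monoid_scheme \<Rightarrow> 'a set \<Rightarrow> 'a set" where
  "normal_closure G S = \<Inter>{N. N \<lhd> G \<and> S \<subseteq> N}"

lemma normal_normal_closure:
  assumes "group G" "S \<subseteq> carrier G"
  shows "normal_closure G S \<lhd> G"
proof -
  interpret group G by fact
  have "carrier G \<lhd> G" by (simp add: normal_inv_iff subgroup_self)
  then have ne: "{N. N \<lhd> G \<and> S \<subseteq> N} \<noteq> {}" using assms(2) by blast
  have "subgroup (normal_closure G S) G" unfolding normal_closure_def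
    by (rule subgroups_Inter) (use ne normal_imp_subgroup in auto)
  moreover have "\<forall>x\<in>carrier G. \<forall>h\<in>normal_closure G S. 
      x \<otimes>\<^bsub>G\<^esub> h \<otimes>\<^bsub>G\<^esub> inv\<^bsub>G\<^esub> x \<in> normal_closure G S"
    unfolding normal_closure_def by (auto intro: normal.inv_op_closed2)
  ultimately show ?thesis by (simp add: normal_inv_iff)
qed


section \<open>Braid groups and pure braid groups\<close>

definition braid_relations :: "nat \<Rightarrow> (nat word \<times> nat word) set" where
  "braid_relations n =
    {([(i, True), (j, True)], [(j, True), (i, True)]) | i j.
        i \<in> {1..<n} \<and> j \<in> {1..<n} \<and> i + 2 \<le> j} \<union>
    {([(i, True), (Suc i, True), (i, True)], [(Suc i, True), (i, True), (Suc i, True)]) | i.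
        i \<in> {1..<n} \<and> Suc i \<in> {1..<n}}"

definition braid_group :: "nat \<Rightarrow> nat word set monoid" where
  "braid_group n = presented_group {1..<n} (braid_relations n)"

definition braid_class :: "nat \<Rightarrow> nat word \<Rightarrow> nat word set" where
  "braid_class n w = word_cong {1..<n} (braid_relations n) `` {w}"

fun word_perm :: "nat word \<Rightarrow> nat \<Rightarrow> nat" where
  "word_perm [] = id"
| "word_perm ((i, b) # w) = transpose i (Suc i) \<circ> word_perm w"

text \<open>The choice of representative is immaterial, see \<open>braid_perm_class\<close> below.\<close>

definition braid_perm :: "nat \<Rightarrow> nat word set \<Rightarrow> nat \<Rightarrow> nat" where
  "braid_perm n A = word_perm (SOME w. w \<in> A)"

definition pure_braid_group :: "nat \<Rightarrow> nat word set monoid" where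
  "pure_braid_group n =
    (braid_group n)\<lparr>carrier := kernel (braid_group n) (sym_group n) (braid_perm n)\<rparr>"

text \<open>\<open>\<sigma>\<^bsub>j-1\<^esub> \<dots> \<sigma>\<^bsub>i+1\<^esub> \<sigma>\<^bsub>i\<^esub> \<sigma>\<^bsub>i\<^esub> \<sigma>\<^bsub>i+1\<^esub>\<^sup>-\<^sup>1 \<dots> \<sigma>\<^bsub>j-1\<^esub>\<^sup>-\<^sup>1\<close>, meant for \<open>1 \<le> i < j \<le> n\<close>\<close>

definition artin_word :: "nat \<Rightarrow> nat \<Rightarrow> nat word" where
  "artin_word i j =
    map (\<lambda>k. (k, True)) (rev [Suc i..<j]) @ [(i, True), (i, True)] @
    map (\<lambda>k. (k, False)) [Suc i..<j]"

definition artin_gen :: "nat \<Rightarrow> nat \<Rightarrow> nat \<Rightarrow> nat word set" where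
  "artin_gen n i j = braid_class n (artin_word i j)"

lemma braid_relations_words: "braid_relations n \<subseteq> words {1..<n} \<times> words {1..<n}"
  by (auto simp: braid_relations_def)

lemma group_braid_group: "group (braid_group n)"
  unfolding braid_group_def by (rule group_presented_group[OF braid_relations_words])

lemma carrier_braid_group: "carrier (braid_group n) = braid_class n ` words {1..<n}"
  by (auto simp: braid_group_def presented_group_def quotient_def braid_class_def)

lemma mult_braid_class:
  assumes "u \<in> words {1..<n}" "v \<in> words {1..<n}"
  shows "braid_class n u \<otimes>\<^bsub>braid_group n\<^esub> braid_class n v = braid_class n (u @ v)"
  unfolding braid_group_def braid_class_def
  by (rule mult_presented_group[OF braid_relations_words assms])

lemma word_perm_append: "word_perm (u @ v) = word_perm u \<circ> word_perm v"
  by (induction u rule: word_perm.induct) (auto simp: o_assoc)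

lemma word_perm_cong:
  "(u, v) \<in> word_cong {1..<n} (braid_relations n) \<Longrightarrow> word_perm u = word_perm v"
proof (induction rule: word_cong.induct)
  case (rel u v l r)
  have "word_perm l = word_perm r"
    using rel by (auto simp: braid_relations_def fun_eq_iff transpose_def)
  then show ?case by (simp add: word_perm_append)
qed (auto simp: word_perm_append fun_eq_iff)

lemma braid_perm_class:
  assumes "w \<in> words {1..<n}"
  shows "braid_perm n (braid_class n w) = word_perm w"
proof -
  have "w \<in> braid_class n w" using assms by (auto simp: braid_class_def intro: word_cong.refl)
  then have "(SOME v. v \<in> braid_class n w) \<in> braid_class n w" by (rule someI)
  then have "(w, SOME v. v \<in> braid_class n w) \<in> word_cong {1..<n} (braid_relations n)"
    by (simp add: braid_class_def)
  from word_perm_cong[OF this] show ?thesis by (simp add: braid_perm_def)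
qed

lemma word_perm_permutes: "w \<in> words {1..<n} \<Longrightarrow> word_perm w permutes {1..n}"
proof (induction w rule: word_perm.induct)
  case (2 i b w)
  then have "transpose i (Suc i) permutes {1..n}" "word_perm w permutes {1..n}"
    by (auto intro!: permutes_swap_id)
  then show ?case by (simp only: word_perm.simps permutes_compose)
qed (simp add: permutes_id)

lemma braid_perm_hom: "braid_perm n \<in> hom (braid_group n) (sym_group n)"
proof (rule homI)
  fix A assume "A \<in> carrier (braid_group n)"
  then obtain u where "u \<in> words {1..<n}" "A = braid_class n u"
    unfolding carrier_braid_group by (elim imageE)
  then show "braid_perm n A \<in> carrier (sym_group n)"
    using word_perm_permutes[of u n] braid_perm_class[of u n] by (simp add: sym_group_def)
next
  fix A B assume "A \<in> carrier (braid_group n)" "B \<in> carrier (braid_group n)"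
  then obtain u v where uv: "u \<in> words {1..<n}" "v \<in> words {1..<n}"
      "A = braid_class n u" "B = braid_class n v"
    unfolding carrier_braid_group by (elim imageE)
  moreover have "u @ v \<in> words {1..<n}" using uv by (simp only: append_in_lists_conv)
  ultimately show "braid_perm n (A \<otimes>\<^bsub>braid_group n\<^esub> B) =
      braid_perm n A \<otimes>\<^bsub>sym_group n\<^esub> braid_perm n B"
    using mult_braid_class[of u n v] braid_perm_class
    by (metis sym_group_mult word_perm_append)
qed

lemma subgroup_pure_braid:
  "subgroup (kernel (braid_group n) (sym_group n) (braid_perm n)) (braid_group n)"
  by (intro group_hom.subgroup_kernel group_hom.intro group_hom_axioms.intro
      group_braid_group sym_group_is_group braid_perm_hom)

lemma group_pure_braid_group: "group (pure_braid_group n)"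
  unfolding pure_braid_group_def
  by (rule subgroup.subgroup_is_group[OF subgroup_pure_braid group_braid_group])

lemma word_perm_conj:
  "word_perm (map (\<lambda>k. (k, True)) (rev ks)) \<circ> word_perm (map (\<lambda>k. (k, False)) ks) = id"
  by (induction ks) (auto simp: word_perm_append fun_eq_iff)

lemma artin_gen_closed:
  assumes "1 \<le> i" "i < j" "j \<le> n"
  shows "artin_gen n i j \<in> carrier (pure_braid_group n)"
proof -
  have w: "artin_word i j \<in> words {1..<n}"
    using assms by (auto simp: artin_word_def append_in_lists_conv in_lists_conv_set)
  moreover have "word_perm (artin_word i j) = id"
    using word_perm_conj[of "[Suc i..<j]"]
    by (simp add: artin_word_def word_perm_append fun_eq_iff)
  ultimately show ?thesis
    by (auto simp: pure_braid_group_def kernel_def artin_gen_def carrier_braid_group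
        braid_perm_class sym_group_def)
qed


section \<open>Graphic pure braid groups\<close>

text \<open>A simple graph on \<open>{1..n}\<close> is given by its edge set \<open>E \<subseteq> [{1..n}]\<^bsup>2\<^esup>\<close>.\<close>

definition graphic_relators :: "nat \<Rightarrow> nat set set \<Rightarrow> nat word set set" where
  "graphic_relators n E = {artin_gen n i j | i j. 1 \<le> i \<and> i < j \<and> j \<le> n \<and> {i, j} \<notin> E}"

definition graphic_kernel :: "nat \<Rightarrow> nat set set \<Rightarrow> nat word set set" where
  "graphic_kernel n E = normal_closure (pure_braid_group n) (graphic_relators n E)"

definition graphic_pure_braid_group :: "nat \<Rightarrow> nat set set \<Rightarrow> nat word set set monoid" where
  "graphic_pure_braid_group n E = pure_braid_group n Mod graphic_kernel n E"

definition graphic_gen :: "nat \<Rightarrow> nat set set \<Rightarrow> nat \<Rightarrow> nat \<Rightarrow> nat word set set" where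
  "graphic_gen n E i j = graphic_kernel n E #>\<^bsub>pure_braid_group n\<^esub> artin_gen n i j"

lemma normal_graphic_kernel: "graphic_kernel n E \<lhd> pure_braid_group n"
  unfolding graphic_kernel_def
  by (rule normal_normal_closure[OF group_pure_braid_group])
     (auto simp: graphic_relators_def artin_gen_closed)

lemma group_graphic_pure_braid_group: "group (graphic_pure_braid_group n E)"
  unfolding graphic_pure_braid_group_def
  by (rule normal.factorgroup_is_group[OF normal_graphic_kernel])

text \<open>For \<open>K \<subseteq> {1..n}\<close>, \<open>relabel K\<close> is the order-preserving bijection from \<open>K\<close> onto \<open>{1..card K}\<close>,
  and \<open>induced_edges K E\<close> the edge set of the relabelled induced subgraph.\<close>

definition relabel :: "nat set \<Rightarrow> nat \<Rightarrow> nat" where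
  "relabel K x = card {y \<in> K. y \<le> x}"

definition induced_edges :: "nat set \<Rightarrow> nat set set \<Rightarrow> nat set set" where
  "induced_edges K E = {relabel K ` e | e. e \<in> E \<and> e \<subseteq> K}"

abbreviation induced_pure_braid_group :: "nat set set \<Rightarrow> nat set \<Rightarrow> nat word set set monoid" where
  "induced_pure_braid_group E K \<equiv> graphic_pure_braid_group (card K) (induced_edges K E)"

text \<open>\<open>\<rho>\<^sub>K\<close> is the unique homomorphism with the prescribed values on the generators
  (made unique as a function by extensionality off the carrier).\<close>

definition rho :: "nat \<Rightarrow> nat set set \<Rightarrow> nat set \<Rightarrow> nat word set set \<Rightarrow> nat word set set" where
  "rho n E K = (THE f.
     f \<in> hom (graphic_pure_braid_group n E) (induced_pure_braid_group E K) \<and>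
     f \<in> extensional (carrier (graphic_pure_braid_group n E)) \<and>
     (\<forall>i j. 1 \<le> i \<and> i < j \<and> j \<le> n \<longrightarrow>
        f (graphic_gen n E i j) =
          (if {i, j} \<subseteq> K
           then graphic_gen (card K) (induced_edges K E) (relabel K i) (relabel K j)
           else \<one>\<^bsub>induced_pure_braid_group E K\<^esub>)))"

definition rho_family ::
  "nat \<Rightarrow> nat set set \<Rightarrow> nat set set \<Rightarrow> nat word set set \<Rightarrow> nat set \<Rightarrow> nat word set set" where
  "rho_family n E Ks g = (\<lambda>K\<in>Ks. rho n E K g)"

definition cliques :: "nat \<Rightarrow> nat set set \<Rightarrow> nat set set" where
  "cliques n E = {K. K \<subseteq> {1..n} \<and> clique K E}"

definition k_cliques :: "nat \<Rightarrow> nat \<Rightarrow> nat set set \<Rightarrow> nat set set" where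
  "k_cliques k n E = {K \<in> cliques n E. card K = k}"

definition maximal_cliques :: "nat \<Rightarrow> nat set set \<Rightarrow> nat set set" where
  "maximal_cliques n E = {K \<in> cliques n E. \<forall>L\<in>cliques n E. K \<subseteq> L \<longrightarrow> K = L}"

lemma clique_iff_nsets: "finite K \<Longrightarrow> clique K E \<longleftrightarrow> [K]\<^bsup>2\<^esup> \<subseteq> E"
  by (auto simp: clique_def nsets_2_eq)

end

theory Submission
  imports Defs "HOL-Algebra.Zassenhaus"
begin

text \<open>
  Write \<open>G\<close> for \<open>P\<^sub>\<Gamma>\<close> and \<open>a\<^sub>e\<close> for the generator belonging to an edge \<open>e\<close>. For a clique \<open>K\<close>,
  putting the strands outside \<open>K\<close> back gives a homomorphism from \<open>P\<^sub>K\<close> to \<open>G\<close>, and composing it with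
  \<open>\<rho>\<^sub>K\<close> gives an endomorphism \<open>\<pi>\<^sub>K\<close> of \<open>G\<close> that fixes \<open>a\<^sub>e\<close> for \<open>e \<subseteq> K\<close> and sends the other generators
  to \<open>1\<close>. An element killed by every \<open>\<rho>\<^sub>K\<close> is killed by every \<open>\<pi>\<^sub>K\<close>, so it is enough to show that the
  \<open>\<pi>\<^sub>K\<close> of the maximal cliques have trivial joint kernel. This rests on three facts.

  \<^item> \<open>a\<^sub>e\<close> and \<open>a\<^sub>f\<close> commute unless \<open>e \<union> f\<close> is a clique. Each relation between pure braid generators that
    involves two crossing or adjacent pairs becomes a commutation relation as soon as one of the
    other pairs of the triangle or quadrilateral is killed (\<open>edge_gens_commute\<close>).
  \<^item> The full twist is central in \<open>P\<^sub>K\<close> and is a product in which every generator occurs once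
    (\<open>clique_center_generates\<close>). Hence, modulo the centre, \<open>P\<^sub>K\<close> is generated by all of its generators
    but an arbitrary one, and the commutator subgroup \<open>D\<^sub>K\<close> of the subgroup \<open>\<langle>a\<^sub>e | e \<subseteq> K\<rangle>\<close> lies in the
    subgroup generated by these (\<open>derived_commutes_if_generates_mod_center\<close>).
  \<^item> Because the 4-cliques are almost disjoint, two maximal cliques share at most one edge, and an edge
    \<open>f\<close> outside a maximal clique \<open>K\<close> forms a clique with at most one edge of \<open>K\<close>
    (\<open>maximal_cliques_share_edge\<close>, \<open>outside_edge_linked_to_one_edge\<close>). Otherwise three vertices of \<open>K\<close>
    would be joined to a vertex outside \<open>K\<close>, and by maximality also to a fourth vertex of \<open>K\<close>, so that
    two 4-cliques would meet in a triangle.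

  By the first and the last fact, \<open>a\<^sub>f\<close> with \<open>f\<close> outside \<open>K\<close> commutes with all generators of \<open>K\<close> but at
  most one, so it centralises \<open>D\<^sub>K\<close> by the second. Therefore all \<open>D\<^sub>K\<close> are normal in \<open>G\<close>. The subgroup \<open>N\<close>
  generated by them contains all commutators of generators, so \<open>G / N\<close> is abelian. Let \<open>g\<close> lie in the
  joint kernel. Then \<open>g\<close> is also killed by the retractions onto the cyclic groups \<open>\<langle>a\<^sub>e\<rangle>\<close>, and peeling off
  one edge after another shows \<open>g \<in> N\<close>. For \<open>L \<noteq> K\<close> the map \<open>\<pi>\<^sub>K\<close> sends all generators of \<open>L\<close> but one
  to \<open>1\<close>, so it has abelian image on \<open>\<langle>a\<^sub>e | e \<subseteq> L\<rangle>\<close> and kills \<open>D\<^sub>L\<close>, whereas it is the identity on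
  \<open>D\<^sub>K\<close>. Peeling off one \<open>D\<^sub>K\<close> after another gives \<open>g = 1\<close> (\<open>joint_kernel_trivial\<close>).

  It remains to supply the maps and relations from the presentation of the braid group by words. The
  pure braid group is generated by the Artin generators (\<open>generate_pure_braid_group\<close>), which makes
  \<open>\<rho>\<^sub>K\<close> unique; deleting letters from words gives the maps that forget strands (\<open>pure_forget\<close>); and a
  conjugate of the inclusion of \<open>B\<^sub>k\<close> into \<open>B\<^sub>n\<close> puts \<open>k\<close> strands into arbitrary positions
  (\<open>pure_strand_inclusion\<close>). The last map also reduces all relations between pure braid generators to
  relations on the first three or four strands.
\<close>

section \<open>Conjugation and generated subgroups\<close>

context group
begin

lemma cancel_inv_left [simp]:
  assumes "x \<in> carrier G" "y \<in> carrier G"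
  shows "inv x \<otimes> (x \<otimes> y) = y" "x \<otimes> (inv x \<otimes> y) = y"
  using assms by (simp_all flip: m_assoc)

lemma conj_mult:
  assumes "g \<in> carrier G" "x \<in> carrier G" "y \<in> carrier G"
  shows "g \<otimes> (x \<otimes> y) \<otimes> inv g = (g \<otimes> x \<otimes> inv g) \<otimes> (g \<otimes> y \<otimes> inv g)"
  using assms by (simp add: m_assoc)

lemma conj_inv:
  assumes "g \<in> carrier G" "x \<in> carrier G"
  shows "g \<otimes> inv x \<otimes> inv g = inv (g \<otimes> x \<otimes> inv g)"
  using assms by (simp add: m_assoc inv_mult_group)

lemma subgroup_centralizer:
  assumes "B \<subseteq> carrier G"
  shows "subgroup {x \<in> carrier G. \<forall>b\<in>B. x \<otimes> b = b \<otimes> x} G"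
proof (rule subgroupI)
  fix x assume x: "x \<in> {x \<in> carrier G. \<forall>b\<in>B. x \<otimes> b = b \<otimes> x}"
  have "inv x \<otimes> b = b \<otimes> inv x" if b: "b \<in> B" for b
  proof -
    have xc: "x \<in> carrier G" and bc: "b \<in> carrier G" using x b assms by auto
    have "inv x \<otimes> b = inv x \<otimes> (b \<otimes> x) \<otimes> inv x" using xc bc by (simp add: m_assoc)
    also have "\<dots> = inv x \<otimes> (x \<otimes> b) \<otimes> inv x" using x b by simp
    also have "\<dots> = b \<otimes> inv x" unfolding m_assoc[symmetric, OF inv_closed[OF xc] xc bc] using xc bc by simp
    finally show ?thesis .
  qed
  with x show "inv x \<in> {x \<in> carrier G. \<forall>b\<in>B. x \<otimes> b = b \<otimes> x}" by simp
next
  fix x y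
  assume "x \<in> {x \<in> carrier G. \<forall>b\<in>B. x \<otimes> b = b \<otimes> x}" "y \<in> {x \<in> carrier G. \<forall>b\<in>B. x \<otimes> b = b \<otimes> x}"
  moreover have "x \<otimes> y \<otimes> b = b \<otimes> (x \<otimes> y)" if "x \<in> carrier G" "y \<in> carrier G" "b \<in> carrier G"
      "x \<otimes> b = b \<otimes> x" "y \<otimes> b = b \<otimes> y" for b
    using that by (metis m_assoc)
  ultimately show "x \<otimes> y \<in> {x \<in> carrier G. \<forall>b\<in>B. x \<otimes> b = b \<otimes> x}"
    using assms by auto
next
  have "\<one> \<in> {x \<in> carrier G. \<forall>b\<in>B. x \<otimes> b = b \<otimes> x}" using assms by auto
  then show "{x \<in> carrier G. \<forall>b\<in>B. x \<otimes> b = b \<otimes> x} \<noteq> {}" by blast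
qed (use assms in auto)

lemma commute_generate:
  assumes A: "A \<subseteq> carrier G" and B: "B \<subseteq> carrier G"
    and AB: "\<And>a b. a \<in> A \<Longrightarrow> b \<in> B \<Longrightarrow> a \<otimes> b = b \<otimes> a"
    and x: "x \<in> generate G A" and y: "y \<in> generate G B"
  shows "x \<otimes> y = y \<otimes> x"
proof -
  have "generate G A \<subseteq> {x \<in> carrier G. \<forall>b\<in>B. x \<otimes> b = b \<otimes> x}"
    by (rule generate_subgroup_incl[OF _ subgroup_centralizer[OF B]]) (use A AB in auto)
  then have xB: "\<forall>b\<in>B. x \<otimes> b = b \<otimes> x" and xc: "x \<in> carrier G" using x by auto
  have "generate G B \<subseteq> {y \<in> carrier G. \<forall>b\<in>{x}. y \<otimes> b = b \<otimes> y}"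
    by (rule generate_subgroup_incl[OF _ subgroup_centralizer]) (use B xB xc in auto)
  then show ?thesis using y by auto
qed

lemma conj_generate:
  assumes g: "g \<in> carrier G" and A: "A \<subseteq> carrier G"
    and conj: "\<And>x. x \<in> A \<Longrightarrow> g \<otimes> x \<otimes> inv g \<in> generate G A"
    and x: "x \<in> generate G A"
  shows "g \<otimes> x \<otimes> inv g \<in> generate G A"
proof -
  interpret H: subgroup "generate G A" G by (rule generate_is_subgroup[OF A])
  have "subgroup {x \<in> carrier G. g \<otimes> x \<otimes> inv g \<in> generate G A} G"
  proof (rule subgroupI)
    have "\<one> \<in> {x \<in> carrier G. g \<otimes> x \<otimes> inv g \<in> generate G A}" using g by simp
    then show "{x \<in> carrier G. g \<otimes> x \<otimes> inv g \<in> generate G A} \<noteq> {}" by blast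
  next
    fix x y assume "x \<in> {x \<in> carrier G. g \<otimes> x \<otimes> inv g \<in> generate G A}"
      "y \<in> {x \<in> carrier G. g \<otimes> x \<otimes> inv g \<in> generate G A}"
    then show "x \<otimes> y \<in> {x \<in> carrier G. g \<otimes> x \<otimes> inv g \<in> generate G A}"
      using conj_mult[OF g, of x y] by simp
  qed (use g in \<open>auto simp: conj_inv\<close>)
  from generate_subgroup_incl[OF _ this, of A] show ?thesis using A conj x by auto
qed

text \<open>
  Both \<open>s\<close> and its inverse have to be tested: conjugation by \<open>s\<close> alone could map the subgroup
  generated by \<open>A\<close> onto a proper subgroup of itself.
\<close>

lemma normal_generate_if_conj_generators:
  assumes S: "S \<subseteq> carrier G" "generate G S = carrier G" and A: "A \<subseteq> carrier G"
    and conj: "\<And>s x. s \<in> S \<Longrightarrow> x \<in> A \<Longrightarrow> s \<otimes> x \<otimes> inv s \<in> generate G A"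
      "\<And>s x. s \<in> S \<Longrightarrow> x \<in> A \<Longrightarrow> inv s \<otimes> x \<otimes> s \<in> generate G A"
  shows "generate G A \<lhd> G"
proof -
  let ?N = "{g \<in> carrier G. \<forall>x\<in>generate G A.
    g \<otimes> x \<otimes> inv g \<in> generate G A \<and> inv g \<otimes> x \<otimes> g \<in> generate G A}"
  have gc: "x \<in> carrier G" if "x \<in> generate G A" for x using that generate_incl[OF A] by blast
  have "subgroup ?N G"
  proof (rule subgroupI)
    have "\<one> \<in> ?N" using gc by simp
    then show "?N \<noteq> {}" by blast
  next
    fix g h assume g: "g \<in> ?N" and h: "h \<in> ?N"
    have "g \<otimes> h \<otimes> x \<otimes> inv (g \<otimes> h) = g \<otimes> (h \<otimes> x \<otimes> inv h) \<otimes> inv g"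
      "inv (g \<otimes> h) \<otimes> x \<otimes> (g \<otimes> h) = inv h \<otimes> (inv g \<otimes> x \<otimes> g) \<otimes> h" if "x \<in> generate G A" for x
      using g h gc[OF that] by (simp_all add: m_assoc inv_mult_group)
    then show "g \<otimes> h \<in> ?N" using g h by auto
  qed auto
  moreover have "S \<subseteq> ?N"
  proof
    fix s assume s: "s \<in> S"
    then have "s \<in> carrier G" using S by auto
    then show "s \<in> ?N"
      using conj_generate[of s A] conj_generate[of "inv s" A] conj[OF s] A by auto
  qed
  ultimately have "carrier G \<subseteq> ?N" using generate_subgroup_incl[of S ?N] S by auto
  then show ?thesis
    using generate_is_subgroup[OF A] by (auto simp: normal_inv_iff)
qed

lemma generate_Un_normal:
  assumes N: "N \<lhd> G" and H: "subgroup H G" and x: "x \<in> generate G (N \<union> H)"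
  obtains n h where "n \<in> N" "h \<in> H" "x = n \<otimes> h"
proof -
  interpret N: normal N G by fact
  interpret H: subgroup H G by fact
  have "subgroup (N <#> H) G" by (rule mult_norm_subgroup[OF N H])
  moreover have "N \<union> H \<subseteq> N <#> H"
  proof
    fix y assume "y \<in> N \<union> H"
    moreover have "y = y \<otimes> \<one>" "y = \<one> \<otimes> y" if "y \<in> N \<union> H" using that by auto
    ultimately show "y \<in> N <#> H"
      unfolding set_mult_def using N.one_closed H.one_closed by blast
  qed
  ultimately have "x \<in> N <#> H" using generate_subgroup_incl x by blast
  then show ?thesis using that by (auto simp: set_mult_def)
qed

end

lemma hom_eq_on_generate:
  assumes "group G" "group H" "f \<in> hom G H" "f' \<in> hom G H" "S \<subseteq> carrier G"
    and "\<And>s. s \<in> S \<Longrightarrow> f s = f' s" and "x \<in> generate G S"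
  shows "f x = f' x"
proof -
  interpret f: group_hom G H f by (intro group_hom.intro group_hom_axioms.intro assms)
  interpret f': group_hom G H f' by (intro group_hom.intro group_hom_axioms.intro assms)
  from \<open>x \<in> generate G S\<close> have "f x = f' x \<and> x \<in> carrier G"
    by (induction rule: generate.induct) (use assms in auto)
  then show ?thesis ..
qed

lemma hom_trivial_on_generate:
  assumes "group G" "group H" "f \<in> hom G H" "S \<subseteq> carrier G"
    and "\<And>s. s \<in> S \<Longrightarrow> f s = \<one>\<^bsub>H\<^esub>" and "x \<in> generate G S"
  shows "f x = \<one>\<^bsub>H\<^esub>"
proof (rule hom_eq_on_generate[OF assms(1-3) _ assms(4) _ assms(6)])
  show "(\<lambda>_. \<one>\<^bsub>H\<^esub>) \<in> hom G H" using assms(2) by (simp add: hom_def group.is_monoid)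
qed (use assms in auto)

context group
begin

text \<open>
  Conjugation by \<open>g\<close> takes \<open>x\<close> to \<open>y\<close>. The form without inverses turns calculations in braid groups
  into compositions of such statements, and the carrier conditions travel along with it.
\<close>

definition conj_to :: "'a \<Rightarrow> 'a \<Rightarrow> 'a \<Rightarrow> bool" where
  "conj_to g x y \<longleftrightarrow> g \<in> carrier G \<and> x \<in> carrier G \<and> y \<in> carrier G \<and> g \<otimes> x = y \<otimes> g"

lemma conj_to_swap: "conj_to g x x \<Longrightarrow> conj_to x g g"
  by (simp add: conj_to_def)

lemma conj_to_conj: "g \<in> carrier G \<Longrightarrow> x \<in> carrier G \<Longrightarrow> conj_to g x (g \<otimes> x \<otimes> inv g)"
  by (simp add: conj_to_def m_assoc)

lemma conj_to_eq:
  assumes "conj_to g x y"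
  shows "y = g \<otimes> x \<otimes> inv g"
proof -
  have c: "g \<in> carrier G" "x \<in> carrier G" "y \<in> carrier G" and eq: "g \<otimes> x = y \<otimes> g"
    using assms by (simp_all add: conj_to_def)
  show ?thesis unfolding eq using c by (simp add: m_assoc)
qed

lemma conj_to_inv:
  assumes "conj_to g x y"
  shows "conj_to (inv g) y x"
proof -
  have c: "g \<in> carrier G" "x \<in> carrier G" "y \<in> carrier G" using assms by (simp_all add: conj_to_def)
  show ?thesis unfolding conj_to_eq[OF assms] using c by (simp add: conj_to_def m_assoc)
qed

lemma conj_to_eq':
  assumes "conj_to g x y"
  shows "x = inv g \<otimes> y \<otimes> g"
  using conj_to_eq[OF conj_to_inv[OF assms]] assms by (simp add: conj_to_def)

lemma conj_to_trans:
  assumes "conj_to g x y" "conj_to h y z"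
  shows "conj_to (h \<otimes> g) x z"
proof -
  have c: "g \<in> carrier G" "h \<in> carrier G" "x \<in> carrier G" "y \<in> carrier G" "z \<in> carrier G"
    using assms by (simp_all add: conj_to_def)
  have "h \<otimes> g \<otimes> x = h \<otimes> (y \<otimes> g)" using assms(1) c by (simp add: conj_to_def m_assoc)
  also have "\<dots> = z \<otimes> h \<otimes> g" using assms(2) c by (simp add: conj_to_def flip: m_assoc)
  finally show ?thesis using c by (simp add: conj_to_def m_assoc)
qed

text \<open>
  The braid relations rewrite the conjugating element, and this lemma then strips off the part of it
  whose effect is already known.
\<close>

lemma conj_to_factor:
  assumes hg: "conj_to (h \<otimes> g) x z" and g: "conj_to g x y" and h: "h \<in> carrier G"
  shows "conj_to h y z"
proof -
  have c: "g \<in> carrier G" using g by (simp add: conj_to_def)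
  have "conj_to (h \<otimes> g \<otimes> inv g) y z" by (rule conj_to_trans[OF conj_to_inv[OF g] hg])
  then show ?thesis using c h by (simp add: m_assoc)
qed

lemma conj_to_mult:
  assumes "conj_to g x y" "conj_to g x' y'"
  shows "conj_to g (x \<otimes> x') (y \<otimes> y')"
proof -
  have c: "g \<in> carrier G" "x \<in> carrier G" "y \<in> carrier G" "x' \<in> carrier G" "y' \<in> carrier G"
    using assms by (simp_all add: conj_to_def)
  have "g \<otimes> (x \<otimes> x') = y \<otimes> (g \<otimes> x')" using assms(1) c by (simp add: conj_to_def flip: m_assoc)
  also have "\<dots> = y \<otimes> y' \<otimes> g" using assms(2) c by (simp add: conj_to_def m_assoc)
  finally show ?thesis using c by (simp add: conj_to_def)
qed

lemma conj_to_commute: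
  assumes "conj_to g x y" "conj_to g x' y'" "x \<otimes> x' = x' \<otimes> x"
  shows "y \<otimes> y' = y' \<otimes> y"
  using conj_to_eq[OF conj_to_mult[OF assms(1,2)]] conj_to_eq[OF conj_to_mult[OF assms(2,1)]]
    assms(3) by simp

lemma conj_to_commute_self:
  assumes "conj_to g x y" "conj_to h x x" "h \<otimes> g = g \<otimes> h"
  shows "conj_to h y y"
proof (rule conj_to_factor[of h g x y y])
  show "conj_to (h \<otimes> g) x y" unfolding assms(3) by (rule conj_to_trans[OF assms(2,1)])
qed (use assms in \<open>auto simp: conj_to_def\<close>)

definition list_prod :: "'a list \<Rightarrow> 'a" where
  "list_prod xs = foldr (\<otimes>) xs \<one>"

lemma list_prod_simps [simp]: "list_prod [] = \<one>" "list_prod (x # xs) = x \<otimes> list_prod xs"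
  by (simp_all add: list_prod_def)

lemma list_prod_closed: "set xs \<subseteq> carrier G \<Longrightarrow> list_prod xs \<in> carrier G"
  by (induction xs) auto

lemma list_prod_append:
  "set xs \<subseteq> carrier G \<Longrightarrow> set ys \<subseteq> carrier G \<Longrightarrow> list_prod (xs @ ys) = list_prod xs \<otimes> list_prod ys"
  by (induction xs) (auto simp: list_prod_closed m_assoc)

lemma list_prod_in_subgroup: "subgroup H G \<Longrightarrow> set xs \<subseteq> H \<Longrightarrow> list_prod xs \<in> H"
  by (induction xs) (auto simp: subgroup.one_closed subgroup.m_closed)

lemma conj_to_list_prod:
  assumes "g \<in> carrier G" "\<And>i. i \<in> set is \<Longrightarrow> conj_to g (f i) (f' i)"
  shows "conj_to g (list_prod (map f is)) (list_prod (map f' is))"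
  using assms(2)
proof (induction "is")
  case Nil
  then show ?case using assms(1) by (simp add: conj_to_def)
next
  case (Cons i "is")
  then show ?case using conj_to_mult[of g "f i" "f' i"] by simp
qed

lemma normal_absorb:
  assumes "N \<lhd> G" "a \<in> N" "q \<in> N" "y \<in> carrier G"
  shows "\<exists>a'\<in>N. a \<otimes> y \<otimes> q = a' \<otimes> y"
proof -
  interpret N: normal N G by fact
  have "a \<otimes> (y \<otimes> q \<otimes> inv y) \<in> N" using assms N.inv_op_closed2 by simp
  moreover have "a \<otimes> y \<otimes> q = a \<otimes> (y \<otimes> q \<otimes> inv y) \<otimes> y" using assms by (simp add: m_assoc)
  ultimately show ?thesis by blast
qed

lemma factor_of_list_prod_in_generate:
  assumes "set xs \<union> set ys \<subseteq> S" "x \<in> carrier G" "S \<subseteq> carrier G"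
    and z: "z = list_prod (xs @ x # ys)"
  shows "x \<in> generate G (insert z S)"
proof -
  have zc: "z \<in> carrier G" unfolding z by (rule list_prod_closed) (use assms in auto)
  have sub: "subgroup (generate G (insert z S)) G"
    by (rule generate_is_subgroup) (use zc assms in auto)
  interpret H: subgroup "generate G (insert z S)" G by (rule sub)
  have xs: "list_prod xs \<in> generate G (insert z S)" "list_prod ys \<in> generate G (insert z S)"
    using list_prod_in_subgroup[OF sub] assms(1) by (auto intro: generate.incl)
  have "z = list_prod xs \<otimes> (x \<otimes> list_prod ys)"
    unfolding z using list_prod_append[of xs "x # ys"] assms by auto
  then have "x = inv (list_prod xs) \<otimes> z \<otimes> inv (list_prod ys)"
    using xs assms(2) H.mem_carrier by (simp add: m_assoc)
  moreover have "inv (list_prod xs) \<otimes> z \<otimes> inv (list_prod ys) \<in> generate G (insert z S)"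
    using xs by (intro H.m_closed H.m_inv_closed) (auto intro: generate.incl)
  ultimately show ?thesis by simp
qed

lemma commute_if_central_prod:
  assumes "x \<in> carrier G" "y \<in> carrier G" "(x \<otimes> y) \<otimes> x = x \<otimes> (x \<otimes> y)"
  shows "x \<otimes> y = y \<otimes> x"
  using assms by (simp add: m_assoc)

end

section \<open>Joint kernels of retractions\<close>

text \<open>
  Since the span of \<open>N\<close> and all \<open>B x'\<close> but one is normal, an element of the whole span is a product
  of an element of that span and an element of the remaining \<open>B x\<close>. The map \<open>p x\<close> kills the first
  factor and fixes the second, so the second is \<open>1\<close>. Repeating this removes all \<open>B x\<close>.
\<close>

lemma (in group) strip_normal_factors:
  assumes F: "finite F" and N: "N \<lhd> G"
    and B: "\<And>x. x \<in> F \<Longrightarrow> subgroup (B x) G"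
    and norm: "\<And>F'. F' \<subseteq> F \<Longrightarrow> generate G (N \<union> (\<Union>x\<in>F'. B x)) \<lhd> G"
    and p: "\<And>x. x \<in> F \<Longrightarrow> p x \<in> hom G G"
    and pN: "\<And>x y. x \<in> F \<Longrightarrow> y \<in> N \<Longrightarrow> p x y = \<one>"
    and pB: "\<And>x x' y. x \<in> F \<Longrightarrow> x' \<in> F \<Longrightarrow> x \<noteq> x' \<Longrightarrow> y \<in> B x' \<Longrightarrow> p x y = \<one>"
    and pid: "\<And>x y. x \<in> F \<Longrightarrow> y \<in> B x \<Longrightarrow> p x y = y"
    and g: "g \<in> generate G (N \<union> (\<Union>x\<in>F. B x))" and pg: "\<And>x. x \<in> F \<Longrightarrow> p x g = \<one>"
  shows "g \<in> N"
  using F B norm p pN pB pid g pg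
proof (induction F)
  case empty
  then show ?case using N generate_subgroup_incl[of N N] normal_imp_subgroup by auto
next
  case (insert x F)
  let ?M = "generate G (N \<union> (\<Union>x\<in>F. B x))"
  interpret N: normal N G by fact
  have M: "?M \<lhd> G" using insert.prems(2) by blast
  interpret M: normal ?M G by (rule M)
  have Bx: "subgroup (B x) G" using insert.prems(1) by simp
  interpret Bx: subgroup "B x" G by (rule Bx)
  have car: "N \<union> (\<Union>x\<in>F. B x) \<subseteq> carrier G"
    using N.subset subgroup.subset[OF insert.prems(1)] by blast
  have "N \<union> (\<Union>x\<in>insert x F. B x) \<subseteq> generate G (?M \<union> B x)"
    using generate.incl[of _ "N \<union> (\<Union>x\<in>F. B x)" G] generate.incl[of _ "?M \<union> B x" G] by blast
  moreover have "subgroup (generate G (?M \<union> B x)) G"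
    by (rule generate_is_subgroup) auto
  ultimately have "g \<in> generate G (?M \<union> B x)"
    using generate_subgroup_incl insert.prems(7) by blast
  then obtain m b where mb: "m \<in> ?M" "b \<in> B x" "g = m \<otimes> b"
    by (rule generate_Un_normal[OF M Bx])
  have "p x m = \<one>"
  proof (rule hom_trivial_on_generate[OF _ _ _ car _ mb(1)])
    show "p x s = \<one>" if "s \<in> N \<union> (\<Union>x\<in>F. B x)" for s
      using that insert.prems(4)[of x s] insert.prems(5)[of x _ s] insert.hyps(2) by auto
  qed (use insert.prems(3) in auto)
  moreover have "p x b = b" using insert.prems(6) mb by simp
  moreover have "p x g = p x m \<otimes> p x b"
    using insert.prems(3)[of x] mb by (simp add: hom_def)
  ultimately have "b = \<one>" using insert.prems(8)[of x] mb by simp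
  then have gm: "g = m" using mb M.subset by auto
  show ?case
  proof (rule insert.IH)
    show "g \<in> ?M" using gm mb by simp
  next
    show "generate G (N \<union> (\<Union>x\<in>F'. B x)) \<lhd> G" if "F' \<subseteq> F" for F'
      using insert.prems(2)[of F'] that by auto
  next
    show "p u y = \<one>" if "u \<in> F" "u' \<in> F" "u \<noteq> u'" "y \<in> B u'" for u u' y
      using insert.prems(5)[of u u' y] that by auto
  qed (use insert.prems in auto)
qed

text \<open>
  Every element of the subgroup generated by \<open>y\<close> and \<open>Y\<close> is a product of an element of \<open>\<langle>Y\<rangle>\<close> and a
  central one, and central factors cancel from commutators. So the commutators lie in \<open>\<langle>Y\<rangle>\<close>, which \<open>c\<close>
  centralises, although nothing is known about \<open>c\<close> and \<open>y\<close>.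
\<close>

lemma (in group) derived_commutes_if_generates_mod_center:
  assumes Y: "Y \<subseteq> carrier G" and y: "y \<in> carrier G" and z: "z \<in> carrier G"
    and zY: "\<And>u. u \<in> insert y Y \<Longrightarrow> z \<otimes> u = u \<otimes> z"
    and gen: "y \<in> generate G (insert z Y)"
    and c: "c \<in> carrier G" and cY: "\<And>u. u \<in> Y \<Longrightarrow> c \<otimes> u = u \<otimes> c"
    and d: "d \<in> derived G (generate G (insert y Y))"
  shows "c \<otimes> d = d \<otimes> c"
proof -
  let ?H = "generate G (insert y Y)" and ?K = "generate G Y"
  have YH: "insert y Y \<subseteq> carrier G" using Y y by auto
  interpret H: subgroup ?H G by (rule generate_is_subgroup[OF YH])
  interpret K: subgroup ?K G by (rule generate_is_subgroup[OF Y])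
  define C where "C = {x \<in> carrier G. \<forall>b\<in>?H. x \<otimes> b = b \<otimes> x}"
  interpret C: subgroup C G unfolding C_def by (rule subgroup_centralizer) (rule H.subset)
  have KH: "?K \<subseteq> ?H" by (rule mono_generate) auto
  have "z \<otimes> b = b \<otimes> z" if "b \<in> ?H" for b
    by (rule commute_generate[of "{z}" "insert y Y"]) (use z YH zY that generate.incl[of z] in auto)
  then have zC: "z \<in> C" using z unfolding C_def by blast
  have C_comm: "c' \<otimes> b = b \<otimes> c'" if "c' \<in> C" "b \<in> ?H" for c' b
    using that unfolding C_def by blast
  have inv_c: "inv k \<otimes> c' = c' \<otimes> inv k" if "k \<in> ?K" "c' \<in> C" for k c'
    using C_comm[OF that(2)] K.m_inv_closed[OF that(1)] KH by (metis subsetD)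
  have sub: "subgroup (?K <#> C) G"
  proof (rule subgroupI)
    show "?K <#> C \<subseteq> carrier G" using K.subset C.subset by (rule set_mult_closed)
    show "?K <#> C \<noteq> {}" unfolding set_mult_def using K.one_closed C.one_closed by blast
  next
    fix x assume "x \<in> ?K <#> C"
    then obtain k c' where kc: "k \<in> ?K" "c' \<in> C" "x = k \<otimes> c'" by (auto simp: set_mult_def)
    then have "inv x = inv k \<otimes> inv c'"
      using inv_c[OF kc(1) C.m_inv_closed[OF kc(2)]] by (simp add: inv_mult_group)
    then show "inv x \<in> ?K <#> C" using kc by (auto simp: set_mult_def)
  next
    fix x x' assume "x \<in> ?K <#> C" "x' \<in> ?K <#> C"
    then obtain k c' k' c'' where kc: "k \<in> ?K" "c' \<in> C" "x = k \<otimes> c'"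
      "k' \<in> ?K" "c'' \<in> C" "x' = k' \<otimes> c''" by (auto simp: set_mult_def)
    then have comm: "c' \<otimes> k' = k' \<otimes> c'" using KH C_comm by blast
    have "x \<otimes> x' = k \<otimes> (c' \<otimes> k') \<otimes> c''" using kc by (simp add: m_assoc)
    also have "\<dots> = (k \<otimes> k') \<otimes> (c' \<otimes> c'')" unfolding comm using kc by (simp add: m_assoc)
    finally show "x \<otimes> x' \<in> ?K <#> C" using kc by (auto simp: set_mult_def)
  qed
  have one: "u = u \<otimes> \<one>" "u = \<one> \<otimes> u" if "u \<in> carrier G" for u using that by auto
  have Yin: "Y \<subseteq> ?K <#> C"
    using one(1) Y generate.incl[of _ Y G] C.one_closed unfolding set_mult_def by blast
  moreover have "z \<in> ?K <#> C"
    using one(2) z zC K.one_closed unfolding set_mult_def by blast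
  ultimately have "y \<in> ?K <#> C" using generate_subgroup_incl[OF _ sub, of "insert z Y"] gen by blast
  then have HKC: "?H \<subseteq> ?K <#> C" using generate_subgroup_incl[OF _ sub, of "insert y Y"] Yin by blast
  have cK: "c \<otimes> k = k \<otimes> c" if "k \<in> ?K" for k
    by (rule commute_generate[of "{c}" Y]) (use c Y cY that generate.incl[of c] in auto)
  have "c \<otimes> u = u \<otimes> c" if "u \<in> derived_set G ?H" for u
  proof -
    obtain h1 h2 where h: "h1 \<in> ?H" "h2 \<in> ?H" "u = h1 \<otimes> h2 \<otimes> inv h1 \<otimes> inv h2"
      using \<open>u \<in> derived_set G ?H\<close> by auto
    have "\<exists>k\<in>?K. \<exists>c'\<in>C. h = k \<otimes> c'" if "h \<in> ?H" for h
      using subsetD[OF HKC that] by (simp add: set_mult_def)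
    then obtain k1 c1 k2 c2 where kc: "k1 \<in> ?K" "c1 \<in> C" "h1 = k1 \<otimes> c1"
      "k2 \<in> ?K" "c2 \<in> C" "h2 = k2 \<otimes> c2" using h(1,2) by meson
    have "c2 = inv k2 \<otimes> h2" using kc by simp
    then have "c2 \<in> ?H" using H.m_closed[OF H.m_inv_closed h(2)] kc(4) KH by auto
    then have cc: "c1 \<otimes> c2 = c2 \<otimes> c1" using C_comm[OF kc(2)] by blast
    have comm: "c1 \<otimes> k2 = k2 \<otimes> c1" using C_comm[OF kc(2)] kc(4) KH by blast
    have car: "k1 \<in> carrier G" "k2 \<in> carrier G" "c1 \<in> carrier G" "c2 \<in> carrier G" using kc by auto
    have "h1 \<otimes> h2 = (k1 \<otimes> k2) \<otimes> (c1 \<otimes> c2)"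
      using kc(3,6) comm car by (metis m_assoc m_closed)
    moreover have "h2 \<otimes> h1 = (k2 \<otimes> k1) \<otimes> (c1 \<otimes> c2)"
    proof -
      have "c2 \<otimes> k1 = k1 \<otimes> c2" using C_comm[OF kc(5)] kc(1) KH by blast
      then show ?thesis using kc(3,6) cc car by (metis m_assoc m_closed)
    qed
    moreover have "u = (h1 \<otimes> h2) \<otimes> inv (h2 \<otimes> h1)" using h by (simp add: m_assoc inv_mult_group)
    ultimately have "u = k1 \<otimes> k2 \<otimes> inv (k2 \<otimes> k1)"
      using car by (simp add: m_assoc inv_mult_group)
    then have "u \<in> ?K" using kc by simp
    then show ?thesis using cK by simp
  qed
  then show ?thesis
    using commute_generate[of "{c}" "derived_set G ?H" c d] c d generate.incl[of c "{c}" G]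
      derived_set_in_carrier[OF H.subset] unfolding derived_def by blast
qed

text \<open>
  The abstract form of the situation: \<open>I\<close> plays the role of the edge set, \<open>\<X>\<close> that of the edge sets of
  the maximal cliques, and \<open>p X\<close> is the retraction onto the subgroup belonging to \<open>X\<close>. Retractions onto
  single generators are included because they detect an element modulo commutators.
\<close>

locale retract_cover = group G for G (structure) +
  fixes I :: "'i set" and a :: "'i \<Rightarrow> 'a" and \<X> :: "'i set set" and p :: "'i set \<Rightarrow> 'a \<Rightarrow> 'a"
  assumes finite_I: "finite I"
    and a_closed: "e \<in> I \<Longrightarrow> a e \<in> carrier G"
    and generate_a: "generate G (a ` I) = carrier G"
    and cover: "\<Union>\<X> = I"
    and p_hom: "X \<in> \<X> \<union> (\<lambda>e. {e}) ` I \<Longrightarrow> p X \<in> hom G G"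
    and p_gen: "X \<in> \<X> \<union> (\<lambda>e. {e}) ` I \<Longrightarrow> e \<in> I \<Longrightarrow> p X (a e) = (if e \<in> X then a e else \<one>)"
    and commute: "e \<in> I \<Longrightarrow> f \<in> I \<Longrightarrow> (\<And>X. X \<in> \<X> \<Longrightarrow> \<not> {e, f} \<subseteq> X) \<Longrightarrow> a e \<otimes> a f = a f \<otimes> a e"
    and almost_commute: "X \<in> \<X> \<Longrightarrow> f \<in> I - X \<Longrightarrow> \<exists>e. \<forall>e'\<in>X - {e}. a f \<otimes> a e' = a e' \<otimes> a f"
    and center: "X \<in> \<X> \<Longrightarrow> e \<in> X \<Longrightarrow> \<exists>z\<in>carrier G.
       (\<forall>e'\<in>X. z \<otimes> a e' = a e' \<otimes> z) \<and> a e \<in> generate G (insert z (a ` (X - {e})))"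
    and almost_disjoint: "X \<in> \<X> \<Longrightarrow> Y \<in> \<X> \<Longrightarrow> X \<noteq> Y \<Longrightarrow> \<exists>e. X \<inter> Y \<subseteq> {e}"
begin

abbreviation H where "H X \<equiv> generate G (a ` X)"
abbreviation D where "D X \<equiv> derived G (H X)"

lemma \<X>_subset: "X \<in> \<X> \<Longrightarrow> X \<subseteq> I"
  using cover by blast

lemma a_image: "X \<subseteq> I \<Longrightarrow> a ` X \<subseteq> carrier G"
  using a_closed by blast

lemma H_carrier: "X \<subseteq> I \<Longrightarrow> H X \<subseteq> carrier G"
  by (rule generate_incl[OF a_image])

lemma D_subset: "X \<subseteq> I \<Longrightarrow> D X \<subseteq> H X"
  by (rule derived_incl[OF _ generate_is_subgroup[OF a_image]]) auto

lemma D_subgroup: "X \<subseteq> I \<Longrightarrow> subgroup (D X) G"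
  by (rule derived_is_subgroup[OF H_carrier])

lemma commutator_in_D:
  assumes "X \<subseteq> I" "e \<in> X" "f \<in> X"
  shows "a e \<otimes> a f \<otimes> inv (a e) \<otimes> inv (a f) \<in> D X"
proof -
  have "a e \<in> H X" "a f \<in> H X" using assms by (simp_all add: generate.incl)
  then have "a e \<otimes> a f \<otimes> inv (a e) \<otimes> inv (a f) \<in> derived_set G (H X)"
    by (intro UN_I[of "a e"] UN_I[of "a f"]) simp_all
  then show ?thesis unfolding derived_def by (rule generate.incl)
qed

text \<open>
  The exceptional generator of \<open>X\<close>, with which \<open>a f\<close> need not commute, is redundant modulo the centre.
\<close>

lemma outer_commutes_D:
  assumes X: "X \<in> \<X>" and f: "f \<in> I - X" and d: "d \<in> D X"
  shows "a f \<otimes> d = d \<otimes> a f"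
proof -
  obtain e where e: "\<And>e'. e' \<in> X - {e} \<Longrightarrow> a f \<otimes> a e' = a e' \<otimes> a f"
    using almost_commute[OF X f] by blast
  note XI = \<X>_subset[OF X]
  show ?thesis
  proof (cases "e \<in> X")
    case True
    then obtain z where z: "z \<in> carrier G" "\<And>e'. e' \<in> X \<Longrightarrow> z \<otimes> a e' = a e' \<otimes> z"
      "a e \<in> generate G (insert z (a ` (X - {e})))" using center[OF X] by blast
    have "insert (a e) (a ` (X - {e})) = a ` X" using True by auto
    then show ?thesis
      using derived_commutes_if_generates_mod_center[of "a ` (X - {e})" "a e" z "a f" d]
        z e f d True a_image[OF XI] a_closed by (auto simp: image_subset_iff)
  next
    case False
    then have "\<And>x. x \<in> a ` X \<Longrightarrow> a f \<otimes> x = x \<otimes> a f" using e by auto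
    moreover have "d \<in> H X" using d D_subset[OF XI] by blast
    ultimately show ?thesis
      using commute_generate[of "{a f}" "a ` X" "a f" d] a_image[OF XI] f a_closed
        generate.incl[of "a f" "{a f}" G] by auto
  qed
qed

text \<open>
  Generators in \<open>X\<close> normalise the commutator subgroup of their own span, and the others centralise it.
\<close>

lemma conj_D:
  assumes X: "X \<in> \<X>" and f: "f \<in> I" and d: "d \<in> D X"
  shows "a f \<otimes> d \<otimes> inv (a f) \<in> D X" "inv (a f) \<otimes> d \<otimes> a f \<in> D X"
proof -
  note XI = \<X>_subset[OF X]
  have dc: "d \<in> carrier G" using d D_subset[OF XI] H_carrier[OF XI] by blast
  have af: "a f \<in> carrier G" using f a_closed by simp
  have "a f \<otimes> d \<otimes> inv (a f) \<in> D X \<and> inv (a f) \<otimes> d \<otimes> a f \<in> D X"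
  proof (cases "f \<in> X")
    case True
    have sub: "subgroup (H X) G" by (rule generate_is_subgroup[OF a_image[OF XI]])
    interpret H: group "G\<lparr>carrier := H X\<rparr>" by (rule subgroup.subgroup_is_group[OF sub is_group])
    have "derived (G\<lparr>carrier := H X\<rparr>) (H X) = D X"
      by (rule derived_consistent[OF _ sub]) auto
    then have "D X \<lhd> G\<lparr>carrier := H X\<rparr>" using H.derived_is_normal[OF H.normal_self] by simp
    then interpret N: normal "D X" "G\<lparr>carrier := H X\<rparr>" .
    have fH: "a f \<in> H X" using True by (auto intro: generate.incl)
    show ?thesis using N.inv_op_closed1[of "a f" d] N.inv_op_closed2[of "a f" d] fH d
      by (simp add: m_inv_consistent[OF sub])
  next
    case False
    then have eq: "a f \<otimes> d = d \<otimes> a f" using outer_commutes_D[OF X _ d] f by blast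
    have "a f \<otimes> d \<otimes> inv (a f) = d" unfolding eq using af dc by (simp add: m_assoc)
    moreover have "inv (a f) \<otimes> d \<otimes> a f = inv (a f) \<otimes> (a f \<otimes> d)"
      unfolding eq using af dc by (simp add: m_assoc)
    ultimately show ?thesis using d af dc by simp
  qed
  then show "a f \<otimes> d \<otimes> inv (a f) \<in> D X" "inv (a f) \<otimes> d \<otimes> a f \<in> D X" by auto
qed

lemma D_carrier: "X \<in> \<X> \<Longrightarrow> D X \<subseteq> carrier G"
  using subset_trans[OF D_subset[OF \<X>_subset] H_carrier[OF \<X>_subset]] .

lemma normal_generate_D:
  assumes "\<Y> \<subseteq> \<X>"
  shows "generate G (\<Union>X\<in>\<Y>. D X) \<lhd> G"
proof (rule normal_generate_if_conj_generators[OF a_image[OF order_refl] generate_a])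
  show "(\<Union>X\<in>\<Y>. D X) \<subseteq> carrier G" using D_carrier[OF subsetD[OF assms]] by (rule UN_least)
  fix s x assume "s \<in> a ` I" "x \<in> (\<Union>X\<in>\<Y>. D X)"
  then obtain f X where f: "f \<in> I" "s = a f" and X: "X \<in> \<Y>" "x \<in> D X" by blast
  then have "X \<in> \<X>" using assms by blast
  from conj_D[OF this f(1) X(2)]
  show "s \<otimes> x \<otimes> inv s \<in> generate G (\<Union>X\<in>\<Y>. D X)" "inv s \<otimes> x \<otimes> s \<in> generate G (\<Union>X\<in>\<Y>. D X)"
    using f(2) X(1) by (auto intro: generate.incl)
qed

text \<open>
  The map sends all generators of \<open>Y\<close> but at most one to \<open>1\<close>, so its image on their span is cyclic.
\<close>

lemma p_D:
  assumes X: "X \<in> \<X> \<union> (\<lambda>e. {e}) ` I" and Y: "Y \<in> \<X>" and e: "X \<inter> Y \<subseteq> {e}" and d: "d \<in> D Y"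
  shows "p X d = \<one>"
proof -
  interpret p: group_hom G G "p X"
    by (intro group_hom.intro group_hom_axioms.intro p_hom[OF X] is_group)
  note YI = \<X>_subset[OF Y]
  have comm: "p X s \<otimes> p X t = p X t \<otimes> p X s" if st: "s \<in> H Y" "t \<in> H Y" for s t
  proof -
    have img: "generate G (p X ` a ` Y) = p X ` H Y" by (rule p.generate_img[OF a_image[OF YI]])
    have gens: "p X y = \<one> \<or> p X y = a e \<and> e \<in> I" if y: "y \<in> a ` Y" for y
    proof -
      obtain f where f: "f \<in> Y" "y = a f" using y by blast
      then have "f \<in> X \<Longrightarrow> f = e" "f \<in> I" using e YI by blast+
      then show ?thesis using p_gen[OF X, of f] f(2) by (cases "f \<in> X") simp_all
    qed
    show ?thesis
    proof (rule commute_generate[of "p X ` a ` Y" "p X ` a ` Y"])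
      show "p X ` a ` Y \<subseteq> carrier G" "p X ` a ` Y \<subseteq> carrier G"
        using gens a_closed by (force, force)
      show "u \<otimes> v = v \<otimes> u" if "u \<in> p X ` a ` Y" "v \<in> p X ` a ` Y" for u v
        using that gens a_closed by (elim imageE[of _ "p X"]) (metis l_one r_one)
      show "p X s \<in> generate G (p X ` a ` Y)" "p X t \<in> generate G (p X ` a ` Y)"
        unfolding img using st by auto
    qed
  qed
  have "p X u = \<one>" if u: "u \<in> derived_set G (H Y)" for u
  proof -
    obtain s t where st: "s \<in> H Y" "t \<in> H Y" "u = s \<otimes> t \<otimes> inv s \<otimes> inv t"
      using u by auto
    then have c: "s \<in> carrier G" "t \<in> carrier G" using H_carrier[OF YI] by auto
    have "p X u = (p X s \<otimes> p X t) \<otimes> inv (p X t \<otimes> p X s)"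
      using c unfolding st(3) by (simp add: inv_mult_group m_assoc)
    then show ?thesis using comm[OF st(1,2)] c by simp
  qed
  then show ?thesis
    by (rule hom_trivial_on_generate[OF is_group is_group p_hom[OF X]
          derived_set_in_carrier[OF H_carrier[OF YI]] _ d[unfolded derived_def]])
qed

abbreviation N where "N \<equiv> generate G (\<Union>X\<in>\<X>. D X)"

lemma N_subset: "N \<subseteq> carrier G"
  using D_carrier by (intro generate_incl UN_least) auto

lemma commutator_in_N:
  assumes "e \<in> I" "f \<in> I"
  shows "a e \<otimes> a f \<otimes> inv (a e) \<otimes> inv (a f) \<in> N"
proof (cases "\<exists>X\<in>\<X>. e \<in> X \<and> f \<in> X")
  case True
  then obtain X where X: "X \<in> \<X>" "e \<in> X" "f \<in> X" by auto
  have "a e \<otimes> a f \<otimes> inv (a e) \<otimes> inv (a f) \<in> D X"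
    by (rule commutator_in_D[OF \<X>_subset[OF X(1)] X(2,3)])
  then show ?thesis by (rule generate.incl[OF UN_I[OF X(1)]])
next
  case False
  have "a e \<otimes> a f = a f \<otimes> a e"
    by (rule commute[OF assms]) (use False in auto)
  then have "a e \<otimes> a f \<otimes> inv (a e) \<otimes> inv (a f) = \<one>"
    using a_closed[OF assms(1)] a_closed[OF assms(2)] by (simp add: m_assoc)
  then show ?thesis by (simp add: generate.one)
qed

text \<open>
  Subgroups that contain all commutators are normal; here it suffices to test generators.
\<close>

lemma normal_generate_N_Un:
  assumes F: "F \<subseteq> I"
  shows "generate G (N \<union> (\<Union>e\<in>F. generate G {a e})) \<lhd> G" (is "generate G ?A \<lhd> G")
proof -
  interpret N: normal N G by (rule normal_generate_D) simp
  have N_A: "N \<subseteq> generate G (N \<union> a ` F)" by (auto intro: generate.incl)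
  have ac: "N \<union> a ` F \<subseteq> carrier G" using a_closed F N_subset by blast
  have sub: "subgroup (generate G (N \<union> a ` F)) G" by (rule generate_is_subgroup[OF ac])
  have "generate G {a e} \<subseteq> generate G (N \<union> a ` F)" if "e \<in> F" for e
    by (rule mono_generate) (use that in auto)
  then have "?A \<subseteq> generate G (N \<union> a ` F)" using N_A by blast
  moreover have "N \<union> a ` F \<subseteq> ?A" by (auto intro: generate.incl)
  moreover have "?A \<subseteq> carrier G"
    using calculation(1) subgroup.subset[OF sub] by blast
  ultimately have eq: "generate G ?A = generate G (N \<union> a ` F)"
    using generate_subgroup_incl[OF _ sub, of ?A] mono_generate[of "N \<union> a ` F" ?A] by blast
  interpret S: subgroup "generate G (N \<union> a ` F)" G by (rule sub)
  show ?thesis unfolding eq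
  proof (rule normal_generate_if_conj_generators[OF a_image[OF order_refl] generate_a ac])
    fix s x assume s: "s \<in> a ` I" and x: "x \<in> N \<union> a ` F"
    then obtain e where e: "e \<in> I" "s = a e" by blast
    have sc: "s \<in> carrier G" using e a_closed by simp
    have "s \<otimes> x \<otimes> inv s \<in> generate G (N \<union> a ` F) \<and> inv s \<otimes> x \<otimes> s \<in> generate G (N \<union> a ` F)"
    proof (cases "x \<in> N")
      case True
      then show ?thesis using N.inv_op_closed1[OF sc] N.inv_op_closed2[OF sc] N_A by blast
    next
      case False
      then obtain f where f: "f \<in> F" "x = a f" using x by blast
      have xc: "x \<in> carrier G" using f a_closed F by blast
      have xA: "x \<in> generate G (N \<union> a ` F)" using f by (auto intro: generate.incl)
      have c1: "s \<otimes> x \<otimes> inv s \<otimes> inv x \<in> N" using commutator_in_N e f F by blast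
      have "x \<otimes> s \<otimes> inv x \<otimes> inv s \<in> N" using commutator_in_N e f F by blast
      then have "inv s \<otimes> (x \<otimes> s \<otimes> inv x \<otimes> inv s) \<otimes> s \<in> N"
        using N.inv_op_closed1[OF sc] by blast
      then have c2: "inv s \<otimes> x \<otimes> s \<otimes> inv x \<in> N" using sc xc by (simp add: m_assoc)
      have "s \<otimes> x \<otimes> inv s = (s \<otimes> x \<otimes> inv s \<otimes> inv x) \<otimes> x"
        "inv s \<otimes> x \<otimes> s = (inv s \<otimes> x \<otimes> s \<otimes> inv x) \<otimes> x"
        using sc xc by (simp_all add: m_assoc)
      then show ?thesis
        using S.m_closed[OF subsetD[OF N_A c1] xA] S.m_closed[OF subsetD[OF N_A c2] xA] by simp
    qed
    then show "s \<otimes> x \<otimes> inv s \<in> generate G (N \<union> a ` F)"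
      "inv s \<otimes> x \<otimes> s \<in> generate G (N \<union> a ` F)" by auto
  qed
qed

lemma p_id_on_H:
  assumes X: "X \<in> \<X> \<union> (\<lambda>e. {e}) ` I" and x: "x \<in> H X"
  shows "p X x = x"
proof -
  have XI: "X \<subseteq> I" using X \<X>_subset[of X] by auto
  show ?thesis
  proof (rule hom_eq_on_generate[OF is_group is_group p_hom[OF X] _ a_image[OF XI] _ x])
    show "(\<lambda>x. x) \<in> hom G G" by (simp add: hom_def)
    show "p X s = s" if s: "s \<in> a ` X" for s
    proof -
      obtain e where "e \<in> X" "s = a e" using s by blast
      then show ?thesis using p_gen[OF X, of e] XI by auto
    qed
  qed
qed

text \<open>
  First the generators \<open>a e\<close> are stripped off, which leaves an element of \<open>N\<close>, and then the subgroups
  \<open>D X\<close>. The first step uses that \<open>p {e}\<close> factors through \<open>p X\<close> for any \<open>X\<close> that contains \<open>e\<close>.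
\<close>

theorem joint_kernel_trivial:
  assumes g: "g \<in> carrier G" and pg: "\<And>X. X \<in> \<X> \<Longrightarrow> p X g = \<one>"
  shows "g = \<one>"
proof -
  have p_edge: "p {e} g = \<one>" if e: "e \<in> I" for e
  proof -
    obtain X where X: "X \<in> \<X>" "e \<in> X" using cover e by blast
    have eX: "{e} \<in> \<X> \<union> (\<lambda>e. {e}) ` I" using e by blast
    have "(p {e} \<circ> p X) g = p {e} g"
    proof (rule hom_eq_on_generate[OF is_group is_group _ p_hom[OF eX] a_image[OF order_refl]])
      show "p {e} \<circ> p X \<in> hom G G"
        by (rule Group.hom_compose[OF p_hom p_hom[OF eX]]) (use X in simp)
      fix s assume "s \<in> a ` I"
      moreover have "p {e} \<one> = \<one>"
        using hom_one[OF p_hom[OF eX]] is_group by simp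
      ultimately show "(p {e} \<circ> p X) s = p {e} s"
        using p_gen[of X] p_gen[OF eX] X by auto
    qed (use g generate_a in simp)
    moreover have "p {e} \<one> = \<one>" using hom_one[OF p_hom[OF eX]] is_group by simp
    ultimately show ?thesis using pg[OF X(1)] by simp
  qed
  have gN: "g \<in> N"
  proof (rule strip_normal_factors[where B = "\<lambda>e. generate G {a e}" and p = "\<lambda>e. p {e}", OF finite_I])
    show "N \<lhd> G" by (rule normal_generate_D) simp
    show "p {e} y = \<one>" if "e \<in> I" "y \<in> N" for e y
    proof (rule hom_trivial_on_generate[OF is_group is_group p_hom _ _ that(2)])
      show "p {e} s = \<one>" if "s \<in> (\<Union>X\<in>\<X>. D X)" for s
        using that p_D[of "{e}" _ e s] \<open>e \<in> I\<close> by auto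
    qed (use that D_carrier in auto)
    show "p {e} y = \<one>" if "e \<in> I" "e' \<in> I" "e \<noteq> e'" "y \<in> generate G {a e'}" for e e' y
      by (rule hom_trivial_on_generate[OF is_group is_group p_hom _ _ that(4)])
         (use that p_gen[of "{e}" e'] a_closed in auto)
    show "p {e} y = y" if "e \<in> I" "y \<in> generate G {a e}" for e y
      using p_id_on_H[of "{e}" y] that by auto
    have "a ` I \<subseteq> generate G (N \<union> (\<Union>e\<in>I. generate G {a e}))"
      by (blast intro: generate.incl)
    moreover have "subgroup (generate G (N \<union> (\<Union>e\<in>I. generate G {a e}))) G"
      by (rule normal_imp_subgroup[OF normal_generate_N_Un[OF order_refl]])
    ultimately show "g \<in> generate G (N \<union> (\<Union>e\<in>I. generate G {a e}))"
      using generate_subgroup_incl[of "a ` I"] g generate_a by auto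
    show "generate G (N \<union> (\<Union>e\<in>F. generate G {a e})) \<lhd> G" if "F \<subseteq> I" for F
      by (rule normal_generate_N_Un[OF that])
  qed (use p_hom p_edge a_closed generate_is_subgroup in auto)
  have one_Un: "generate G ({\<one>} \<union> (\<Union>X\<in>F. D X)) = generate G (\<Union>X\<in>F. D X)" if "F \<subseteq> \<X>" for F
  proof (rule equalityI)
    show "generate G ({\<one>} \<union> (\<Union>X\<in>F. D X)) \<subseteq> generate G (\<Union>X\<in>F. D X)"
      using normal_generate_D[OF that] normal_imp_subgroup
      by (intro generate_subgroup_incl) (auto intro: generate.intros)
    show "generate G (\<Union>X\<in>F. D X) \<subseteq> generate G ({\<one>} \<union> (\<Union>X\<in>F. D X))"
      by (rule mono_generate) auto
  qed
  have "g \<in> {\<one>}"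
  proof (rule strip_normal_factors[where F = \<X> and B = D and p = p])
    show "finite \<X>" using cover finite_I finite_UnionD by blast
    show "{\<one>} \<lhd> G" by (rule one_is_normal)
    show "generate G ({\<one>} \<union> (\<Union>X\<in>F. D X)) \<lhd> G" if "F \<subseteq> \<X>" for F
      using normal_generate_D[OF that] one_Un[OF that] by simp
    show "g \<in> generate G ({\<one>} \<union> (\<Union>X\<in>\<X>. D X))" using one_Un gN by simp
    show "p X y = \<one>" if "X \<in> \<X>" "Y \<in> \<X>" "X \<noteq> Y" "y \<in> D Y" for X Y y
      using almost_disjoint[OF that(1-3)] p_D[of X Y _ y] that by auto
    show "p X y = y" if "X \<in> \<X>" "y \<in> D X" for X y
      using p_id_on_H[of X y] D_subset[of X] \<X>_subset[of X] that by auto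
    show "p X y = \<one>" if "X \<in> \<X>" "y \<in> {\<one>}" for X y
      using hom_one[OF p_hom[of X]] that is_group by simp
  qed (use pg p_hom D_subgroup \<X>_subset in auto)
  then show ?thesis by simp
qed

end

section \<open>Artin elements in groups satisfying the braid relations\<close>

text \<open>
  The order in which the Artin generators have to be multiplied to give the full twist:
  \<open>(1,2)\<close>, \<open>(1,3)\<close>, \<open>(2,3)\<close>, \<open>(1,4)\<close>, and so on.
\<close>

primrec index_pairs :: "nat \<Rightarrow> (nat \<times> nat) list" where
  "index_pairs 0 = []"
| "index_pairs (Suc m) = index_pairs m @ map (\<lambda>i. (i, Suc m)) [1..<Suc m]"

lemma set_index_pairs: "set (index_pairs m) = {(i, j). 1 \<le> i \<and> i < j \<and> j \<le> m}"
proof (induction m)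
  case (Suc m)
  show ?case unfolding index_pairs.simps set_append Suc by (auto simp: less_Suc_eq)
qed simp

lemma distinct_index_pairs: "distinct (index_pairs m)"
proof (induction m)
  case (Suc m)
  have "distinct (map (\<lambda>i. (i, Suc m)) [1..<Suc m])" by (simp only: distinct_map) (simp add: inj_on_def)
  moreover have "set (index_pairs m) \<inter> set (map (\<lambda>i. (i, Suc m)) [1..<Suc m]) = {}"
    unfolding set_index_pairs by auto
  ultimately show ?case using Suc by (simp only: index_pairs.simps distinct_append simp_thms)
qed simp

text \<open>
  The calculations with Artin generators use the braid relations only, and are easier with group
  elements than with words.
\<close>

locale braid_elements = group G for G (structure) +
  fixes s :: "nat \<Rightarrow> 'a" and n :: nat
  assumes s_closed: "1 \<le> k \<Longrightarrow> k < n \<Longrightarrow> s k \<in> carrier G"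
    and far: "1 \<le> i \<Longrightarrow> i + 2 \<le> j \<Longrightarrow> j < n \<Longrightarrow> s i \<otimes> s j = s j \<otimes> s i"
    and braid: "1 \<le> i \<Longrightarrow> Suc i < n \<Longrightarrow> s i \<otimes> s (Suc i) \<otimes> s i = s (Suc i) \<otimes> s i \<otimes> s (Suc i)"
begin

lemma far_conj: "1 \<le> i \<Longrightarrow> 1 \<le> j \<Longrightarrow> i < n \<Longrightarrow> j < n \<Longrightarrow> i + 2 \<le> j \<or> j + 2 \<le> i \<Longrightarrow> conj_to (s i) (s j) (s j)"
  using far[of i j] far[of j i] s_closed[of i] s_closed[of j] by (auto simp: conj_to_def)

text \<open>
  The element of \<open>artin_word\<close>, by recursion on the larger index. The recursion starts with \<open>s i \<otimes> s i\<close>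
  at \<open>j = Suc i\<close>; this is also the default value for \<open>j \<le> i\<close>.
\<close>

primrec art :: "nat \<Rightarrow> nat \<Rightarrow> 'a" where
  "art i 0 = s i \<otimes> s i"
| "art i (Suc j) = (if j \<le> i then s i \<otimes> s i else s j \<otimes> art i j \<otimes> inv (s j))"

declare art.simps [simp del]

lemma art_base: "art i (Suc i) = s i \<otimes> s i"
  by (simp add: art.simps)

lemma art_closed: "1 \<le> i \<Longrightarrow> i < j \<Longrightarrow> j \<le> n \<Longrightarrow> art i j \<in> carrier G"
  by (induction j) (auto simp: art.simps s_closed)

lemma raise_upper:
  "1 \<le> i \<Longrightarrow> i < j \<Longrightarrow> j < n \<Longrightarrow> conj_to (s j) (art i j) (art i (Suc j))"
  using conj_to_conj[OF s_closed[of j] art_closed[of i j]] by (auto simp: art.simps)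

lemma conj_to_art:
  assumes "1 \<le> i" "i < j" "j \<le> n" and x: "\<And>k. i \<le> k \<Longrightarrow> k < j \<Longrightarrow> conj_to x (s k) (s k)"
  shows "conj_to x (art i j) (art i j)"
  using assms(2,3) x
proof (induction j)
  case (Suc j)
  show ?case
  proof (cases "i = j")
    case True
    then show ?thesis using conj_to_mult[of x "s i" "s i" "s i" "s i"] Suc.prems by (simp add: art_base)
  next
    case False
    then have ij: "i < j" using Suc.prems by simp
    have "conj_to x (art i j) (art i j)" using Suc ij by simp
    moreover have "x \<otimes> s j = s j \<otimes> x" using Suc.prems(3)[of j] ij by (simp add: conj_to_def)
    ultimately show ?thesis
      using conj_to_commute_self[OF raise_upper[of i j]] assms(1) ij Suc.prems by simp
  qed
qed simp

text \<open>
  \<open>s i\<close> moves the lower strand up. The definition favours the upper strand, so this is where the braid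
  relation enters: it conjugates \<open>s i\<close> into \<open>s (Suc i)\<close>.
\<close>

lemma raise_lower:
  "1 \<le> i \<Longrightarrow> Suc i < j \<Longrightarrow> j \<le> n \<Longrightarrow> conj_to (s i) (art i j) (art (Suc i) j)"
proof (induction j)
  case (Suc j)
  note c = s_closed[of i] s_closed[of "Suc i"]
  show ?case
  proof (cases "j = Suc i")
    case True
    have "conj_to (s i \<otimes> s (Suc i)) (s i) (s (Suc i))"
      using braid[of i] c Suc.prems True by (simp add: conj_to_def m_assoc)
    from conj_to_mult[OF this this]
    have "conj_to (s i \<otimes> s (Suc i)) (art i (Suc i)) (art (Suc i) (Suc (Suc i)))"
      by (simp add: art_base)
    then show ?thesis
      using conj_to_factor[OF _ raise_upper[of i "Suc i"]] Suc.prems True c by simp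
  next
    case False
    then have ij: "Suc i < j" using Suc.prems by simp
    have 1: "conj_to (s j) (art i j) (art i (Suc j))" using ij Suc.prems raise_upper by simp
    have "conj_to (s j \<otimes> s i) (art i j) (art (Suc i) (Suc j))"
      using conj_to_trans[OF Suc.IH raise_upper[of "Suc i" j]] ij Suc.prems by simp
    moreover have "s j \<otimes> s i = s i \<otimes> s j" using far[of i j] ij Suc.prems by simp
    ultimately show ?thesis using conj_to_factor[OF _ 1, of "s i"] c Suc.prems by simp
  qed
qed simp

text \<open>
  A crossing strictly between the two strands of an Artin generator commutes with it. For \<open>j = k + 2\<close> the
  generator arises from that on the strands \<open>i\<close> and \<open>k\<close> by conjugation with \<open>s (k+1) \<otimes> s k\<close>, and moving
  \<open>s k\<close> past this braid turns it into \<open>s (k+1)\<close>, which is far from the strands \<open>i\<close> and \<open>k\<close>.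
\<close>

lemma conj_between:
  "1 \<le> i \<Longrightarrow> i < k \<Longrightarrow> Suc k < j \<Longrightarrow> j \<le> n \<Longrightarrow> conj_to (s k) (art i j) (art i j)"
proof (induction j)
  case (Suc j)
  note c = s_closed[of k] s_closed[of "Suc k"]
  show ?case
  proof (cases "j = Suc k")
    case True
    have 1: "conj_to (s (Suc k)) (art i k) (art i k)"
      using Suc.prems True by (intro conj_to_art far_conj) auto
    have "conj_to (s (Suc k) \<otimes> s k) (art i k) (art i (Suc (Suc k)))"
      using conj_to_trans[OF raise_upper[of i k] raise_upper[of i "Suc k"]] Suc.prems True by simp
    note 2 = this conj_to_trans[OF 1 this]
    have "s (Suc k) \<otimes> s k \<otimes> s (Suc k) = s k \<otimes> (s (Suc k) \<otimes> s k)"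
      using braid[of k] c Suc.prems True by (simp add: m_assoc)
    then show ?thesis using conj_to_factor[OF _ 2(1), of "s k"] 2(2) c Suc.prems True by simp
  next
    case False
    then have kj: "Suc k < j" using Suc.prems by simp
    show ?thesis
      using conj_to_commute_self[OF raise_upper[of i j] Suc.IH] far[of k j] kj Suc.prems by simp
  qed
qed simp

lemma conj_disjoint:
  assumes "1 \<le> i" "i < j" "j \<le> n" "1 \<le> k" "k < n" "i \<notin> {k, Suc k}" "j \<notin> {k, Suc k}"
  shows "conj_to (s k) (art i j) (art i j)"
proof -
  consider "j < k" | "Suc k < i" | "i < k" "Suc k < j" using assms by force
  then show ?thesis
  proof cases
    case 3
    then show ?thesis using conj_between assms by simp
  qed (use assms in \<open>intro conj_to_art far_conj; simp\<close>)+
qed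

definition gens :: "'a set" where
  "gens = {art i j | i j. 1 \<le> i \<and> i < j \<and> j \<le> n}"

lemma art_in_gens: "1 \<le> i \<Longrightarrow> i < j \<Longrightarrow> j \<le> n \<Longrightarrow> art i j \<in> gens"
  by (auto simp: gens_def)

lemma gens_closed: "gens \<subseteq> carrier G"
  by (auto simp: gens_def art_closed)

text \<open>
  In the two cases where \<open>s k\<close> moves a strand of the generator down instead of up, it is the inverse of
  \<open>s k\<close> that yields an Artin generator.
\<close>

lemma conj_gens:
  assumes x: "x \<in> gens" and k: "1 \<le> k" "k < n"
  shows "\<exists>y\<in>gens. conj_to (s k) x y \<or> conj_to (s k) y x"
proof -
  obtain i j where ij: "x = art i j" "1 \<le> i" "i < j" "j \<le> n" using x by (auto simp: gens_def)
  consider "i = k" "j = Suc k" | "i \<notin> {k, Suc k}" "j \<notin> {k, Suc k}"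
    | "i = k" "Suc k < j" | "i = Suc k" | "j = k" | "j = Suc k" "i < k"
    using ij by force
  then show ?thesis
  proof cases
    case 1
    have "conj_to (s k) (s k) (s k)" using s_closed k by (simp add: conj_to_def)
    from conj_to_mult[OF this this] show ?thesis using ij 1 x by (auto simp: art_base)
  next
    case 2
    then show ?thesis using conj_disjoint[of i j k] ij k x by blast
  next
    case 3
    then show ?thesis using raise_lower[of k j] art_in_gens[of "Suc k" j] ij k by auto
  next
    case 4
    then show ?thesis using raise_lower[of k j] art_in_gens[of k j] ij k by auto
  next
    case 5
    then show ?thesis using raise_upper[of i k] art_in_gens[of i "Suc k"] ij k by auto
  next
    case 6
    then show ?thesis using raise_upper[of i k] art_in_gens[of i k] ij k by auto
  qed
qed

text \<open>
  The conjugate by the wrong one of \<open>s k\<close> and its inverse differs from an Artin generator by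
  conjugation with \<open>s k \<otimes> s k\<close>, which is itself an Artin generator.
\<close>

lemma conj_gens_in_generate:
  assumes x: "x \<in> gens" and k: "1 \<le> k" "k < n"
  shows "s k \<otimes> x \<otimes> inv (s k) \<in> generate G gens" "inv (s k) \<otimes> x \<otimes> s k \<in> generate G gens"
proof -
  interpret A: subgroup "generate G gens" G by (rule generate_is_subgroup[OF gens_closed])
  have sc: "s k \<in> carrier G" using s_closed k by simp
  have "art k (Suc k) \<in> gens" using art_in_gens k by simp
  then have ss: "s k \<otimes> s k \<in> generate G gens" by (simp add: art_base generate.incl)
  have xc: "x \<in> carrier G" using x gens_closed by auto
  obtain y where y: "y \<in> gens" "conj_to (s k) x y \<or> conj_to (s k) y x"
    using conj_gens[OF x k] by blast
  have yA: "y \<in> generate G gens" and yc: "y \<in> carrier G" using y gens_closed by (auto intro: generate.incl)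
  have "s k \<otimes> x \<otimes> inv (s k) \<in> generate G gens \<and> inv (s k) \<otimes> x \<otimes> s k \<in> generate G gens"
    using y(2)
  proof
    assume "conj_to (s k) x y"
    note e = conj_to_eq[OF this] conj_to_eq'[OF this]
    have "inv (s k) \<otimes> x \<otimes> s k = inv (s k \<otimes> s k) \<otimes> y \<otimes> (s k \<otimes> s k)"
      by (subst e(2)) (use sc yc in \<open>simp add: m_assoc inv_mult_group\<close>)
    moreover have "inv (s k \<otimes> s k) \<otimes> y \<otimes> (s k \<otimes> s k) \<in> generate G gens"
      by (intro A.m_closed A.m_inv_closed ss yA)
    ultimately show ?thesis using yA unfolding e(1)[symmetric] by simp
  next
    assume "conj_to (s k) y x"
    note e = conj_to_eq[OF this] conj_to_eq'[OF this]
    have "s k \<otimes> x \<otimes> inv (s k) = (s k \<otimes> s k) \<otimes> y \<otimes> inv (s k \<otimes> s k)"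
      by (subst e(1)) (use sc yc in \<open>simp add: m_assoc inv_mult_group\<close>)
    moreover have "(s k \<otimes> s k) \<otimes> y \<otimes> inv (s k \<otimes> s k) \<in> generate G gens"
      by (intro A.m_closed A.m_inv_closed ss yA)
    ultimately show ?thesis using yA unfolding e(2)[symmetric] by simp
  qed
  then show "s k \<otimes> x \<otimes> inv (s k) \<in> generate G gens" "inv (s k) \<otimes> x \<otimes> s k \<in> generate G gens"
    by auto
qed

text \<open>
  The strands \<open>1, \<dots>, m\<close> can be moved to any positions \<open>x 1 < \<dots> < x m\<close> by one braid that takes Artin
  generators to Artin generators. The induction moves back the first strand that is not in place; it
  always has a free position just below it.
\<close>

lemma transport:
  assumes "\<And>i. 1 \<le> i \<Longrightarrow> i \<le> m \<Longrightarrow> 1 \<le> x i \<and> x i \<le> n"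
    and "\<And>i j. 1 \<le> i \<Longrightarrow> i < j \<Longrightarrow> j \<le> m \<Longrightarrow> x i < x j"
  shows "\<exists>b\<in>carrier G. \<forall>i j. 1 \<le> i \<longrightarrow> i < j \<longrightarrow> j \<le> m \<longrightarrow> conj_to b (art i j) (art (x i) (x j))"
  using assms
proof (induction "\<Sum>i=1..m. x i" arbitrary: x rule: less_induct)
  case less
  note range = less.prems(1) and mono = less.prems(2)
  show ?case
  proof (cases "\<exists>i. 1 \<le> i \<and> i \<le> m \<and> x i \<noteq> i")
    case False
    have "conj_to \<one> (art i j) (art (x i) (x j))" if "1 \<le> i" "i < j" "j \<le> m" for i j
    proof -
      have "x i = i" "x j = j" using False that by auto
      moreover have "j \<le> n" using range[of j] that calculation by auto
      ultimately show ?thesis using art_closed[of i j] that by (simp add: conj_to_def)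
    qed
    then show ?thesis by (intro bexI[of _ \<one>]) auto
  next
    case True
    \<comment> \<open>The position \<open>x i - 1\<close> is free, since the strands below \<open>i\<close> occupy \<open>1, \<dots>, i - 1\<close>.\<close>
    define i where "i = (LEAST i. 1 \<le> i \<and> i \<le> m \<and> x i \<noteq> i)"
    have i: "1 \<le> i" "i \<le> m" "x i \<noteq> i" using LeastI_ex[OF True] by (simp_all add: i_def)
    have below: "x p = p" if "1 \<le> p" "p < i" for p
      using not_less_Least[of p "\<lambda>i. 1 \<le> i \<and> i \<le> m \<and> x i \<noteq> i"] that i by (auto simp: i_def)
    have xi: "i < x i"
    proof (cases "i = 1")
      case True
      then show ?thesis using range[of i] i by simp
    next
      case False
      then have "1 \<le> i - 1" "i - 1 < i" using i by simp_all
      then have "i - 1 < x i" using below[of "i - 1"] mono[of "i - 1" i] i by simp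
      then show ?thesis using i by linarith
    qed
    define q where "q = x i - 1"
    have q: "x i = Suc q" "i \<le> q" "1 \<le> q" "q < n" using xi i range[of i] by (auto simp: q_def)
    have free: "x p \<noteq> q" if "1 \<le> p" "p \<le> m" for p
    proof
      assume p: "x p = q"
      have "\<not> i < p" using mono[of i p] that p q i by auto
      moreover have "p \<noteq> i" using p q by auto
      ultimately show False using below[of p] p q that by auto
    qed
    have inj: "x p \<noteq> Suc q" if "1 \<le> p" "p \<le> m" "p \<noteq> i" for p
      using mono[of i p] mono[of p i] that q i by (cases "p < i") auto
    define y where "y = x(i := q)"
    have "(\<Sum>p=1..m. y p) < (\<Sum>p=1..m. x p)"
      by (rule sum_strict_mono_ex1) (use q i in \<open>auto simp: y_def\<close>)
    moreover have "1 \<le> y p \<and> y p \<le> n" if "1 \<le> p" "p \<le> m" for p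
      using range[OF that] q by (auto simp: y_def)
    moreover have "y p < y r" if pr: "1 \<le> p" "p < r" "r \<le> m" for p r
      using mono[OF pr] below[of p] free[of r] inj[of r] pr q by (auto simp: y_def)
    ultimately obtain b where b: "b \<in> carrier G"
      "\<And>p r. 1 \<le> p \<Longrightarrow> p < r \<Longrightarrow> r \<le> m \<Longrightarrow> conj_to b (art p r) (art (y p) (y r))"
      using less.hyps[of y] by blast
    have "conj_to (s q) (art (y p) (y r)) (art (x p) (x r))" if pr: "1 \<le> p" "p < r" "r \<le> m" for p r
    proof -
      note rg = range[of p] range[of r] mono[OF pr]
      consider "p = i" | "r = i" | "p \<noteq> i" "r \<noteq> i" by blast
      then show ?thesis
      proof cases
        case 1
        then show ?thesis using raise_lower[of q "x r"] rg pr q by (simp add: y_def)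
      next
        case 2
        then show ?thesis using raise_upper[of "x p" q] rg pr q free[of p] by (simp add: y_def)
      next
        case 3
        then show ?thesis using conj_disjoint[of "x p" "x r" q] rg pr q free[of p] free[of r] inj[of p] inj[of r]
          by (simp add: y_def)
      qed
    qed
    then have "conj_to (s q \<otimes> b) (art p r) (art (x p) (x r))" if "1 \<le> p" "p < r" "r \<le> m" for p r
      using conj_to_trans[OF b(2)] that by blast
    then show ?thesis using b(1) s_closed[of q] q by (intro bexI[of _ "s q \<otimes> b"]) auto
  qed
qed

lemma parallel_commute:
  assumes "4 \<le> n"
  shows "art 1 2 \<otimes> art 3 4 = art 3 4 \<otimes> art 1 2" "art 1 4 \<otimes> art 2 3 = art 2 3 \<otimes> art 1 4"
proof -
  have a: "art 1 2 = s 1 \<otimes> s 1" "art 2 3 = s 2 \<otimes> s 2"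
    using art_base[of 1] art_base[of 2] by (simp_all add: numeral_2_eq_2 numeral_3_eq_3)
  have "conj_to (s 1) (art 3 4) (art 3 4)" "conj_to (s 2) (art 1 4) (art 1 4)"
    using conj_disjoint[of 3 4 1] conj_disjoint[of 1 4 2] assms by auto
  note c = conj_to_trans[OF this(1) this(1)] conj_to_trans[OF this(2) this(2)]
  from c show "art 1 2 \<otimes> art 3 4 = art 3 4 \<otimes> art 1 2" "art 1 4 \<otimes> art 2 3 = art 2 3 \<otimes> art 1 4"
    unfolding a by (simp_all add: conj_to_def)
qed

text \<open>
  The generators on the strands 1, 3 and 2, 4 do not commute, but they do after the second has been
  conjugated by the generator of one of the pairs 34, 23 and 12 or by its inverse. Each identity is the
  image of a relation between disjoint unlinked pairs under conjugation by \<open>s 3\<close>, \<open>s 2\<close> or \<open>s 1\<close> or an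
  inverse of them.
\<close>

lemma crossing_commute:
  assumes "4 \<le> n"
  shows "art 1 3 \<otimes> (inv (art 3 4) \<otimes> art 2 4 \<otimes> art 3 4) = (inv (art 3 4) \<otimes> art 2 4 \<otimes> art 3 4) \<otimes> art 1 3" (is "_ \<otimes> ?b = _")
    "art 1 3 \<otimes> (art 2 3 \<otimes> art 2 4 \<otimes> inv (art 2 3)) = (art 2 3 \<otimes> art 2 4 \<otimes> inv (art 2 3)) \<otimes> art 1 3" (is "_ \<otimes> ?c = _")
    "art 1 3 \<otimes> (inv (art 1 2) \<otimes> art 2 4 \<otimes> art 1 2) = (inv (art 1 2) \<otimes> art 2 4 \<otimes> art 1 2) \<otimes> art 1 3" (is "_ \<otimes> ?d = _")
proof -
  have a: "art 1 2 = s 1 \<otimes> s 1" "art 2 3 = s 2 \<otimes> s 2" "art 3 4 = s 3 \<otimes> s 3"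
    using art_base[of 1] art_base[of 2] art_base[of 3]
    by (simp_all add: numeral_2_eq_2 numeral_3_eq_3 eval_nat_numeral)
  have c: "s 1 \<in> carrier G" "s 2 \<in> carrier G" "s 3 \<in> carrier G" using s_closed assms by simp_all
  have m: "conj_to (s 3) (art 1 3) (art 1 4)" "conj_to (s 3) (art 2 3) (art 2 4)"
    "conj_to (s 2) (art 1 2) (art 1 3)" "conj_to (s 2) (art 2 4) (art 3 4)"
    "conj_to (s 1) (art 1 3) (art 2 3)" "conj_to (s 1) (art 1 4) (art 2 4)"
    using raise_upper[of 1 3] raise_upper[of 2 3] raise_upper[of 1 2] raise_lower[of 2 4]
      raise_lower[of 1 3] raise_lower[of 1 4] assms by (simp_all add: eval_nat_numeral)
  have ac: "art 2 4 \<in> carrier G" using art_closed assms by simp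
  have "inv (art 3 4) \<otimes> art 2 4 \<otimes> art 3 4 = inv (s 3) \<otimes> art 2 3 \<otimes> s 3"
    unfolding a conj_to_eq'[OF m(2), unfolded a] using ac c by (simp add: m_assoc inv_mult_group)
  moreover have "conj_to (inv (s 3)) (art 2 3) (inv (s 3) \<otimes> art 2 3 \<otimes> s 3)"
    using conj_to_conj[of "inv (s 3)" "art 2 3"] m(2) c by (simp add: conj_to_def)
  ultimately show "art 1 3 \<otimes> ?b = ?b \<otimes> art 1 3"
    using conj_to_commute[OF conj_to_inv[OF m(1)] _ parallel_commute(2)[OF assms]] by simp
  have "art 2 3 \<otimes> art 2 4 \<otimes> inv (art 2 3) = s 2 \<otimes> art 3 4 \<otimes> inv (s 2)"
    unfolding a conj_to_eq[OF m(4), unfolded a] using ac c by (simp add: m_assoc inv_mult_group)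
  moreover have "conj_to (s 2) (art 3 4) (s 2 \<otimes> art 3 4 \<otimes> inv (s 2))"
    using conj_to_conj[of "s 2" "art 3 4"] m(4) c by (simp add: conj_to_def)
  ultimately show "art 1 3 \<otimes> ?c = ?c \<otimes> art 1 3"
    using conj_to_commute[OF m(3) _ parallel_commute(1)[OF assms]] by simp
  have "inv (art 1 2) \<otimes> art 2 4 \<otimes> art 1 2 = inv (s 1) \<otimes> art 1 4 \<otimes> s 1"
    unfolding a conj_to_eq'[OF m(6), unfolded a] using ac c by (simp add: m_assoc inv_mult_group)
  moreover have "conj_to (inv (s 1)) (art 1 4) (inv (s 1) \<otimes> art 1 4 \<otimes> s 1)"
    using conj_to_conj[of "inv (s 1)" "art 1 4"] m(6) c by (simp add: conj_to_def)
  ultimately show "art 1 3 \<otimes> ?d = ?d \<otimes> art 1 3"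
    using conj_to_commute[OF conj_to_inv[OF m(5)] _ parallel_commute(2)[OF assms, symmetric]] by simp
qed

text \<open>
  Strand \<open>j\<close> running once around the strands below it.
\<close>

primrec loop :: "nat \<Rightarrow> 'a" where
  "loop 0 = \<one>"
| "loop (Suc j) = (if j = 0 then \<one> else s j \<otimes> loop j \<otimes> s j)"

primrec full_twist :: "nat \<Rightarrow> 'a" where
  "full_twist 0 = \<one>"
| "full_twist (Suc m) = full_twist m \<otimes> loop (Suc m)"

declare loop.simps(2) [simp del]

lemma loop_closed: "j \<le> n \<Longrightarrow> loop j \<in> carrier G"
  by (induction j) (auto simp: s_closed loop.simps)

lemma full_twist_closed: "m \<le> n \<Longrightarrow> full_twist m \<in> carrier G"
  by (induction m) (auto simp: loop_closed)

lemma far_loop: "j \<le> k \<Longrightarrow> Suc k < n \<Longrightarrow> conj_to (s (Suc k)) (loop j) (loop j)"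
proof (induction j)
  case (Suc j)
  have "conj_to (s (Suc k)) (s j) (s j)" if "j \<noteq> 0" using that Suc.prems by (intro far_conj) auto
  then show ?case using Suc s_closed by (auto simp: loop.simps conj_to_def[of _ \<one>] intro!: conj_to_mult)
qed (simp add: conj_to_def s_closed)

text \<open>
  The loop encircles the strands below \<open>j\<close> together, so a crossing among them can be slid through it.
\<close>

lemma conj_loop: "1 \<le> k \<Longrightarrow> Suc k < j \<Longrightarrow> j \<le> n \<Longrightarrow> conj_to (s k) (loop j) (loop j)"
proof (induction j)
  case (Suc j)
  show ?case
  proof (cases "j = Suc k")
    case True
    note c = s_closed[of k] s_closed[of "Suc k"] loop_closed[of k]
    have kn: "Suc k < n" using Suc.prems True by simp
    have c: "s k \<in> carrier G" "s (Suc k) \<in> carrier G" "loop k \<in> carrier G"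
      using s_closed loop_closed Suc.prems kn by simp_all
    have b: "s k \<otimes> s (Suc k) \<otimes> s k = s (Suc k) \<otimes> s k \<otimes> s (Suc k)"
      using braid Suc.prems kn by simp
    have l: "s (Suc k) \<otimes> loop k = loop k \<otimes> s (Suc k)"
      using far_loop[of k k] kn by (simp add: conj_to_def)
    have L: "loop (Suc (Suc k)) = s (Suc k) \<otimes> (s k \<otimes> loop k \<otimes> s k) \<otimes> s (Suc k)"
      using Suc.prems by (simp add: loop.simps)
    have "s k \<otimes> loop (Suc (Suc k)) = (s k \<otimes> s (Suc k) \<otimes> s k) \<otimes> loop k \<otimes> s k \<otimes> s (Suc k)"
      unfolding L using c by (simp add: m_assoc)
    also have "\<dots> = s (Suc k) \<otimes> s k \<otimes> (s (Suc k) \<otimes> loop k) \<otimes> s k \<otimes> s (Suc k)"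
      unfolding b using c by (simp add: m_assoc)
    also have "\<dots> = s (Suc k) \<otimes> s k \<otimes> loop k \<otimes> (s (Suc k) \<otimes> s k \<otimes> s (Suc k))"
      unfolding l using c by (simp add: m_assoc)
    also have "\<dots> = loop (Suc (Suc k)) \<otimes> s k"
      unfolding b[symmetric] L using c by (simp add: m_assoc)
    finally show ?thesis unfolding True using c loop_closed[of "Suc (Suc k)"] kn
      by (simp add: conj_to_def)
  next
    case False
    then have "Suc k < j" using Suc.prems by simp
    then have "conj_to (s k) (s j) (s j)" "conj_to (s k) (loop j) (loop j)"
      using Suc by (auto intro!: far_conj)
    then show ?thesis using Suc.prems by (auto simp: loop.simps intro!: conj_to_mult)
  qed
qed simp

lemma loop_loop_commute:
  assumes "j < n" "1 \<le> j"
  shows "loop j \<otimes> loop (Suc j) = loop (Suc j) \<otimes> loop j"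
proof -
  have "conj_to (loop (Suc j)) (loop i) (loop i)" if "i \<le> j" for i
    using that
  proof (induction i)
    case 0
    then show ?case using loop_closed[of "Suc j"] assms by (simp add: conj_to_def)
  next
    case (Suc i)
    have "conj_to (loop (Suc j)) (s i) (s i)" if "i \<noteq> 0"
      by (rule conj_to_swap[OF conj_loop]) (use Suc.prems assms that in auto)
    moreover have "conj_to (loop (Suc j)) (loop i) (loop i)" using Suc by simp
    moreover have "conj_to (loop (Suc j)) \<one> \<one>"
      using loop_closed[of "Suc j"] assms by (simp add: conj_to_def)
    ultimately show ?case by (auto simp: loop.simps(2)[of i] intro!: conj_to_mult)
  qed
  from this[of j] show ?thesis by (simp add: conj_to_def)
qed

lemma far_full_twist: "j \<le> k \<Longrightarrow> Suc k < n \<Longrightarrow> conj_to (s (Suc k)) (full_twist j) (full_twist j)"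
proof (induction j)
  case 0
  then show ?case using s_closed[of "Suc k"] by (simp add: conj_to_def)
next
  case (Suc j)
  then show ?case using conj_to_mult[OF Suc.IH far_loop[of "Suc j" k]] by simp
qed

text \<open>
  The crossing \<open>s m\<close> is far from all loops but the last two. These combine to
  \<open>loop m \<otimes> s m \<otimes> loop m \<otimes> s m\<close>, which commutes with \<open>s m\<close> because \<open>loop m\<close> commutes with
  \<open>loop (Suc m) = s m \<otimes> loop m \<otimes> s m\<close>.
\<close>

lemma full_twist_central: "1 \<le> k \<Longrightarrow> k < m \<Longrightarrow> m \<le> n \<Longrightarrow> conj_to (s k) (full_twist m) (full_twist m)"
proof (induction m)
  case (Suc m)
  show ?case
  proof (cases "k = m")
    case False
    then have "k < m" using Suc.prems by simp
    then show ?thesis using Suc conj_loop[of k "Suc m"] by (auto intro!: conj_to_mult)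
  next
    case True
    then obtain p where p: "m = Suc p" using Suc.prems by (cases m) auto
    have c: "s m \<in> carrier G" "full_twist p \<in> carrier G" "loop m \<in> carrier G"
      using s_closed full_twist_closed loop_closed Suc.prems True p by simp_all
    have L: "loop (Suc m) = s m \<otimes> loop m \<otimes> s m" using p by (simp add: loop.simps)
    have t: "s m \<otimes> full_twist p = full_twist p \<otimes> s m"
      using far_full_twist[of p p] Suc.prems p by (simp add: conj_to_def)
    have l: "loop m \<otimes> loop (Suc m) = loop (Suc m) \<otimes> loop m"
      using loop_loop_commute[of m] Suc.prems p by simp
    have F: "full_twist (Suc m) = full_twist p \<otimes> (loop m \<otimes> loop (Suc m))"
      using c L unfolding p by (simp add: m_assoc)
    have "s m \<otimes> full_twist (Suc m) = (s m \<otimes> full_twist p) \<otimes> (loop m \<otimes> loop (Suc m))"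
      unfolding F using c L by (simp add: m_assoc)
    also have "\<dots> = full_twist p \<otimes> (s m \<otimes> loop m \<otimes> s m) \<otimes> loop m \<otimes> s m"
      unfolding t L using c by (simp add: m_assoc)
    also have "\<dots> = full_twist p \<otimes> (loop (Suc m) \<otimes> loop m) \<otimes> s m"
      unfolding L using c by (simp add: m_assoc)
    also have "\<dots> = full_twist (Suc m) \<otimes> s m" unfolding l[symmetric] F ..
    finally show ?thesis unfolding True using c full_twist_closed[of "Suc m"] Suc.prems
      by (simp add: conj_to_def del: full_twist.simps)
  qed
qed simp

lemma loop_eq_prod: "1 \<le> j \<Longrightarrow> j \<le> n \<Longrightarrow> loop j = list_prod (map (\<lambda>i. art i j) [1..<j])"
proof (induction j)
  case (Suc j)
  show ?case
  proof (cases "j = 0")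
    case False
    let ?p = "list_prod (map (\<lambda>i. art i (Suc j)) [1..<j])"
    have c: "s j \<in> carrier G" "loop j \<in> carrier G" using s_closed loop_closed Suc.prems False by simp_all
    have "conj_to (s j) (list_prod (map (\<lambda>i. art i j) [1..<j])) ?p"
      by (rule conj_to_list_prod[OF c(1)]) (use raise_upper Suc.prems in auto)
    then have "conj_to (s j) (loop j) ?p" using Suc False by simp
    then have "loop (Suc j) = ?p \<otimes> (s j \<otimes> s j)"
      using c False by (simp add: loop.simps conj_to_def m_assoc)
    also have "\<dots> = list_prod (map (\<lambda>i. art i (Suc j)) ([1..<j] @ [j]))"
      unfolding map_append using c Suc.prems art_closed
      by (subst list_prod_append) (auto simp: art_base)
    also have "[1..<j] @ [j] = [1..<Suc j]" using False by simp
    finally show ?thesis .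
  qed (simp add: loop.simps)
qed simp

text \<open>
  Each Artin generator occurs exactly once, which makes any one of them redundant once the full twist
  is available.
\<close>

lemma full_twist_eq_prod: "m \<le> n \<Longrightarrow> full_twist m = list_prod (map (\<lambda>(i, j). art i j) (index_pairs m))"
proof (induction m)
  case (Suc m)
  then have "full_twist (Suc m) = list_prod (map (\<lambda>(i, j). art i j) (index_pairs m))
      \<otimes> list_prod (map (\<lambda>i. art i (Suc m)) [1..<Suc m])"
    using loop_eq_prod[of "Suc m"] by simp
  also have "\<dots> = list_prod (map (\<lambda>(i, j). art i j) (index_pairs m) @ map (\<lambda>i. art i (Suc m)) [1..<Suc m])"
    by (rule list_prod_append[symmetric]) (use Suc.prems art_closed in \<open>auto simp: set_index_pairs\<close>)
  also have "\<dots> = list_prod (map (\<lambda>(i, j). art i j) (index_pairs (Suc m)))"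
    by (simp add: comp_def)
  finally show ?case .
qed simp

lemma full_twist_commutes_art:
  assumes "1 \<le> i" "i < j" "j \<le> n"
  shows "full_twist n \<otimes> art i j = art i j \<otimes> full_twist n"
proof -
  have "conj_to (full_twist n) (s k) (s k)" if "i \<le> k" "k < j" for k
  proof (rule conj_to_swap[OF full_twist_central])
    show "1 \<le> k" "k < n" using that assms by auto
  qed simp
  then have "conj_to (full_twist n) (art i j) (art i j)" by (rule conj_to_art[OF assms])
  then show ?thesis by (simp add: conj_to_def)
qed

end

section \<open>The Artin generators generate the pure braid group\<close>

definition sigma :: "nat \<Rightarrow> nat \<Rightarrow> nat word set" where
  "sigma n k = braid_class n [(k, True)]"

lemma sigma_closed: "1 \<le> k \<Longrightarrow> k < n \<Longrightarrow> sigma n k \<in> carrier (braid_group n)"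
  by (auto simp: sigma_def carrier_braid_group)

lemma braid_class_closed: "w \<in> words {1..<n} \<Longrightarrow> braid_class n w \<in> carrier (braid_group n)"
  by (simp add: carrier_braid_group)

lemma braid_class_Nil: "braid_class n [] = \<one>\<^bsub>braid_group n\<^esub>"
  by (simp add: braid_class_def braid_group_def presented_group_def)

lemma braid_class_eq: "(u, v) \<in> word_cong {1..<n} (braid_relations n) \<Longrightarrow> braid_class n u = braid_class n v"
  unfolding braid_class_def by (rule equiv_class_eq[OF equiv_word_cong[OF braid_relations_words]])

lemma braid_class_relation:
  assumes "(l, r) \<in> braid_relations n"
  shows "braid_class n l = braid_class n r"
  using word_cong.rel[of "[]" "{1..<n}" "[]" l r] assms by (intro braid_class_eq) simp

lemma braid_class_Cons:
  assumes "1 \<le> k" "k < n" "w \<in> words {1..<n}"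
  shows "braid_class n ((k, True) # w) = sigma n k \<otimes>\<^bsub>braid_group n\<^esub> braid_class n w"
  using mult_braid_class[of "[(k, True)]" n w] assms by (simp add: sigma_def)

lemma braid_class_inv_letter:
  assumes "1 \<le> k" "k < n"
  shows "braid_class n [(k, False)] = inv\<^bsub>braid_group n\<^esub> sigma n k"
proof -
  have "braid_class n [(k, False), (k, \<not> False)] = \<one>\<^bsub>braid_group n\<^esub>"
    unfolding braid_class_Nil[symmetric]
    using word_cong.cancel[of "[]" "{1..<n}" "[]" k False] assms by (intro braid_class_eq) simp
  then have "braid_class n [(k, False)] \<otimes>\<^bsub>braid_group n\<^esub> sigma n k = \<one>\<^bsub>braid_group n\<^esub>"
    using mult_braid_class[of "[(k, False)]" n "[(k, True)]"] assms by (simp add: sigma_def)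
  then show ?thesis
    using group.inv_equality[OF group_braid_group] sigma_closed[OF assms] braid_class_closed[of "[(k, False)]" n] assms by simp
qed

interpretation braid: braid_elements "braid_group n" "sigma n" n for n
proof (intro braid_elements.intro braid_elements_axioms.intro group_braid_group)
  fix i j assume ij: "1 \<le> i" "i + 2 \<le> j" "j < n"
  then have "braid_class n [(i, True), (j, True)] = braid_class n [(j, True), (i, True)]"
    by (intro braid_class_relation) (auto simp: braid_relations_def)
  then show "sigma n i \<otimes>\<^bsub>braid_group n\<^esub> sigma n j = sigma n j \<otimes>\<^bsub>braid_group n\<^esub> sigma n i"
    using ij by (simp add: sigma_def mult_braid_class)
next
  fix i assume i: "1 \<le> i" "Suc i < n"
  then have "braid_class n [(i, True), (Suc i, True), (i, True)] =
      braid_class n [(Suc i, True), (i, True), (Suc i, True)]"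
    by (intro braid_class_relation) (auto simp: braid_relations_def)
  then show "sigma n i \<otimes>\<^bsub>braid_group n\<^esub> sigma n (Suc i) \<otimes>\<^bsub>braid_group n\<^esub> sigma n i =
      sigma n (Suc i) \<otimes>\<^bsub>braid_group n\<^esub> sigma n i \<otimes>\<^bsub>braid_group n\<^esub> sigma n (Suc i)"
    using i by (simp add: sigma_def mult_braid_class)
qed (rule sigma_closed)

lemma artin_word_Suc: "i < j \<Longrightarrow> artin_word i (Suc j) = (j, True) # artin_word i j @ [(j, False)]"
  by (simp add: artin_word_def)

lemma artin_word_base: "artin_word i (Suc i) = [(i, True), (i, True)]"
  by (simp add: artin_word_def)

lemma artin_word_in_words: "1 \<le> i \<Longrightarrow> i < j \<Longrightarrow> j \<le> n \<Longrightarrow> artin_word i j \<in> words {1..<n}"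
  by (auto simp: artin_word_def)

lemma artin_gen_eq_art:
  "1 \<le> i \<Longrightarrow> i < j \<Longrightarrow> j \<le> n \<Longrightarrow> artin_gen n i j = braid.art n i j"
proof (induction j)
  case (Suc j)
  show ?case
  proof (cases "i = j")
    case True
    have "braid_class n [(j, True), (j, True)] = sigma n j \<otimes>\<^bsub>braid_group n\<^esub> sigma n j"
      using Suc.prems True by (simp add: sigma_def mult_braid_class)
    then show ?thesis using True
      by (simp add: artin_gen_def artin_word_base braid.art_base)
  next
    case False
    then have ij: "i < j" using Suc.prems by simp
    have "braid_class n (artin_word i (Suc j)) = sigma n j \<otimes>\<^bsub>braid_group n\<^esub>
      (braid_class n (artin_word i j) \<otimes>\<^bsub>braid_group n\<^esub> inv\<^bsub>braid_group n\<^esub> sigma n j)"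
      using artin_word_in_words[of i j n] Suc.prems ij
      by (simp add: artin_word_Suc braid_class_Cons flip: mult_braid_class braid_class_inv_letter)
    then show ?thesis using Suc ij braid.art_closed[of i j n] sigma_closed[of j n]
      by (simp add: artin_gen_def braid.art.simps braid.m_assoc)
  qed
qed simp

lemma artin_gens_eq: "{artin_gen n i j | i j. 1 \<le> i \<and> i < j \<and> j \<le> n} = braid.gens n"
  unfolding braid.gens_def using artin_gen_eq_art by (metis (no_types, opaque_lifting))

lemma carrier_pure_braid_group:
  "carrier (pure_braid_group n) = {A \<in> carrier (braid_group n). braid_perm n A = id}"
  by (simp add: pure_braid_group_def kernel_def sym_group_def)

lemma generate_sigma: "generate (braid_group n) (sigma n ` {1..<n}) = carrier (braid_group n)"
proof (rule equalityI)
  let ?A = "generate (braid_group n) (sigma n ` {1..<n})"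
  show "?A \<subseteq> carrier (braid_group n)"
    by (rule braid.generate_incl) (auto intro: sigma_closed)
  have "braid_class n w \<in> ?A" if "w \<in> words {1..<n}" for w
    using that
  proof (induction w rule: list.induct)
    case Nil
    then show ?case by (simp add: braid_class_Nil generate.one)
  next
    case (Cons x w)
    obtain k b where x: "x = (k, b)" by (cases x)
    have k: "1 \<le> k" "k < n" and w: "w \<in> words {1..<n}" using Cons.prems x by auto
    have "braid_class n [x] \<in> ?A"
      unfolding x using k
      by (cases b) (auto simp: braid_class_inv_letter simp flip: sigma_def intro: generate.incl generate.inv)
    then show ?case using mult_braid_class[of "[x]" n w] k w x generate.eng Cons.IH by fastforce
  qed
  then show "carrier (braid_group n) \<subseteq> ?A"
    unfolding carrier_braid_group by blast
qed

lemma normal_generate_gens: "generate (braid_group n) (braid.gens n) \<lhd> braid_group n"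
  by (rule braid.normal_generate_if_conj_generators[OF _ generate_sigma braid.gens_closed])
     (auto intro: sigma_closed braid.conj_gens_in_generate)

text \<open>
  Descending words \<open>\<sigma>\<^sub>m \<dots> \<sigma>\<^sub>k\<close> represent the cosets of the symmetric group on \<open>m\<close> letters in that on
  \<open>m + 1\<close> letters; \<open>k = m + 1\<close> gives the empty word.
\<close>

definition descent :: "nat \<Rightarrow> nat \<Rightarrow> nat word" where
  "descent k m = map (\<lambda>i. (i, True)) (rev [k..<Suc m])"

lemma descent_Nil: "descent (Suc m) m = []"
  by (simp add: descent_def)

lemma descent_words: "1 \<le> k \<Longrightarrow> m < n \<Longrightarrow> descent k m \<in> words {1..<n}"
  by (auto simp: descent_def)

lemma descent_Suc: "k \<le> Suc m \<Longrightarrow> descent k (Suc m) = (Suc m, True) # descent k m"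
  by (simp add: descent_def)

lemma descent_snoc: "k \<le> m \<Longrightarrow> descent k m = descent (Suc k) m @ [(k, True)]"
  by (simp add: descent_def upt_conv_Cons)

lemma word_perm_descent: "k \<le> Suc m \<Longrightarrow> word_perm (descent k m) k = Suc m"
proof (induction m)
  case 0
  then show ?case by (cases k) (auto simp: descent_def)
next
  case (Suc m)
  show ?case
  proof (cases "k = Suc (Suc m)")
    case False
    then show ?thesis using Suc by (simp add: descent_Suc)
  qed (simp add: descent_Nil)
qed

lemma conj_to_descent:
  assumes "1 \<le> k" "m < n" "x \<in> carrier (braid_group n)"
    and "\<And>i. k \<le> i \<Longrightarrow> i \<le> m \<Longrightarrow> braid.conj_to n x (sigma n i) (sigma n i)"
  shows "braid.conj_to n x (braid_class n (descent k m)) (braid_class n (descent k m))"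
proof -
  have *: "braid_class n (map (\<lambda>i. (i, True)) is) = braid.list_prod n (map (sigma n) is)"
    if "set is \<subseteq> {1..<n}" for "is"
    using that
  proof (induction "is")
    case (Cons i "is")
    then have "map (\<lambda>i. (i, True)) is \<in> words {1..<n}" by auto
    then show ?case using Cons by (simp add: braid_class_Cons)
  qed (simp add: braid_class_Nil)
  have "braid.conj_to n x (braid.list_prod n (map (sigma n) (rev [k..<Suc m])))
     (braid.list_prod n (map (sigma n) (rev [k..<Suc m])))"
    by (rule braid.conj_to_list_prod) (use assms in auto)
  then show ?thesis using *[of "rev [k..<Suc m]"] assms(1,2) by (simp add: descent_def del: upt_Suc)
qed

lemma descent_shift:
  assumes k: "1 \<le> k" and j: "k < j"
  shows "j \<le> m \<Longrightarrow> m < n \<Longrightarrow> braid.conj_to n (braid_class n (descent k m)) (sigma n j) (sigma n (j - 1))"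
proof (induction m)
  case (Suc m)
  obtain p where p: "j = Suc p" "k \<le> p" "1 \<le> p" using j k by (cases j) auto
  show ?case
  proof (cases "j = Suc m")
    case False
    then have jm: "j \<le> m" using Suc.prems by simp
    have "braid.conj_to n (sigma n (Suc m)) (sigma n (j - 1)) (sigma n (j - 1))"
      using jm p Suc.prems by (intro braid.far_conj) auto
    from braid.conj_to_trans[OF Suc.IH this] show ?thesis
      using jm j k Suc.prems descent_words[of k m n] by (simp add: descent_Suc braid_class_Cons)
  next
    case True
    then obtain q where q: "p = Suc q" using p by (cases p) auto
    have c: "sigma n p \<in> carrier (braid_group n)" "sigma n j \<in> carrier (braid_group n)"
      "braid_class n (descent k q) \<in> carrier (braid_group n)"
      using sigma_closed braid_class_closed[OF descent_words[of k q n]] p k Suc.prems True q by simp_all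
    have 1: "braid.conj_to n (braid_class n (descent k q)) (sigma n j) (sigma n j)"
      by (rule braid.conj_to_swap[OF conj_to_descent])
         (use c k p q Suc.prems True in \<open>auto intro: braid.far_conj\<close>)
    have 2: "braid.conj_to n (sigma n j \<otimes>\<^bsub>braid_group n\<^esub> sigma n p) (sigma n j) (sigma n p)"
      using braid.braid[of p n] c p Suc.prems True by (simp add: braid.conj_to_def braid.m_assoc)
    have "descent k m = (p, True) # descent k q"
      using descent_Suc[of k q] p q True by simp
    then have "braid_class n (descent k (Suc m)) =
        (sigma n j \<otimes>\<^bsub>braid_group n\<^esub> sigma n p) \<otimes>\<^bsub>braid_group n\<^esub> braid_class n (descent k q)"
      using True p q k Suc.prems c descent_words[of k q n] descent_words[of k "Suc q" n]
      by (simp add: descent_Suc braid_class_Cons braid.m_assoc)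
    then show ?thesis using braid.conj_to_trans[OF 1 2] p by simp
  qed
qed (use j in simp)

text \<open>
  Modulo a normal subgroup containing the squares of the crossings, a braid word can be brought into
  the form of a word in fewer crossings followed by a descending word, as in the symmetric group:
  multiplying from the right by \<open>\<sigma>\<^sub>j\<close> prolongs the descending word (\<open>j = k - 1\<close>), shortens it up to a
  square (\<open>j = k\<close>), or lets \<open>\<sigma>\<^sub>j\<close> pass to the left as \<open>\<sigma>\<^sub>j\<close> or \<open>\<sigma>\<^sub>j\<^sub>-\<^sub>1\<close>.
\<close>

lemma braid_normal_form:
  assumes N: "N \<lhd> braid_group n" and m: "m < n"
    and sq: "\<And>k. 1 \<le> k \<Longrightarrow> k < n \<Longrightarrow> sigma n k \<otimes>\<^bsub>braid_group n\<^esub> sigma n k \<in> N"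
    and w: "w \<in> words {1..<Suc m}"
  shows "\<exists>a\<in>N. \<exists>v\<in>words {1..<m}. \<exists>k. 1 \<le> k \<and> k \<le> Suc m \<and>
    braid_class n w = a \<otimes>\<^bsub>braid_group n\<^esub> braid_class n (v @ descent k m)"
  using w
proof (induction w rule: rev_induct)
  case Nil
  interpret N: normal N "braid_group n" by fact
  have "braid_class n [] = \<one>\<^bsub>braid_group n\<^esub> \<otimes>\<^bsub>braid_group n\<^esub> braid_class n ([] @ descent (Suc m) m)"
    by (simp add: descent_Nil braid_class_Nil)
  then show ?case using N.one_closed by (metis Nil le_add1 lists.Nil order_refl plus_1_eq_Suc)
next
  case (snoc x w)
  let ?B = "braid_group n"
  interpret N: normal N "?B" by fact
  let ?f = "\<lambda>y. \<exists>a\<in>N. \<exists>v\<in>words {1..<m}. \<exists>k. 1 \<le> k \<and> k \<le> Suc m \<and>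
    y = a \<otimes>\<^bsub>?B\<^esub> braid_class n (v @ descent k m)"
  obtain j b where x: "x = (j, b)" by (cases x)
  have j: "1 \<le> j" "j \<le> m" and w: "w \<in> words {1..<Suc m}" using snoc.prems x by auto
  have words_n: "u \<in> words {1..<n}" if "u \<in> words {1..<m} \<union> words {1..<Suc m}" for u
    using that m by auto
  have f_I: "?f (a \<otimes>\<^bsub>?B\<^esub> braid_class n (v @ descent k m))"
    if "a \<in> N" "v \<in> words {1..<m}" "1 \<le> k" "k \<le> Suc m" for a v k
    using that by blast
  have absorb: "?f (y \<otimes>\<^bsub>?B\<^esub> q)" if y: "?f y" and q: "q \<in> N" for y q
  proof -
    obtain a v k where avk: "a \<in> N" "v \<in> words {1..<m}" "1 \<le> k" "k \<le> Suc m"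
      "y = a \<otimes>\<^bsub>?B\<^esub> braid_class n (v @ descent k m)" using y by blast
    have "v @ descent k m \<in> words {1..<n}"
      using words_n[of v] descent_words[of k m n] avk m by (simp add: append_in_lists_conv del: in_lists_conv_set)
    then obtain a' where "a' \<in> N" "y \<otimes>\<^bsub>?B\<^esub> q = a' \<otimes>\<^bsub>?B\<^esub> braid_class n (v @ descent k m)"
      using braid.normal_absorb[OF N avk(1) q braid_class_closed] avk(5) by blast
    then show ?thesis using avk by blast
  qed
  have sj: "sigma n j \<in> carrier (?B)" using j m sigma_closed by simp
  obtain a v k where avk: "a \<in> N" "v \<in> words {1..<m}" "1 \<le> k" "k \<le> Suc m"
    "braid_class n w = a \<otimes>\<^bsub>?B\<^esub> braid_class n (v @ descent k m)" using snoc.IH[OF w] by blast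
  have vc: "v \<in> words {1..<n}" by (rule words_n) (use avk in blast)
  have dc: "descent i m \<in> words {1..<n}" if "1 \<le> i" for i by (rule descent_words[OF that m])
  have ac: "a \<in> carrier (?B)" using avk by simp
  note cl = braid_class_closed[OF vc] braid_class_closed[OF dc[OF avk(3)]]
  have step: "?f (braid_class n w \<otimes>\<^bsub>?B\<^esub> sigma n j)"
  proof -
    consider "k = Suc j" | "k = j" | "Suc j < k" | "k < j" by linarith
    then show ?thesis
    proof cases
      case 1
      have "braid_class n w \<otimes>\<^bsub>?B\<^esub> sigma n j = a \<otimes>\<^bsub>?B\<^esub> braid_class n (v @ descent j m)"
        unfolding avk(5) descent_snoc[OF j(2)] 1[symmetric] sigma_def
        using ac cl sj vc dc[OF avk(3)] j m mult_braid_class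
        by (simp add: braid.m_assoc sigma_def append_in_lists_conv flip: mult_braid_class del: in_lists_conv_set)
      then show ?thesis using f_I[OF avk(1,2), of j] j by simp
    next
      case 2
      have "k \<le> m" using 2 j by simp
      have "braid_class n w \<otimes>\<^bsub>?B\<^esub> sigma n j =
        a \<otimes>\<^bsub>?B\<^esub> braid_class n (v @ descent (Suc j) m) \<otimes>\<^bsub>?B\<^esub>
         (sigma n j \<otimes>\<^bsub>?B\<^esub> sigma n j)"
        unfolding avk(5) 2 descent_snoc[OF j(2)]
        using ac vc dc[of "Suc j"] j m sj braid_class_closed[OF vc] braid_class_closed[OF dc[of "Suc j"]]
        by (simp add: braid.m_assoc sigma_def[symmetric] append_in_lists_conv mult_braid_class[symmetric] del: in_lists_conv_set)
      moreover have "?f (a \<otimes>\<^bsub>?B\<^esub> braid_class n (v @ descent (Suc j) m))"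
        using f_I[OF avk(1,2)] j by simp
      ultimately show ?thesis using absorb[OF _ sq[of j]] j m by simp
    next
      case 3
      have "braid.conj_to n (sigma n j) (braid_class n (descent k m)) (braid_class n (descent k m))"
        by (rule conj_to_descent) (use 3 avk j m sj in \<open>auto intro: braid.far_conj\<close>)
      then have "braid_class n (descent k m) \<otimes>\<^bsub>?B\<^esub> sigma n j =
          sigma n j \<otimes>\<^bsub>?B\<^esub> braid_class n (descent k m)"
        by (simp add: braid.conj_to_def)
      then have "braid_class n w \<otimes>\<^bsub>?B\<^esub> sigma n j =
          a \<otimes>\<^bsub>?B\<^esub> braid_class n ((v @ [(j, True)]) @ descent k m)"
        unfolding avk(5)
        using ac cl sj vc dc[OF avk(3)] j m
        by (simp add: braid.m_assoc sigma_def[symmetric] append_in_lists_conv mult_braid_class[symmetric]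
          braid_class_Cons del: in_lists_conv_set)
      moreover have "v @ [(j, True)] \<in> words {1..<m}" using avk 3 j by auto
      ultimately show ?thesis using f_I[OF avk(1) _ avk(3,4)] by presburger
    next
      case 4
      then have "braid_class n (descent k m) \<otimes>\<^bsub>?B\<^esub> sigma n j =
          sigma n (j - 1) \<otimes>\<^bsub>?B\<^esub> braid_class n (descent k m)"
        using descent_shift[of k j m n] avk j m by (simp add: braid.conj_to_def)
      moreover have "1 \<le> j - 1" "j - 1 < n" "j - 1 < m" using 4 avk j m by auto
      moreover have "sigma n (j - 1) \<in> carrier (?B)" using calculation sigma_closed by blast
      ultimately have "braid_class n w \<otimes>\<^bsub>?B\<^esub> sigma n j =
          a \<otimes>\<^bsub>?B\<^esub> braid_class n ((v @ [(j - 1, True)]) @ descent k m)"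
        unfolding avk(5)
        using ac cl sj vc dc[OF avk(3)]
        by (simp add: braid.m_assoc sigma_def[symmetric] append_in_lists_conv mult_braid_class[symmetric]
          braid_class_Cons del: in_lists_conv_set)
      moreover have "v @ [(j - 1, True)] \<in> words {1..<m}" using avk \<open>1 \<le> j - 1\<close> \<open>j - 1 < m\<close> by auto
      ultimately show ?thesis using f_I[OF avk(1) _ avk(3,4)] by presburger
    qed
  qed
  show ?case
  proof (cases b)
    case True
    then show ?thesis using step mult_braid_class[of w n "[x]"] words_n[of w] w x j m
      by (simp add: sigma_def)
  next
    case False
    have "braid_class n (w @ [x]) = braid_class n w \<otimes>\<^bsub>?B\<^esub> inv\<^bsub>?B\<^esub> sigma n j"
      using mult_braid_class[of w n "[x]"] words_n[of w] w x j m False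
      by (simp add: braid_class_inv_letter)
    also have "\<dots> = braid_class n w \<otimes>\<^bsub>?B\<^esub> sigma n j \<otimes>\<^bsub>?B\<^esub>
        inv\<^bsub>?B\<^esub> (sigma n j \<otimes>\<^bsub>?B\<^esub> sigma n j)"
      using sj braid_class_closed[of w n] words_n[of w] w by (simp add: braid.m_assoc braid.inv_mult_group)
    finally show ?thesis using absorb[OF step N.m_inv_closed[OF sq[of j]]] j m by simp
  qed
qed

lemma gens_pure: "braid.gens n \<subseteq> carrier (pure_braid_group n)"
  unfolding artin_gens_eq[symmetric] by (auto intro: artin_gen_closed)

text \<open>
  If the permutation of a word in normal form is the identity, then its descending part is empty, as
  this part alone decides which strand ends at position \<open>m + 1\<close>. The remaining word uses fewer crossings.
\<close>

lemma pure_in_generate: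
  "m \<le> n \<Longrightarrow> w \<in> words {1..<m} \<Longrightarrow> word_perm w = id \<Longrightarrow>
    braid_class n w \<in> generate (braid_group n) (braid.gens n)"
proof (induction m arbitrary: w)
  case 0
  then show ?case by (cases w) (auto simp: braid_class_Nil intro: generate.one)
next
  case (Suc m)
  let ?A = "generate (braid_group n) (braid.gens n)"
  interpret N: normal "?A" "braid_group n"
    by (rule normal_generate_gens)
  have sub: "?A \<subseteq> carrier (pure_braid_group n)"
    using braid.generate_subgroup_incl[OF gens_pure] subgroup_pure_braid by (simp add: pure_braid_group_def)
  have "sigma n k \<otimes>\<^bsub>braid_group n\<^esub> sigma n k \<in> ?A"
    if "1 \<le> k" "k < n" for k
    using braid.art_in_gens[of k "Suc k" n] that by (simp add: braid.art_base generate.incl)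
  from braid_normal_form[OF normal_generate_gens _ this Suc.prems(2)] Suc.prems(1)
  obtain a v k where avk: "a \<in> ?A" "v \<in> words {1..<m}"
    "1 \<le> k" "k \<le> Suc m" "braid_class n w = a \<otimes>\<^bsub>braid_group n\<^esub> braid_class n (v @ descent k m)" by auto
  have w: "w \<in> words {1..<n}" using Suc.prems by auto
  have v: "v \<in> words {1..<n}" using avk(2) Suc.prems(1) by auto
  have vd: "v @ descent k m \<in> words {1..<n}"
    using v descent_words[OF avk(3), of m n] Suc.prems(1) by (simp add: append_in_lists_conv del: in_lists_conv_set)
  have a: "a \<in> carrier (braid_group n)" "braid_perm n a = id"
    using avk(1) sub by (auto simp: carrier_pure_braid_group)
  have "braid_perm n (braid_class n w) = braid_perm n a \<circ> braid_perm n (braid_class n (v @ descent k m))"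
    unfolding avk(5) using braid_perm_hom[of n] a(1) braid_class_closed[OF vd]
    by (simp add: hom_def sym_group_def)
  then have perm: "word_perm v \<circ> word_perm (descent k m) = id"
    unfolding braid_perm_class[OF w] braid_perm_class[OF vd] word_perm_append Suc.prems(3) a(2) by simp
  have "word_perm v (Suc m) = Suc m"
    using permutes_not_in[OF word_perm_permutes[OF avk(2)], of "Suc m"] by simp
  then have "k = Suc m" using fun_cong[OF perm, of k] word_perm_descent[OF avk(4)] by simp
  then have d: "descent k m = []" by (simp add: descent_Nil)
  then have "word_perm v = id" using perm by simp
  then have "braid_class n v \<in> ?A"
    using Suc.IH[OF _ avk(2)] Suc.prems(1) by simp
  then show ?case using avk(1,5) d by simp
qed

theorem generate_pure_braid_group:
  "generate (pure_braid_group n) (braid.gens n) = carrier (pure_braid_group n)"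
proof -
  let ?A = "generate (braid_group n) (braid.gens n)"
  have "generate (pure_braid_group n) (braid.gens n) = ?A"
    unfolding pure_braid_group_def
    by (rule braid.generate_consistent[OF _ subgroup_pure_braid])
       (use gens_pure in \<open>simp add: pure_braid_group_def\<close>)
  moreover have "A \<in> ?A" if A: "A \<in> carrier (pure_braid_group n)" for A
  proof -
    obtain w where w: "w \<in> words {1..<n}" "A = braid_class n w"
      using A unfolding carrier_pure_braid_group carrier_braid_group by blast
    then show ?thesis using A pure_in_generate[of n n w] braid_perm_class[OF w(1)]
      by (simp add: carrier_pure_braid_group)
  qed
  moreover have "?A \<subseteq> carrier (pure_braid_group n)"
    using braid.generate_subgroup_incl[OF gens_pure] subgroup_pure_braid by (simp add: pure_braid_group_def)
  ultimately show ?thesis by blast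
qed

section \<open>Adding strands\<close>

text \<open>
  The map on braid classes that is induced by a map \<open>F\<close> on words, provided that \<open>F\<close> respects the
  congruence, see \<open>lift_word_class\<close>.
\<close>

definition lift_word :: "nat \<Rightarrow> (nat word \<Rightarrow> nat word) \<Rightarrow> nat word set \<Rightarrow> nat word set" where
  "lift_word k F A = braid_class k (F (SOME w. w \<in> A))"

lemma lift_word_class:
  assumes F: "\<And>u v. (u, v) \<in> word_cong {1..<n} (braid_relations n) \<Longrightarrow>
      (F u, F v) \<in> word_cong {1..<k} (braid_relations k)"
    and w: "w \<in> words {1..<n}"
  shows "lift_word k F (braid_class n w) = braid_class k (F w)"
proof -
  have "w \<in> braid_class n w" using w by (auto simp: braid_class_def intro: word_cong.refl)
  then have "(SOME v. v \<in> braid_class n w) \<in> braid_class n w" by (rule someI)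
  then have "(w, SOME v. v \<in> braid_class n w) \<in> word_cong {1..<n} (braid_relations n)"
    by (simp add: braid_class_def)
  from braid_class_eq[OF F[OF this]] show ?thesis by (simp add: lift_word_def)
qed

lemma carrier_pureE:
  assumes "A \<in> carrier (pure_braid_group n)"
  obtains w where "w \<in> words {1..<n}" "word_perm w = id" "A = braid_class n w"
proof -
  have A: "A \<in> carrier (braid_group n)" "braid_perm n A = id"
    using assms by (simp_all add: carrier_pure_braid_group)
  from A(1) obtain w where w: "w \<in> words {1..<n}" "A = braid_class n w"
    unfolding carrier_braid_group by (rule imageE)
  then show ?thesis using that[OF w(1) _ w(2)] braid_perm_class[OF w(1)] A(2) by simp
qed

lemma mult_pure: "mult (pure_braid_group n) = mult (braid_group n)"
  and one_pure: "\<one>\<^bsub>pure_braid_group n\<^esub> = \<one>\<^bsub>braid_group n\<^esub>"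
  by (simp_all add: pure_braid_group_def)

text \<open>
  That the image consists of pure braids only needs to be checked for the generators, so the
  permutation of the image of a general pure braid never has to be computed.
\<close>

lemma hom_pure_braid_groupI:
  assumes f: "f \<in> hom (pure_braid_group k) (braid_group n)"
    and gens: "\<And>i j. 1 \<le> i \<Longrightarrow> i < j \<Longrightarrow> j \<le> k \<Longrightarrow> f (artin_gen k i j) \<in> carrier (pure_braid_group n)"
  shows "f \<in> hom (pure_braid_group k) (pure_braid_group n)"
proof -
  interpret f: group_hom "pure_braid_group k" "braid_group n" f
    by (intro group_hom.intro group_hom_axioms.intro f group_pure_braid_group group_braid_group)
  have "f ` carrier (pure_braid_group k) = generate (braid_group n) (f ` braid.gens k)"
    unfolding generate_pure_braid_group[symmetric] by (rule f.generate_img[symmetric, OF gens_pure])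
  also have "\<dots> \<subseteq> carrier (pure_braid_group n)"
    using braid.generate_subgroup_incl[OF _ subgroup_pure_braid, of "f ` braid.gens k"] gens
    unfolding artin_gens_eq[symmetric] by (auto simp: pure_braid_group_def)
  finally show ?thesis using f by (auto simp: hom_def mult_pure)
qed

lemma word_cong_mono:
  assumes "(u, v) \<in> word_cong S R" "S \<subseteq> S'" "R \<subseteq> R'"
  shows "(u, v) \<in> word_cong S' R'"
proof -
  have words: "words S \<subseteq> words S'" using assms(2) by (intro lists_mono) auto
  show ?thesis using assms(1)
  proof (induction rule: word_cong.induct)
    case (refl w)
    then show ?case using words by (blast intro: word_cong.refl)
  next
    case (cancel u v s b)
    then show ?case using words assms(2) by (intro word_cong.cancel) auto
  next
    case (rel u v l r)
    then show ?case using words assms(3) by (intro word_cong.rel) auto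
  qed (blast intro: word_cong.sym word_cong.trans)+
qed

lemma braid_relations_mono: "k \<le> n \<Longrightarrow> braid_relations k \<subseteq> braid_relations n"
  unfolding braid_relations_def by fastforce

text \<open>
  The inclusion of words embeds the \<open>k\<close> strands as the first ones; conjugating with the braid of
  \<open>transport\<close> moves them to the positions \<open>x\<close>.
\<close>

theorem pure_strand_inclusion:
  assumes k: "k \<le> n" and range: "\<And>i. 1 \<le> i \<Longrightarrow> i \<le> k \<Longrightarrow> 1 \<le> x i \<and> x i \<le> n"
    and mono: "\<And>i j. 1 \<le> i \<Longrightarrow> i < j \<Longrightarrow> j \<le> k \<Longrightarrow> x i < x j"
  shows "\<exists>h\<in>hom (pure_braid_group k) (pure_braid_group n).
    \<forall>i j. 1 \<le> i \<longrightarrow> i < j \<longrightarrow> j \<le> k \<longrightarrow> h (artin_gen k i j) = artin_gen n (x i) (x j)"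
proof -
  let ?B = "braid_group n"
  obtain b where b: "b \<in> carrier (?B)"
    and conj: "\<And>i j. 1 \<le> i \<Longrightarrow> i < j \<Longrightarrow> j \<le> k \<Longrightarrow>
       braid.conj_to n b (braid.art n i j) (braid.art n (x i) (x j))"
    using braid.transport[of k x n] range mono by blast
  have incl: "lift_word n id (braid_class k w) = braid_class n w" if "w \<in> words {1..<k}" for w
    using lift_word_class[of k id n w] word_cong_mono[OF _ _ braid_relations_mono[OF k]] that k by simp
  have words: "w \<in> words {1..<n}" if "w \<in> words {1..<k}" for w using that k by auto
  define h where "h A = b \<otimes>\<^bsub>?B\<^esub> lift_word n id A \<otimes>\<^bsub>?B\<^esub> inv\<^bsub>?B\<^esub> b" for A
  have hom: "h \<in> hom (pure_braid_group k) (?B)"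
  proof (rule homI)
    fix A assume "A \<in> carrier (pure_braid_group k)"
    then obtain w where w: "w \<in> words {1..<k}" "A = braid_class k w" by (rule carrier_pureE)
    then show "h A \<in> carrier (?B)"
      using b braid_class_closed[OF words[OF w(1)]] unfolding h_def w(2) incl[OF w(1)] by simp
  next
    fix A B assume A: "A \<in> carrier (pure_braid_group k)" and B: "B \<in> carrier (pure_braid_group k)"
    obtain u where u: "u \<in> words {1..<k}" "A = braid_class k u" using A by (rule carrier_pureE)
    obtain v where v: "v \<in> words {1..<k}" "B = braid_class k v" using B by (rule carrier_pureE)
    have "u @ v \<in> words {1..<k}" using u v by (simp only: append_in_lists_conv)
    then have "lift_word n id (A \<otimes>\<^bsub>pure_braid_group k\<^esub> B) = lift_word n id A \<otimes>\<^bsub>?B\<^esub> lift_word n id B"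
      unfolding u(2) v(2) mult_pure mult_braid_class[OF u(1) v(1)] incl[OF u(1)] incl[OF v(1)]
        mult_braid_class[OF words[OF u(1)] words[OF v(1)]] by (rule incl)
    moreover have "lift_word n id A \<in> carrier (?B)" "lift_word n id B \<in> carrier (?B)"
      unfolding u(2) v(2) incl[OF u(1)] incl[OF v(1)] using braid_class_closed words u(1) v(1) by blast+
    ultimately show "h (A \<otimes>\<^bsub>pure_braid_group k\<^esub> B) = h A \<otimes>\<^bsub>?B\<^esub> h B"
      using braid.conj_mult[OF b] by (simp add: h_def)
  qed
  have gen: "h (artin_gen k i j) = artin_gen n (x i) (x j)" if ij: "1 \<le> i" "i < j" "j \<le> k" for i j
  proof -
    have "lift_word n id (artin_gen k i j) = braid.art n i j"
      using incl[OF artin_word_in_words[OF ij]] artin_gen_eq_art[of i j n] ij k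
      by (simp add: artin_gen_def)
    then show ?thesis
      using braid.conj_to_eq[OF conj[OF ij]] artin_gen_eq_art[of "x i" "x j" n]
        range[of i] range[of j] mono[OF ij] ij by (simp add: h_def)
  qed
  have "h \<in> hom (pure_braid_group k) (pure_braid_group n)"
    by (rule hom_pure_braid_groupI[OF hom]) (use gen range mono in \<open>simp add: artin_gen_closed\<close>)
  then show ?thesis using gen by blast
qed

section \<open>Forgetting strands\<close>

text \<open>
  Read a braid word from the left and keep only crossings between two strands of \<open>K\<close>, numbered by their
  rank in the set of positions that \<open>K\<close> occupies at that moment.
\<close>

fun forget :: "nat set \<Rightarrow> nat word \<Rightarrow> nat word" where
  "forget K [] = []"
| "forget K ((k, b) # w) =
    (if {k, Suc k} \<subseteq> K then [(relabel K k, b)] else []) @ forget (transpose k (Suc k) ` K) w"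

fun track :: "nat set \<Rightarrow> nat word \<Rightarrow> nat set" where
  "track K [] = K"
| "track K ((k, b) # w) = track (transpose k (Suc k) ` K) w"

lemma forget_append: "forget K (u @ v) = forget K u @ forget (track K u) v"
  by (induction K u rule: forget.induct) auto

lemma transpose_transpose_image: "transpose i (Suc i) ` transpose i (Suc i) ` K = K"
  by (simp add: image_image)

lemma word_perm_track: "word_perm w ` track K w = K"
  by (induction K w rule: track.induct) (simp_all only: word_perm.simps track.simps image_comp[symmetric] transpose_transpose_image image_id image_ident id_apply)

lemma bij_word_perm: "bij (word_perm w)"
  by (induction w rule: word_perm.induct) (simp_all only: word_perm.simps bij_id bij_comp bij_transpose)

lemma track_eq:
  assumes "word_perm u = word_perm v"
  shows "track K u = track K v"
  using word_perm_track[of u K] word_perm_track[of v K] inj_image_eq_iff[OF bij_is_inj[OF bij_word_perm[of v]]]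
  unfolding assms by metis

lemma track_pure: "word_perm w = id \<Longrightarrow> track K w = K"
  using word_perm_track[of w K] by simp

lemma finite_track: "finite K \<Longrightarrow> finite (track K w)"
  by (induction K w rule: track.induct) auto

lemma card_track: "card (track K w) = card K"
  by (induction K w rule: track.induct) (auto simp: card_image)

lemma relabel_less:
  assumes "finite K" "y \<in> K" "x < y"
  shows "relabel K x < relabel K y"
proof -
  have "{z \<in> K. z \<le> x} \<subset> {z \<in> K. z \<le> y}"
  proof (rule psubsetI)
    show "{z \<in> K. z \<le> x} \<noteq> {z \<in> K. z \<le> y}" using assms(2,3) by (metis (mono_tags) leD mem_Collect_eq order_refl)
  qed (use assms in auto)
  then show ?thesis unfolding relabel_def by (intro psubset_card_mono) (use assms in auto)
qed

lemma relabel_Suc: "finite K \<Longrightarrow> relabel K (Suc i) = relabel K i + (if Suc i \<in> K then 1 else 0)"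
proof -
  assume K: "finite K"
  have "{y \<in> K. y \<le> Suc i} = (if Suc i \<in> K then insert (Suc i) {y \<in> K. y \<le> i} else {y \<in> K. y \<le> i})"
    by (auto simp: le_Suc_eq)
  then show ?thesis using K by (simp add: relabel_def)
qed

lemma relabel_le_card: "finite K \<Longrightarrow> relabel K x \<le> card K"
  unfolding relabel_def by (rule card_mono) auto

lemma relabel_pos: "finite K \<Longrightarrow> x \<in> K \<Longrightarrow> 1 \<le> relabel K x"
  unfolding relabel_def by (metis (mono_tags, lifting) One_nat_def Suc_leI card_gt_0_iff empty_iff
    finite_subset mem_Collect_eq order_refl subsetI)

lemma relabel_transpose:
  assumes "j \<noteq> i"
  shows "relabel (transpose i (Suc i) ` K) j = relabel K j"
proof -
  have "transpose i (Suc i) y \<le> j \<longleftrightarrow> y \<le> j" for y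
    using assms by (auto simp: transpose_def)
  then have "{y \<in> transpose i (Suc i) ` K. y \<le> j} = transpose i (Suc i) ` {y \<in> K. y \<le> j}"
    by auto
  then show ?thesis by (simp add: relabel_def card_image)
qed

lemma mem_transpose_image:
  "i \<in> transpose i (Suc i) ` K \<longleftrightarrow> Suc i \<in> K" "Suc i \<in> transpose i (Suc i) ` K \<longleftrightarrow> i \<in> K"
  "x \<noteq> i \<Longrightarrow> x \<noteq> Suc i \<Longrightarrow> x \<in> transpose i (Suc i) ` K \<longleftrightarrow> x \<in> K"
  by (simp_all add: in_transpose_image_iff)

lemma transpose_image_self: "i \<in> K \<longleftrightarrow> Suc i \<in> K \<Longrightarrow> transpose i (Suc i) ` K = K"
  by (rule transpose_image_eq) simp

lemma relabel_letter:
  assumes "finite K" "k \<in> K" "Suc k \<in> K"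
  shows "relabel K k \<in> {1..<card K}"
  using relabel_pos[OF assms(1,2)] relabel_less[OF assms(1,3), of k] relabel_le_card[OF assms(1), of "Suc k"]
  by simp

lemma forget_words: "finite K \<Longrightarrow> forget K w \<in> words {1..<card K}"
proof (induction K w rule: forget.induct)
  case (2 K k b w)
  have "forget (transpose k (Suc k) ` K) w \<in> words {1..<card K}" using 2 by (simp add: card_image)
  moreover have "(if {k, Suc k} \<subseteq> K then [(relabel K k, b)] else []) \<in> words {1..<card K}"
    using relabel_letter[OF 2(2)] by auto
  ultimately show ?case by (simp only: forget.simps append_in_lists_conv simp_thms)
qed simp

lemma word_cong_relation: "(l, r) \<in> R \<Longrightarrow> (l, r) \<in> word_cong S R"
  using word_cong.rel[of "[]" S "[]" l r R] by simp

text \<open>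
  If all strands in the relation are kept, the result is the corresponding relation between the ranks.
  If some strand is forgotten, both sides become the same word.
\<close>

lemma forget_relation:
  assumes K: "finite K" and lr: "(l, r) \<in> braid_relations n"
  shows "(forget K l, forget K r) \<in> word_cong {1..<card K} (braid_relations (card K))"
proof -
  note refl = word_cong.refl[OF forget_words[OF K]]
  from lr consider (far) i j where "i + 2 \<le> j" "l = [(i, True), (j, True)]" "r = [(j, True), (i, True)]"
    | (braid) i where "l = [(i, True), (Suc i, True), (i, True)]" "r = [(Suc i, True), (i, True), (Suc i, True)]"
    unfolding braid_relations_def by blast
  then show ?thesis
  proof cases
    case far
    have m: "j \<in> transpose i (Suc i) ` K \<longleftrightarrow> j \<in> K" "Suc j \<in> transpose i (Suc i) ` K \<longleftrightarrow> Suc j \<in> K"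
      "i \<in> transpose j (Suc j) ` K \<longleftrightarrow> i \<in> K" "Suc i \<in> transpose j (Suc j) ` K \<longleftrightarrow> Suc i \<in> K"
      using far(1) by (simp_all add: mem_transpose_image)
    have rl: "relabel (transpose i (Suc i) ` K) j = relabel K j" "relabel (transpose j (Suc j) ` K) i = relabel K i"
      using far(1) by (simp_all add: relabel_transpose)
    show ?thesis
    proof (cases "i \<in> K \<and> Suc i \<in> K \<and> j \<in> K \<and> Suc j \<in> K")
      case True
      have "relabel K i + 2 \<le> relabel K j"
        using relabel_Suc[OF K, of i] relabel_less[OF K, of j "Suc i"] True far(1) by simp
      then have "([(relabel K i, True), (relabel K j, True)], [(relabel K j, True), (relabel K i, True)])
          \<in> braid_relations (card K)"
        using relabel_letter[OF K] True unfolding braid_relations_def by blast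
      then show ?thesis using True far(2,3) by (simp add: m rl word_cong_relation)
    next
      case False
      then have "forget K l = forget K r" using far(2,3) by (auto simp: m rl)
      then show ?thesis using refl by simp
    qed
  next
    case braid
    let ?ti = "transpose i (Suc i)" and ?ts = "transpose (Suc i) (Suc (Suc i))"
    have m: "Suc i \<in> ?ti ` K \<longleftrightarrow> i \<in> K" "Suc (Suc i) \<in> ?ti ` K \<longleftrightarrow> Suc (Suc i) \<in> K"
      "i \<in> ?ts ` ?ti ` K \<longleftrightarrow> Suc i \<in> K" "Suc i \<in> ?ts ` ?ti ` K \<longleftrightarrow> Suc (Suc i) \<in> K"
      "i \<in> ?ts ` K \<longleftrightarrow> i \<in> K" "Suc i \<in> ?ts ` K \<longleftrightarrow> Suc (Suc i) \<in> K"
      "Suc i \<in> ?ti ` ?ts ` K \<longleftrightarrow> i \<in> K" "Suc (Suc i) \<in> ?ti ` ?ts ` K \<longleftrightarrow> Suc i \<in> K"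
      by (simp_all add: mem_transpose_image)
    have fin: "finite (?ti ` K)" "finite (?ts ` K)" using K by auto
    have rl: "relabel (?ti ` K) (Suc i) = relabel K (Suc i)" "relabel (?ts ` ?ti ` K) i = relabel (?ti ` K) i"
      "relabel (?ts ` K) i = relabel K i" "relabel (?ti ` ?ts ` K) (Suc i) = relabel (?ts ` K) (Suc i)"
      by (simp_all add: relabel_transpose)
    have rs: "relabel K (Suc i) = relabel K i + (if Suc i \<in> K then 1 else 0)"
      "relabel K (Suc i) = relabel (?ti ` K) i + (if i \<in> K then 1 else 0)"
      "relabel (?ts ` K) (Suc i) = relabel K i + (if Suc (Suc i) \<in> K then 1 else 0)"
      using relabel_Suc[OF K, of i] relabel_Suc[OF fin(1), of i] relabel_Suc[OF fin(2), of i]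
      by (simp_all add: m rl)
    show ?thesis
    proof (cases "i \<in> K \<and> Suc i \<in> K \<and> Suc (Suc i) \<in> K")
      case True
      have "Suc (relabel K i) = relabel K (Suc i)" using rs(1) True by simp
      then have "([(relabel K i, True), (Suc (relabel K i), True), (relabel K i, True)],
          [(Suc (relabel K i), True), (relabel K i, True), (Suc (relabel K i), True)]) \<in> braid_relations (card K)"
        using relabel_letter[OF K, of i] relabel_letter[OF K, of "Suc i"] True
        unfolding braid_relations_def by auto
      moreover have "forget K l = [(relabel K i, True), (Suc (relabel K i), True), (relabel K i, True)]"
        "forget K r = [(Suc (relabel K i), True), (relabel K i, True), (Suc (relabel K i), True)]"
        using True braid rs by (simp_all add: m rl)
      ultimately show ?thesis by (simp add: word_cong_relation)
    next
      case False
      then have "forget K l = forget K r" using braid rs by (auto simp: m rl)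
      then show ?thesis using refl by simp
    qed
  qed
qed

lemma forget_cancel:
  assumes K: "finite K"
  shows "(forget K [(s, b), (s, \<not> b)], []) \<in> word_cong {1..<card K} (braid_relations (card K))"
proof (cases "s \<in> K \<and> Suc s \<in> K")
  case True
  then have "forget K [(s, b), (s, \<not> b)] = [(relabel K s, b), (relabel K s, \<not> b)]"
    by (simp add: transpose_image_self)
  then show ?thesis
    using word_cong.cancel[of "[]" "{1..<card K}" "[]" "relabel K s" b] relabel_letter[OF K] True by simp
next
  case False
  then have "forget K [(s, b), (s, \<not> b)] = []" by (auto simp: mem_transpose_image)
  then show ?thesis by (simp add: word_cong.refl)
qed

lemma forget_cong:
  assumes "(u, v) \<in> word_cong {1..<n} (braid_relations n)"
  shows "finite K \<Longrightarrow> (forget K u, forget K v) \<in> word_cong {1..<card K} (braid_relations (card K))"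
  using assms
proof (induction rule: word_cong.induct)
  case (refl w)
  then show ?case by (intro word_cong.refl forget_words)
next
  case (cancel u v s b)
  note app = word_cong_append[OF braid_relations_words]
  let ?L = "track K u"
  have t: "track ?L [(s, b), (s, \<not> b)] = ?L" by (simp add: transpose_transpose_image)
  have L: "finite ?L" "card ?L = card K" using cancel by (simp_all add: finite_track card_track)
  have "(forget K u @ forget ?L [(s, b), (s, \<not> b)] @ forget ?L v, forget K u @ [] @ forget ?L v)
      \<in> word_cong {1..<card K} (braid_relations (card K))"
    using forget_cancel[OF L(1), of s b] forget_words[OF L(1), of v] forget_words[OF cancel(4), of u] L(2)
    by (intro app word_cong.refl) (simp_all del: forget.simps in_lists_conv_set)
  then show ?case unfolding forget_append t by simp
next
  case (rel u v l r)
  note app = word_cong_append[OF braid_relations_words]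
  let ?L = "track K u"
  have "word_perm l = word_perm r"
    by (rule word_perm_cong[OF word_cong_relation[OF rel(3)]])
  then have t: "track ?L l = track ?L r" by (rule track_eq)
  have L: "finite ?L" "card ?L = card K" using rel by (simp_all add: finite_track card_track)
  have L': "finite (track ?L r)" "card (track ?L r) = card K" using L by (simp_all add: finite_track card_track)
  show ?case unfolding forget_append t
    using forget_relation[OF L(1) rel(3)] forget_words[OF L'(1), of v] forget_words[OF rel(4), of u] L(2) L'(2)
    by (intro app word_cong.refl) (simp_all del: forget.simps in_lists_conv_set)
qed (blast intro: word_cong.sym word_cong.trans)+

lemma word_perm_artin_word: "word_perm (artin_word i j) = id"
  using word_perm_conj[of "[Suc i..<j]"]
  by (simp add: artin_word_def word_perm_append fun_eq_iff)

text \<open>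
  Peeling off the outer crossings \<open>\<sigma>\<^sub>j\<close> and \<open>\<sigma>\<^sub>j\<^sup>-\<^sup>1\<close> exchanges the roles of \<open>j\<close> and \<open>j + 1\<close> in \<open>K\<close>, so
  the induction has to be over all \<open>K\<close>.
\<close>

lemma forget_artin_word:
  assumes "finite K" "i < j"
  shows "braid_class (card K) (forget K (artin_word i j)) =
    (if {i, j} \<subseteq> K then artin_gen (card K) (relabel K i) (relabel K j) else \<one>\<^bsub>braid_group (card K)\<^esub>)"
  using assms
proof (induction j arbitrary: K)
  case (Suc j)
  let ?k = "card K" and ?B = "braid_group (card K)" and ?K' = "transpose j (Suc j) ` K"
  note K = \<open>finite K\<close>
  show ?case
  proof (cases "i = j")
    case True
    have "forget K (artin_word i (Suc j)) = (if {i, j, Suc j} \<subseteq> K then artin_word (relabel K i) (Suc (relabel K i)) else [])"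
      using True by (auto simp: artin_word_base transpose_image_self mem_transpose_image)
    then show ?thesis using True relabel_Suc[OF K, of j]
      by (auto simp: artin_gen_def braid_class_Nil)
  next
    case False
    then have ij: "i < j" using Suc.prems by simp
    have IH: "braid_class ?k (forget ?K' (artin_word i j)) =
        (if {i, j} \<subseteq> ?K' then artin_gen ?k (relabel ?K' i) (relabel ?K' j) else \<one>\<^bsub>braid_group ?k\<^esub>)"
      using Suc.IH[of ?K'] ij K by (simp add: card_image)
    have i: "i \<in> ?K' \<longleftrightarrow> i \<in> K" "relabel ?K' i = relabel K i"
      using ij by (simp_all add: mem_transpose_image relabel_transpose)
    have F: "forget K (artin_word i (Suc j)) =
      (if {j, Suc j} \<subseteq> K then [(relabel K j, True)] else []) @ forget ?K' (artin_word i j) @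
      (if {j, Suc j} \<subseteq> ?K' then [(relabel ?K' j, False)] else [])"
      using ij by (simp add: artin_word_Suc forget_append track_pure word_perm_artin_word)
    show ?thesis
    proof (cases "j \<in> K \<and> Suc j \<in> K")
      case True
      then have K': "?K' = K" by (simp add: transpose_image_self)
      let ?r = "relabel K j"
      have r: "1 \<le> ?r" "?r < ?k" using relabel_letter[OF K, of j] True by simp_all
      have Sr: "relabel K (Suc j) = Suc ?r" using relabel_Suc[OF K, of j] True by simp
      have fw: "forget K (artin_word i j) \<in> words {1..<?k}" by (rule forget_words[OF K])
      have "braid_class ?k (forget K (artin_word i (Suc j))) =
          braid_class ?k [(?r, True)] \<otimes>\<^bsub>braid_group ?k\<^esub> (braid_class ?k (forget K (artin_word i j)) \<otimes>\<^bsub>braid_group ?k\<^esub>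
            braid_class ?k [(?r, False)])"
        using F True r fw unfolding K'
        by (simp add: mult_braid_class append_in_lists_conv del: in_lists_conv_set)
      also have "\<dots> = (if {i, Suc j} \<subseteq> K then artin_gen ?k (relabel K i) (relabel K (Suc j)) else \<one>\<^bsub>braid_group ?k\<^esub>)"
      proof (cases "i \<in> K")
        case i: True
        have ri: "1 \<le> relabel K i" "relabel K i < ?r"
          using relabel_pos[OF K i] relabel_less[OF K _ ij] True by simp_all
        have "artin_gen ?k (relabel K i) (Suc ?r) =
            braid_class ?k ([(?r, True)] @ artin_word (relabel K i) ?r @ [(?r, False)])"
          using ri by (simp add: artin_gen_def artin_word_Suc)
        then show ?thesis using IH i True r artin_word_in_words[of "relabel K i" ?r ?k] ri unfolding K'
          by (simp add: Sr artin_gen_def mult_braid_class append_in_lists_conv del: in_lists_conv_set)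
      next
        case i: False
        have "sigma ?k ?r \<in> carrier (braid_group ?k)" using sigma_closed r by simp
        then show ?thesis using IH i r unfolding K'
          by (simp add: braid_class_inv_letter flip: sigma_def)
      qed
      finally show ?thesis .
    next
      case False
      then have "\<not> {j, Suc j} \<subseteq> ?K'" by (auto simp: mem_transpose_image)
      then have "forget K (artin_word i (Suc j)) = forget ?K' (artin_word i j)" using F False by auto
      moreover have "relabel ?K' j = relabel K (Suc j)" if "Suc j \<in> K"
      proof -
        have "Suc j \<notin> ?K'" using False that by (simp add: mem_transpose_image)
        then show ?thesis
          using relabel_Suc[of ?K' j] relabel_transpose[of "Suc j" j K] K by simp
      qed
      ultimately show ?thesis using IH i by (simp add: mem_transpose_image)
    qed
  qed
qed simp

theorem pure_forget:
  assumes K: "K \<subseteq> {1..n}"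
  shows "\<exists>f\<in>hom (pure_braid_group n) (pure_braid_group (card K)).
    \<forall>i j. 1 \<le> i \<longrightarrow> i < j \<longrightarrow> j \<le> n \<longrightarrow> f (artin_gen n i j) =
      (if {i, j} \<subseteq> K then artin_gen (card K) (relabel K i) (relabel K j) else \<one>\<^bsub>pure_braid_group (card K)\<^esub>)"
proof -
  have fin: "finite K" using K finite_subset by blast
  let ?f = "lift_word (card K) (forget K)"
  have cl: "?f (braid_class n w) = braid_class (card K) (forget K w)" if "w \<in> words {1..<n}" for w
    using lift_word_class[of n "forget K" "card K" w] forget_cong[OF _ fin] that by simp
  have hom: "?f \<in> hom (pure_braid_group n) (braid_group (card K))"
  proof (rule homI)
    fix A assume "A \<in> carrier (pure_braid_group n)"
    then obtain w where w: "w \<in> words {1..<n}" "A = braid_class n w" by (rule carrier_pureE)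
    show "?f A \<in> carrier (braid_group (card K))"
      unfolding w(2) cl[OF w(1)] by (rule braid_class_closed[OF forget_words[OF fin]])
  next
    fix A B assume A: "A \<in> carrier (pure_braid_group n)" and B: "B \<in> carrier (pure_braid_group n)"
    obtain u where u: "u \<in> words {1..<n}" "word_perm u = id" "A = braid_class n u"
      using A by (rule carrier_pureE)
    obtain v where v: "v \<in> words {1..<n}" "word_perm v = id" "B = braid_class n v"
      using B by (rule carrier_pureE)
    have "u @ v \<in> words {1..<n}" using u v by (simp only: append_in_lists_conv)
    then show "?f (A \<otimes>\<^bsub>pure_braid_group n\<^esub> B) = ?f A \<otimes>\<^bsub>braid_group (card K)\<^esub> ?f B"
      unfolding u(3) v(3) mult_pure mult_braid_class[OF u(1) v(1)] cl[OF u(1)] cl[OF v(1)]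
        mult_braid_class[OF forget_words[OF fin] forget_words[OF fin]]
      by (simp add: cl forget_append track_pure[OF u(2)])
  qed
  have gen: "?f (artin_gen n i j) =
      (if {i, j} \<subseteq> K then artin_gen (card K) (relabel K i) (relabel K j) else \<one>\<^bsub>pure_braid_group (card K)\<^esub>)"
    if "1 \<le> i" "i < j" "j \<le> n" for i j
    using cl[OF artin_word_in_words[OF that]] forget_artin_word[OF fin that(2)]
    by (simp add: artin_gen_def one_pure)
  have "?f \<in> hom (pure_braid_group n) (pure_braid_group (card K))"
  proof (rule hom_pure_braid_groupI[OF hom])
    fix i j assume ij: "1 \<le> i" "i < j" "j \<le> n"
    have "\<one>\<^bsub>pure_braid_group (card K)\<^esub> \<in> carrier (pure_braid_group (card K))"
      by (rule monoid.one_closed[OF group.is_monoid[OF group_pure_braid_group]])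
    then show "?f (artin_gen n i j) \<in> carrier (pure_braid_group (card K))"
      using gen[OF ij] artin_gen_closed[of "relabel K i" "relabel K j" "card K"]
        relabel_pos[OF fin, of i] relabel_less[OF fin _ ij(2)] relabel_le_card[OF fin, of j] by auto
  qed
  then show ?thesis using gen by blast
qed

section \<open>The homomorphisms between graphic pure braid groups\<close>

definition graphic_proj :: "nat \<Rightarrow> nat set set \<Rightarrow> nat word set \<Rightarrow> nat word set set" where
  "graphic_proj n E A = graphic_kernel n E #>\<^bsub>pure_braid_group n\<^esub> A"

lemma graphic_gen_eq_proj: "graphic_gen n E i j = graphic_proj n E (artin_gen n i j)"
  by (simp add: graphic_gen_def graphic_proj_def)

lemma graphic_proj_hom: "graphic_proj n E \<in> hom (pure_braid_group n) (graphic_pure_braid_group n E)"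
  unfolding graphic_proj_def graphic_pure_braid_group_def
  by (rule normal.r_coset_hom_Mod[OF normal_graphic_kernel])

lemma graphic_gen_closed:
  "1 \<le> i \<Longrightarrow> i < j \<Longrightarrow> j \<le> n \<Longrightarrow> graphic_gen n E i j \<in> carrier (graphic_pure_braid_group n E)"
  unfolding graphic_gen_eq_proj by (rule hom_in_carrier[OF graphic_proj_hom artin_gen_closed])

lemma graphic_gen_eq_one:
  assumes "1 \<le> i" "i < j" "j \<le> n" "{i, j} \<notin> E"
  shows "graphic_gen n E i j = \<one>\<^bsub>graphic_pure_braid_group n E\<^esub>"
proof -
  have "artin_gen n i j \<in> graphic_kernel n E"
    unfolding graphic_kernel_def normal_closure_def graphic_relators_def using assms by blast
  then show ?thesis
    unfolding graphic_gen_def graphic_pure_braid_group_def one_FactGroup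
    by (rule subgroup.rcos_const[OF normal_imp_subgroup[OF normal_graphic_kernel] group_pure_braid_group])
qed

lemma generate_graphic_gen:
  "generate (graphic_pure_braid_group n E) {graphic_gen n E i j | i j. 1 \<le> i \<and> i < j \<and> j \<le> n} =
    carrier (graphic_pure_braid_group n E)"
proof -
  interpret q: group_hom "pure_braid_group n" "graphic_pure_braid_group n E" "graphic_proj n E"
    by (intro group_hom.intro group_hom_axioms.intro graphic_proj_hom group_pure_braid_group
        group_graphic_pure_braid_group)
  have "{graphic_gen n E i j | i j. 1 \<le> i \<and> i < j \<and> j \<le> n} = graphic_proj n E ` braid.gens n"
    unfolding artin_gens_eq[symmetric] graphic_gen_eq_proj by blast
  then show ?thesis
    using q.generate_img[OF gens_pure] unfolding generate_pure_braid_group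
    by (simp add: graphic_pure_braid_group_def carrier_FactGroup graphic_proj_def)
qed

lemma graphic_hom:
  assumes H: "group H" and h: "h \<in> hom (pure_braid_group n) H"
    and triv: "\<And>i j. 1 \<le> i \<Longrightarrow> i < j \<Longrightarrow> j \<le> n \<Longrightarrow> {i, j} \<notin> E \<Longrightarrow> h (artin_gen n i j) = \<one>\<^bsub>H\<^esub>"
  obtains g where "g \<in> hom (graphic_pure_braid_group n E) H"
    "\<And>i j. 1 \<le> i \<Longrightarrow> i < j \<Longrightarrow> j \<le> n \<Longrightarrow> g (graphic_gen n E i j) = h (artin_gen n i j)"
proof -
  interpret h: group_hom "pure_braid_group n" H h
    by (intro group_hom.intro group_hom_axioms.intro h H group_pure_braid_group)
  have "graphic_relators n E \<subseteq> kernel (pure_braid_group n) H h"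
    using triv artin_gen_closed by (auto simp: graphic_relators_def kernel_def)
  then have "graphic_kernel n E \<subseteq> kernel (pure_braid_group n) H h"
    unfolding graphic_kernel_def normal_closure_def using h.normal_kernel by blast
  from h.FactGroup_universal_kernel[OF normal_graphic_kernel this]
  obtain g where "g \<in> hom (graphic_pure_braid_group n E) H"
    "\<And>A. A \<in> carrier (pure_braid_group n) \<Longrightarrow> g (graphic_proj n E A) = h A"
    unfolding graphic_pure_braid_group_def graphic_proj_def by blast
  then show ?thesis using that artin_gen_closed by (simp add: graphic_gen_eq_proj)
qed

lemma graphic_hom_eqI:
  assumes "group H" "f \<in> hom (graphic_pure_braid_group n E) H" "f' \<in> hom (graphic_pure_braid_group n E) H"
    and "\<And>i j. 1 \<le> i \<Longrightarrow> i < j \<Longrightarrow> j \<le> n \<Longrightarrow> f (graphic_gen n E i j) = f' (graphic_gen n E i j)"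
    and "x \<in> carrier (graphic_pure_braid_group n E)"
  shows "f x = f' x"
  by (rule hom_eq_on_generate[OF group_graphic_pure_braid_group assms(1-3)
        _ _ assms(5)[folded generate_graphic_gen]])
     (use assms(4) in \<open>auto intro: graphic_gen_closed\<close>)

lemma relabel_bij:
  assumes "finite K"
  shows "bij_betw (relabel K) K {1..card K}"
proof -
  have inj: "inj_on (relabel K) K"
    by (rule strict_mono_on_imp_inj_on) (auto intro!: strict_mono_onI relabel_less assms)
  moreover have "relabel K ` K \<subseteq> {1..card K}"
    using relabel_pos[OF assms] relabel_le_card[OF assms] by auto
  ultimately have "relabel K ` K = {1..card K}"
    by (intro card_subset_eq) (simp_all add: card_image)
  then show ?thesis using inj by (simp add: bij_betw_def)
qed

lemma induced_edges_iff:
  assumes "finite K" "{i, j} \<subseteq> K"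
  shows "{relabel K i, relabel K j} \<in> induced_edges K E \<longleftrightarrow> {i, j} \<in> E"
proof
  assume "{relabel K i, relabel K j} \<in> induced_edges K E"
  then obtain e where e: "e \<in> E" "e \<subseteq> K" "relabel K ` {i, j} = relabel K ` e"
    unfolding induced_edges_def by auto
  then have "{i, j} = e"
    using inj_on_image_eq_iff[OF bij_betw_imp_inj_on[OF relabel_bij[OF assms(1)]] assms(2) e(2)] by simp
  then show "{i, j} \<in> E" using e by simp
next
  assume "{i, j} \<in> E"
  then have "relabel K ` {i, j} \<in> induced_edges K E" using assms(2) unfolding induced_edges_def by blast
  then show "{relabel K i, relabel K j} \<in> induced_edges K E" by simp
qed

definition rho_spec where
  "rho_spec n E K f \<longleftrightarrow>
     f \<in> hom (graphic_pure_braid_group n E) (induced_pure_braid_group E K) \<and>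
     f \<in> extensional (carrier (graphic_pure_braid_group n E)) \<and>
     (\<forall>i j. 1 \<le> i \<and> i < j \<and> j \<le> n \<longrightarrow>
        f (graphic_gen n E i j) =
          (if {i, j} \<subseteq> K
           then graphic_gen (card K) (induced_edges K E) (relabel K i) (relabel K j)
           else \<one>\<^bsub>induced_pure_braid_group E K\<^esub>))"

text \<open>
  Forgetting strands maps the relators to relators or to \<open>1\<close>, so it induces a map of the quotients.
  Uniqueness holds because the Artin generators generate.
\<close>

lemma rho_spec_rho:
  assumes K: "K \<subseteq> {1..n}"
  shows "rho_spec n E K (rho n E K)"
proof -
  let ?H = "induced_pure_braid_group E K" and ?G = "graphic_pure_braid_group n E"
  have fin: "finite K" using K finite_subset by blast
  have H: "group ?H" by (rule group_graphic_pure_braid_group)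
  obtain f where f: "f \<in> hom (pure_braid_group n) (pure_braid_group (card K))"
    and fg: "\<And>i j. 1 \<le> i \<Longrightarrow> i < j \<Longrightarrow> j \<le> n \<Longrightarrow> f (artin_gen n i j) =
      (if {i, j} \<subseteq> K then artin_gen (card K) (relabel K i) (relabel K j) else \<one>\<^bsub>pure_braid_group (card K)\<^esub>)"
    using pure_forget[OF K] by blast
  let ?h = "graphic_proj (card K) (induced_edges K E) \<circ> f"
  have h: "?h \<in> hom (pure_braid_group n) ?H" by (rule Group.hom_compose[OF f graphic_proj_hom])
  have hg: "?h (artin_gen n i j) = (if {i, j} \<subseteq> K
       then graphic_gen (card K) (induced_edges K E) (relabel K i) (relabel K j) else \<one>\<^bsub>?H\<^esub>)"
    if "1 \<le> i" "i < j" "j \<le> n" for i j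
    using fg[OF that] hom_one[OF graphic_proj_hom group_pure_braid_group H]
    by (auto simp: graphic_gen_eq_proj)
  have triv: "?h (artin_gen n i j) = \<one>\<^bsub>?H\<^esub>" if ij: "1 \<le> i" "i < j" "j \<le> n" "{i, j} \<notin> E" for i j
  proof (cases "{i, j} \<subseteq> K")
    case True
    then have "{relabel K i, relabel K j} \<notin> induced_edges K E"
      using induced_edges_iff[OF fin True] ij by simp
    moreover have "1 \<le> relabel K i" "relabel K i < relabel K j" "relabel K j \<le> card K"
      using relabel_pos[OF fin, of i] relabel_less[OF fin _ ij(2)] relabel_le_card[OF fin, of j] True
      by auto
    ultimately have "graphic_gen (card K) (induced_edges K E) (relabel K i) (relabel K j) = \<one>\<^bsub>?H\<^esub>"
      by (intro graphic_gen_eq_one)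
    then show ?thesis using hg[OF ij(1-3)] True by simp
  next
    case False
    then show ?thesis using hg[OF ij(1-3)] by auto
  qed
  obtain g where g: "g \<in> hom ?G ?H"
    and gg: "\<And>i j. 1 \<le> i \<Longrightarrow> i < j \<Longrightarrow> j \<le> n \<Longrightarrow> g (graphic_gen n E i j) = ?h (artin_gen n i j)"
    by (rule graphic_hom[where E = E, OF H h triv]) blast+
  have "rho_spec n E K (restrict g (carrier ?G))"
    unfolding rho_spec_def
  proof (intro conjI allI impI)
    show "restrict g (carrier ?G) \<in> hom ?G ?H"
      using g group.is_monoid[OF group_graphic_pure_braid_group] by (auto simp: hom_def monoid.m_closed)
    fix i j assume "1 \<le> i \<and> i < j \<and> j \<le> n"
    then show "restrict g (carrier ?G) (graphic_gen n E i j) = (if {i, j} \<subseteq> K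
       then graphic_gen (card K) (induced_edges K E) (relabel K i) (relabel K j) else \<one>\<^bsub>?H\<^esub>)"
      using gg hg graphic_gen_closed by simp
  qed simp
  note spec = this
  have unique: "f1 = f2" if "rho_spec n E K f1" "rho_spec n E K f2" for f1 f2
  proof (rule extensionalityI[of _ "carrier ?G"])
    show "f1 x = f2 x" if "x \<in> carrier ?G" for x
      by (rule graphic_hom_eqI[OF H _ _ _ that])
         (use \<open>rho_spec n E K f1\<close> \<open>rho_spec n E K f2\<close> in \<open>simp_all add: rho_spec_def\<close>)
  qed (use that in \<open>simp_all add: rho_spec_def\<close>)
  have "\<exists>!f. rho_spec n E K f"
    by (rule ex1I[of "rho_spec n E K", OF spec]) (rule unique[OF _ spec])
  then have "rho_spec n E K (THE f. rho_spec n E K f)" by (rule theI')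
  moreover have "rho n E K = (THE f. rho_spec n E K f)" unfolding rho_def rho_spec_def ..
  ultimately show ?thesis by simp
qed

lemma rho_hom:
  "K \<subseteq> {1..n} \<Longrightarrow> rho n E K \<in> hom (graphic_pure_braid_group n E) (induced_pure_braid_group E K)"
  using rho_spec_rho[of K n E] by (simp add: rho_spec_def)

lemma rho_gen:
  assumes "K \<subseteq> {1..n}" "1 \<le> i" "i < j" "j \<le> n"
  shows "rho n E K (graphic_gen n E i j) = (if {i, j} \<subseteq> K
           then graphic_gen (card K) (induced_edges K E) (relabel K i) (relabel K j)
           else \<one>\<^bsub>induced_pure_braid_group E K\<^esub>)"
  using rho_spec_rho[OF assms(1), of E] assms(2-4) by (simp add: rho_spec_def)

lemma strand_hom:
  assumes "k \<le> n" "\<And>i. 1 \<le> i \<Longrightarrow> i \<le> k \<Longrightarrow> 1 \<le> x i \<and> x i \<le> n"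
    and "\<And>i j. 1 \<le> i \<Longrightarrow> i < j \<Longrightarrow> j \<le> k \<Longrightarrow> x i < x j"
  obtains h where "h \<in> hom (pure_braid_group k) (graphic_pure_braid_group n E)"
    "\<And>i j. 1 \<le> i \<Longrightarrow> i < j \<Longrightarrow> j \<le> k \<Longrightarrow> h (artin_gen k i j) = graphic_gen n E (x i) (x j)"
proof -
  have "\<exists>h\<in>hom (pure_braid_group k) (pure_braid_group n).
    \<forall>i j. 1 \<le> i \<longrightarrow> i < j \<longrightarrow> j \<le> k \<longrightarrow> h (artin_gen k i j) = artin_gen n (x i) (x j)"
    by (rule pure_strand_inclusion) (use assms in auto)
  then obtain h where h: "h \<in> hom (pure_braid_group k) (pure_braid_group n)"
    "\<forall>i j. 1 \<le> i \<longrightarrow> i < j \<longrightarrow> j \<le> k \<longrightarrow> h (artin_gen k i j) = artin_gen n (x i) (x j)"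
    by (rule bexE)
  have "graphic_proj n E \<circ> h \<in> hom (pure_braid_group k) (graphic_pure_braid_group n E)"
    by (rule Group.hom_compose[OF h(1) graphic_proj_hom])
  then show ?thesis using that h(2) by (simp add: graphic_gen_eq_proj)
qed

definition enum :: "nat set \<Rightarrow> nat \<Rightarrow> nat" where
  "enum K = inv_into K (relabel K)"

lemma enum_in: "finite K \<Longrightarrow> 1 \<le> p \<Longrightarrow> p \<le> card K \<Longrightarrow> enum K p \<in> K"
  unfolding enum_def using bij_betw_imp_surj_on[OF relabel_bij] by (metis atLeastAtMost_iff inv_into_into)

lemma relabel_enum: "finite K \<Longrightarrow> 1 \<le> p \<Longrightarrow> p \<le> card K \<Longrightarrow> relabel K (enum K p) = p"
  unfolding enum_def using bij_betw_imp_surj_on[OF relabel_bij] by (metis atLeastAtMost_iff f_inv_into_f)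

lemma enum_relabel: "finite K \<Longrightarrow> x \<in> K \<Longrightarrow> enum K (relabel K x) = x"
  unfolding enum_def using bij_betw_imp_inj_on[OF relabel_bij] by (rule inv_into_f_f)

lemma enum_less:
  assumes "finite K" "1 \<le> p" "p < q" "q \<le> card K"
  shows "enum K p < enum K q"
proof (rule ccontr)
  assume "\<not> enum K p < enum K q"
  then have "relabel K (enum K q) \<le> relabel K (enum K p)"
    unfolding relabel_def using assms(1) by (intro card_mono) auto
  then show False using relabel_enum[of K p] relabel_enum[of K q] assms by simp
qed

lemma strand_hom_enum:
  assumes K: "K \<subseteq> {1..n}"
  obtains h where "h \<in> hom (pure_braid_group (card K)) (graphic_pure_braid_group n E)"
    "\<And>i j. 1 \<le> i \<Longrightarrow> i < j \<Longrightarrow> j \<le> card K \<Longrightarrow>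
      h (artin_gen (card K) i j) = graphic_gen n E (enum K i) (enum K j)"
proof (rule strand_hom[of "card K" n "enum K" E])
  have fin: "finite K" using K finite_subset by blast
  show "card K \<le> n" using card_mono[OF _ K] by simp
  show "1 \<le> enum K i \<and> enum K i \<le> n" if "1 \<le> i" "i \<le> card K" for i
    using enum_in[OF fin that] K by auto
  show "enum K i < enum K j" if "1 \<le> i" "i < j" "j \<le> card K" for i j
    using enum_less[OF fin that] .
qed (use that in blast)

text \<open>
  The graph induced on a clique is complete, so no relators have to be respected when its strands
  are put into the larger graph.
\<close>

lemma clique_retraction:
  assumes K: "K \<in> cliques n E"
  obtains p where "p \<in> hom (graphic_pure_braid_group n E) (graphic_pure_braid_group n E)"
    "\<And>i j. 1 \<le> i \<Longrightarrow> i < j \<Longrightarrow> j \<le> n \<Longrightarrow> p (graphic_gen n E i j) =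
       (if {i, j} \<subseteq> K then graphic_gen n E i j else \<one>\<^bsub>graphic_pure_braid_group n E\<^esub>)"
    "\<And>g. rho n E K g = \<one>\<^bsub>induced_pure_braid_group E K\<^esub> \<Longrightarrow> p g = \<one>\<^bsub>graphic_pure_braid_group n E\<^esub>"
proof -
  let ?G = "graphic_pure_braid_group n E" and ?H = "induced_pure_braid_group E K"
  note G = group_graphic_pure_braid_group[of n E]
  have Kn: "K \<subseteq> {1..n}" and cl: "clique K E" using K by (auto simp: cliques_def)
  have fin: "finite K" using Kn finite_subset by blast
  obtain h where h: "h \<in> hom (pure_braid_group (card K)) ?G"
    and hg: "\<And>i j. 1 \<le> i \<Longrightarrow> i < j \<Longrightarrow> j \<le> card K \<Longrightarrow>
      h (artin_gen (card K) i j) = graphic_gen n E (enum K i) (enum K j)"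
    by (rule strand_hom_enum[OF Kn, of E]) blast
  have edge: "{i, j} \<in> induced_edges K E" if ij: "1 \<le> i" "i < j" "j \<le> card K" for i j
  proof -
    have "{enum K i, enum K j} \<subseteq> K" "enum K i \<noteq> enum K j"
      using enum_in[OF fin] enum_less[OF fin ij] ij by auto
    then have "{relabel K (enum K i), relabel K (enum K j)} \<in> induced_edges K E"
      using induced_edges_iff[OF fin, of "enum K i" "enum K j" E] cl by (simp add: clique_def)
    then show ?thesis using relabel_enum[OF fin] ij by simp
  qed
  obtain s where s: "s \<in> hom ?H ?G"
    and sg: "\<And>i j. 1 \<le> i \<Longrightarrow> i < j \<Longrightarrow> j \<le> card K \<Longrightarrow>
      s (graphic_gen (card K) (induced_edges K E) i j) = h (artin_gen (card K) i j)"
    by (rule graphic_hom[where E = "induced_edges K E", OF G h]) (use edge in blast)+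
  have s1: "s \<one>\<^bsub>?H\<^esub> = \<one>\<^bsub>?G\<^esub>"
    by (rule hom_one[OF s group_graphic_pure_braid_group G])
  show ?thesis
  proof (rule that[of "s \<circ> rho n E K"])
    show "s \<circ> rho n E K \<in> hom ?G ?G" by (rule Group.hom_compose[OF rho_hom[OF Kn] s])
    show "(s \<circ> rho n E K) (graphic_gen n E i j) = (if {i, j} \<subseteq> K then graphic_gen n E i j else \<one>\<^bsub>?G\<^esub>)"
      if ij: "1 \<le> i" "i < j" "j \<le> n" for i j
    proof (cases "{i, j} \<subseteq> K")
      case True
      have "1 \<le> relabel K i" "relabel K i < relabel K j" "relabel K j \<le> card K"
        using relabel_pos[OF fin, of i] relabel_less[OF fin _ ij(2)] relabel_le_card[OF fin, of j] True
        by auto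
      then show ?thesis using rho_gen[OF Kn ij, of E] sg hg True enum_relabel[OF fin] by simp
    next
      case False
      then show ?thesis using rho_gen[OF Kn ij, of E] s1 by auto
    qed
    show "(s \<circ> rho n E K) g = \<one>\<^bsub>?G\<^esub>" if "rho n E K g = \<one>\<^bsub>?H\<^esub>" for g
      using that s1 by simp
  qed
qed

section \<open>Commutation relations and central elements\<close>

lemma pure_hom_commute:
  assumes "h \<in> hom (pure_braid_group k) H" "A \<in> carrier (pure_braid_group k)" "B \<in> carrier (pure_braid_group k)"
    and "A \<otimes>\<^bsub>braid_group k\<^esub> B = B \<otimes>\<^bsub>braid_group k\<^esub> A"
  shows "h A \<otimes>\<^bsub>H\<^esub> h B = h B \<otimes>\<^bsub>H\<^esub> h A"
  using hom_mult[OF assms(1-3)] hom_mult[OF assms(1,3,2)] assms(4) by (simp add: mult_pure)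

lemma full_twist_pure: "braid.full_twist n n \<in> carrier (pure_braid_group n)"
proof -
  have "set (map (\<lambda>(i, j). braid.art n i j) (index_pairs n)) \<subseteq> carrier (pure_braid_group n)"
    using gens_pure[of n] braid.art_in_gens[of _ _ n] by (auto simp: set_index_pairs)
  then show ?thesis
    using braid.list_prod_in_subgroup[OF subgroup_pure_braid]
    unfolding braid.full_twist_eq_prod[OF order_refl] by (simp add: pure_braid_group_def)
qed

lemma hom_list_prod:
  assumes "h \<in> hom (pure_braid_group k) H" "group H" "set xs \<subseteq> carrier (pure_braid_group k)"
  shows "h (braid.list_prod k xs) = group.list_prod H (map h xs)"
  using assms(3)
proof (induction xs)
  case Nil
  then show ?case using hom_one[OF assms(1) group_pure_braid_group assms(2)]
    by (simp add: group.list_prod_simps[OF assms(2)] one_pure)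
next
  case (Cons x xs)
  then have "braid.list_prod k xs \<in> carrier (pure_braid_group k)"
    using braid.list_prod_in_subgroup[OF subgroup_pure_braid, of xs k] by (simp add: pure_braid_group_def)
  then show ?case using Cons hom_mult[OF assms(1), of x "braid.list_prod k xs"]
    by (simp add: group.list_prod_simps[OF assms(2)] mult_pure)
qed

lemma clique_center:
  fixes n :: nat and E :: "nat set set"
  assumes K: "K \<subseteq> {1..n}"
  defines "G \<equiv> graphic_pure_braid_group n E"
  obtains z where "z \<in> carrier G"
    "\<And>i j. i \<in> K \<Longrightarrow> j \<in> K \<Longrightarrow> i < j \<Longrightarrow> z \<otimes>\<^bsub>G\<^esub> graphic_gen n E i j = graphic_gen n E i j \<otimes>\<^bsub>G\<^esub> z"
    "z = group.list_prod G (map (\<lambda>(i, j). graphic_gen n E (enum K i) (enum K j)) (index_pairs (card K)))"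
proof -
  let ?k = "card K"
  have fin: "finite K" using K finite_subset by blast
  have grp: "group G" unfolding G_def by (rule group_graphic_pure_braid_group)
  obtain h where h: "h \<in> hom (pure_braid_group ?k) G"
    and hg: "\<And>i j. 1 \<le> i \<Longrightarrow> i < j \<Longrightarrow> j \<le> ?k \<Longrightarrow>
      h (artin_gen ?k i j) = graphic_gen n E (enum K i) (enum K j)"
    unfolding G_def by (rule strand_hom_enum[OF K, of E]) blast
  show ?thesis
  proof (rule that[of "h (braid.full_twist ?k ?k)"])
    show "h (braid.full_twist ?k ?k) \<in> carrier G" by (rule hom_in_carrier[OF h full_twist_pure])
    fix i j assume ij: "i \<in> K" "j \<in> K" "i < j"
    define p q where "p = relabel K i" and "q = relabel K j"
    have pq: "1 \<le> p" "p < q" "q \<le> ?k"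
      using relabel_pos[OF fin ij(1)] relabel_less[OF fin ij(2,3)] relabel_le_card[OF fin, of j]
      by (auto simp: p_def q_def)
    have e: "enum K p = i" "enum K q = j" using enum_relabel[OF fin] ij by (auto simp: p_def q_def)
    show "h (braid.full_twist ?k ?k) \<otimes>\<^bsub>G\<^esub> graphic_gen n E i j = graphic_gen n E i j \<otimes>\<^bsub>G\<^esub> h (braid.full_twist ?k ?k)"
      using pure_hom_commute[OF h full_twist_pure artin_gen_closed[OF pq]]
        braid.full_twist_commutes_art[OF pq] artin_gen_eq_art[OF pq] hg[OF pq] e by simp
  next
    have eq: "map (\<lambda>(i, j). braid.art ?k i j) (index_pairs ?k) = map (\<lambda>(i, j). artin_gen ?k i j) (index_pairs ?k)"
      using artin_gen_eq_art[of _ _ ?k] by (auto simp: set_index_pairs)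
    have "h (braid.full_twist ?k ?k) =
        group.list_prod G (map h (map (\<lambda>(i, j). artin_gen ?k i j) (index_pairs ?k)))"
      unfolding braid.full_twist_eq_prod[OF order_refl] eq
      by (rule hom_list_prod[OF h grp]) (auto simp: set_index_pairs artin_gen_closed)
    also have "map h (map (\<lambda>(i, j). artin_gen ?k i j) (index_pairs ?k)) =
        map (\<lambda>(i, j). graphic_gen n E (enum K i) (enum K j)) (index_pairs ?k)"
      using hg by (auto simp: set_index_pairs)
    finally show "h (braid.full_twist ?k ?k) =
      group.list_prod G (map (\<lambda>(i, j). graphic_gen n E (enum K i) (enum K j)) (index_pairs ?k))" .
  qed
qed

text \<open>
  The central element is the image of the full twist on the strands \<open>K\<close>.
\<close>

lemma clique_center_generates:
  fixes n :: nat and E :: "nat set set"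
  assumes K: "K \<subseteq> {1..n}" and ij: "i \<in> K" "j \<in> K" "i < j"
  defines "G \<equiv> graphic_pure_braid_group n E"
  obtains z where "z \<in> carrier G"
    "\<And>k l. k \<in> K \<Longrightarrow> l \<in> K \<Longrightarrow> k < l \<Longrightarrow> z \<otimes>\<^bsub>G\<^esub> graphic_gen n E k l = graphic_gen n E k l \<otimes>\<^bsub>G\<^esub> z"
    "graphic_gen n E i j \<in> generate G
      (insert z {graphic_gen n E k l | k l. k \<in> K \<and> l \<in> K \<and> k < l \<and> (k, l) \<noteq> (i, j)})"
proof -
  interpret group G unfolding G_def by (rule group_graphic_pure_braid_group)
  have fin: "finite K" using K finite_subset by blast
  let ?k = "card K" and ?g = "\<lambda>(i, j). graphic_gen n E (enum K i) (enum K j)"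
  let ?S = "{graphic_gen n E k l | k l. k \<in> K \<and> l \<in> K \<and> k < l \<and> (k, l) \<noteq> (i, j)}"
  obtain z where z: "z \<in> carrier G"
    "\<And>i j. i \<in> K \<Longrightarrow> j \<in> K \<Longrightarrow> i < j \<Longrightarrow> z \<otimes>\<^bsub>G\<^esub> graphic_gen n E i j = graphic_gen n E i j \<otimes>\<^bsub>G\<^esub> z"
    "z = list_prod (map ?g (index_pairs ?k))"
    unfolding G_def by (rule clique_center[OF K, of E]) blast
  have "(relabel K i, relabel K j) \<in> set (index_pairs ?k)"
    using relabel_pos[OF fin ij(1)] relabel_less[OF fin ij(2,3)] relabel_le_card[OF fin, of j]
    by (auto simp: set_index_pairs)
  then obtain us vs where split: "index_pairs ?k = us @ (relabel K i, relabel K j) # vs"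
    by (auto simp: in_set_conv_decomp)
  have other: "?g u \<in> ?S" if u: "u \<in> set us \<union> set vs" for u
  proof -
    obtain p q where pq: "u = (p, q)" by (cases u)
    have "u \<in> set (index_pairs ?k)" using u split by auto
    then have b: "1 \<le> p" "p < q" "q \<le> ?k" by (auto simp: set_index_pairs pq)
    have "u \<noteq> (relabel K i, relabel K j)" using distinct_index_pairs[of ?k] u unfolding split by auto
    then have "(enum K p, enum K q) \<noteq> (i, j)"
      using relabel_enum[OF fin, of p] relabel_enum[OF fin, of q] b pq by auto
    then show ?thesis using enum_in[OF fin, of p] enum_in[OF fin, of q] enum_less[OF fin b] b pq by auto
  qed
  have bounds: "1 \<le> k \<and> k \<le> n" if "k \<in> K" for k using K that by auto
  have S: "?S \<subseteq> carrier G" unfolding G_def using bounds by (auto intro!: graphic_gen_closed)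
  have "graphic_gen n E i j \<in> generate G (insert z ?S)"
  proof (rule factor_of_list_prod_in_generate[of "map ?g us" "map ?g vs"])
    show "graphic_gen n E i j \<in> carrier G" unfolding G_def using bounds ij by (auto intro!: graphic_gen_closed)
    show "z = list_prod (map ?g us @ graphic_gen n E i j # map ?g vs)"
      using z(3) split enum_relabel[OF fin] ij by simp
    show "set (map ?g us) \<union> set (map ?g vs) \<subseteq> ?S" using other by auto
  qed (rule S)
  then show ?thesis using that z by blast
qed

text \<open>
  The product of the three generators of a triangle is central in their span. If one of them is \<open>1\<close>, the
  product of the other two commutes with each of them.
\<close>

lemma triangle_commute:
  fixes n :: nat and E :: "nat set set"
  assumes ijk: "1 \<le> i" "i < j" "j < k" "k \<le> n"
  defines "G \<equiv> graphic_pure_braid_group n E"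
  shows "{i, j} \<notin> E \<Longrightarrow> graphic_gen n E i k \<otimes>\<^bsub>G\<^esub> graphic_gen n E j k = graphic_gen n E j k \<otimes>\<^bsub>G\<^esub> graphic_gen n E i k"
      (is "_ \<Longrightarrow> ?bc")
    "{i, k} \<notin> E \<Longrightarrow> graphic_gen n E i j \<otimes>\<^bsub>G\<^esub> graphic_gen n E j k = graphic_gen n E j k \<otimes>\<^bsub>G\<^esub> graphic_gen n E i j"
      (is "_ \<Longrightarrow> ?ac")
    "{j, k} \<notin> E \<Longrightarrow> graphic_gen n E i j \<otimes>\<^bsub>G\<^esub> graphic_gen n E i k = graphic_gen n E i k \<otimes>\<^bsub>G\<^esub> graphic_gen n E i j"
      (is "_ \<Longrightarrow> ?ab")
proof -
  interpret group G unfolding G_def by (rule group_graphic_pure_braid_group)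
  let ?x = "\<lambda>p. if p = 1 then i else if p = 2 then j else k"
  obtain h where h: "h \<in> hom (pure_braid_group 3) G"
    and hg: "\<And>p q. 1 \<le> p \<Longrightarrow> p < q \<Longrightarrow> q \<le> 3 \<Longrightarrow> h (artin_gen 3 p q) = graphic_gen n E (?x p) (?x q)"
    unfolding G_def by (rule strand_hom[of 3 n ?x E]) (use ijk in \<open>auto split: if_splits\<close>)
  define a b c where "a = graphic_gen n E i j" and "b = graphic_gen n E i k" and "c = graphic_gen n E j k"
  have car: "a \<in> carrier G" "b \<in> carrier G" "c \<in> carrier G"
    unfolding a_def b_def c_def G_def using ijk by (auto intro!: graphic_gen_closed)
  have habc: "h (artin_gen 3 1 2) = a" "h (artin_gen 3 1 3) = b" "h (artin_gen 3 2 3) = c"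
    using hg[of 1 2] hg[of 1 3] hg[of 2 3] by (simp_all add: a_def b_def c_def)
  define z where "z = h (braid.full_twist 3 3)"
  have comm: "z \<otimes>\<^bsub>G\<^esub> h (artin_gen 3 p q) = h (artin_gen 3 p q) \<otimes>\<^bsub>G\<^esub> z" if "1 \<le> p" "p < q" "q \<le> 3" for p q
    unfolding z_def
    using pure_hom_commute[OF h full_twist_pure artin_gen_closed[OF that]]
      braid.full_twist_commutes_art[OF that] artin_gen_eq_art[OF that] by simp
  have p3: "index_pairs 3 = [(1, 2), (1, 3), (2, 3)]" by (simp add: numeral_3_eq_3 numeral_2_eq_2)
  have "z = list_prod (map h [artin_gen 3 1 2, artin_gen 3 1 3, artin_gen 3 2 3])"
    unfolding z_def braid.full_twist_eq_prod[OF order_refl] p3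
    using hom_list_prod[OF h is_group, of "[artin_gen 3 1 2, artin_gen 3 1 3, artin_gen 3 2 3]"]
      artin_gen_eq_art[of _ _ 3] artin_gen_closed[of _ _ 3] by simp
  then have z: "z = a \<otimes>\<^bsub>G\<^esub> (b \<otimes>\<^bsub>G\<^esub> c)" using habc car by simp
  have zc: "z \<otimes>\<^bsub>G\<^esub> a = a \<otimes>\<^bsub>G\<^esub> z" "z \<otimes>\<^bsub>G\<^esub> b = b \<otimes>\<^bsub>G\<^esub> z"
    using comm[of 1 2] comm[of 1 3] habc by simp_all
  {
    assume "{i, j} \<notin> E"
    then have "a = \<one>\<^bsub>G\<^esub>" unfolding a_def G_def using ijk by (intro graphic_gen_eq_one) auto
    then show ?bc
      using commute_if_central_prod[of b c] zc z car by (simp add: b_def c_def)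
  next
    assume "{i, k} \<notin> E"
    then have "b = \<one>\<^bsub>G\<^esub>" unfolding b_def G_def using ijk by (intro graphic_gen_eq_one) auto
    then show ?ac
      using commute_if_central_prod[of a c] zc z car by (simp add: a_def c_def)
  next
    assume "{j, k} \<notin> E"
    then have "c = \<one>\<^bsub>G\<^esub>" unfolding c_def G_def using ijk by (intro graphic_gen_eq_one) auto
    then show ?ab
      using commute_if_central_prod[of a b] zc z car by (simp add: a_def b_def)
  }
qed

text \<open>
  Number the vertices 1 to 4. If one of the pairs 34, 23 and 12 is missing, the conjugation in the
  corresponding part of \<open>crossing_commute\<close> becomes trivial. If 14 is missing, then the generators of 12
  and 24 commute by the triangle relation, and again a conjugation is trivial.
\<close>

lemma quadruple_commute:
  fixes n :: nat and E :: "nat set set"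
  assumes ijkl: "1 \<le> i" "i < j" "j < k" "k < l" "l \<le> n"
  defines "G \<equiv> graphic_pure_braid_group n E"
  shows "graphic_gen n E i j \<otimes>\<^bsub>G\<^esub> graphic_gen n E k l = graphic_gen n E k l \<otimes>\<^bsub>G\<^esub> graphic_gen n E i j"
      (is "?par")
    "graphic_gen n E i l \<otimes>\<^bsub>G\<^esub> graphic_gen n E j k = graphic_gen n E j k \<otimes>\<^bsub>G\<^esub> graphic_gen n E i l"
      (is "?nest")
    "\<not> {{i, j}, {j, k}, {k, l}, {i, l}} \<subseteq> E \<Longrightarrow>
      graphic_gen n E i k \<otimes>\<^bsub>G\<^esub> graphic_gen n E j l = graphic_gen n E j l \<otimes>\<^bsub>G\<^esub> graphic_gen n E i k"
      (is "_ \<Longrightarrow> ?cross")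
proof -
  interpret group G unfolding G_def by (rule group_graphic_pure_braid_group)
  let ?x = "\<lambda>p. if p = 1 then i else if p = 2 then j else if p = 3 then k else l"
  let ?a = "artin_gen 4" and ?P = "pure_braid_group 4"
  obtain h where h: "h \<in> hom (?P) G"
    and hg: "\<And>p q. 1 \<le> p \<Longrightarrow> p < q \<Longrightarrow> q \<le> 4 \<Longrightarrow> h (?a p q) = graphic_gen n E (?x p) (?x q)"
    unfolding G_def by (rule strand_hom[of 4 n ?x E]) (use ijkl in \<open>auto split: if_splits\<close>)
  interpret h: group_hom "?P" G h
    by (intro group_hom.intro group_hom_axioms.intro h group_pure_braid_group is_group)
  have hv: "h (?a 1 2) = graphic_gen n E i j" "h (?a 1 3) = graphic_gen n E i k" "h (?a 1 4) = graphic_gen n E i l"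
    "h (?a 2 3) = graphic_gen n E j k" "h (?a 2 4) = graphic_gen n E j l" "h (?a 3 4) = graphic_gen n E k l"
    using hg[of 1 2] hg[of 1 3] hg[of 1 4] hg[of 2 3] hg[of 2 4] hg[of 3 4] by simp_all
  have ac: "?a p q \<in> carrier (?P)" if "1 \<le> p" "p < q" "q \<le> 4" for p q
    by (rule artin_gen_closed[OF that])
  have art: "braid.art 4 p q = ?a p q" if "1 \<le> p" "p < q" "q \<le> 4" for p q
    using artin_gen_eq_art[OF that] by simp
  have inv: "inv\<^bsub>braid_group 4\<^esub> A = inv\<^bsub>?P\<^esub> A" if "A \<in> carrier (?P)" for A
    using braid.m_inv_consistent[OF subgroup_pure_braid, of A 4] that by (simp add: pure_braid_group_def)
  show ?par
    ?nest
    using pure_hom_commute[OF h ac ac, of 1 2 3 4] pure_hom_commute[OF h ac ac, of 1 4 2 3]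
      braid.parallel_commute[of 4] art hv by simp_all
  have cross: "h (?a 1 3) \<otimes>\<^bsub>G\<^esub> h B = h B \<otimes>\<^bsub>G\<^esub> h (?a 1 3)"
    if "B \<in> {inv\<^bsub>?P\<^esub> ?a 3 4 \<otimes>\<^bsub>?P\<^esub> ?a 2 4 \<otimes>\<^bsub>?P\<^esub> ?a 3 4,
      ?a 2 3 \<otimes>\<^bsub>?P\<^esub> ?a 2 4 \<otimes>\<^bsub>?P\<^esub> inv\<^bsub>?P\<^esub> ?a 2 3,
      inv\<^bsub>?P\<^esub> ?a 1 2 \<otimes>\<^bsub>?P\<^esub> ?a 2 4 \<otimes>\<^bsub>?P\<^esub> ?a 1 2}" for B
  proof (rule pure_hom_commute[OF h])
    show "?a 1 3 \<in> carrier (?P)" by (rule ac) auto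
    show "B \<in> carrier (?P)" using that ac by auto
    show "?a 1 3 \<otimes>\<^bsub>braid_group 4\<^esub> B = B \<otimes>\<^bsub>braid_group 4\<^esub> ?a 1 3"
      using that braid.crossing_commute[of 4] art inv ac by (auto simp: mult_pure)
  qed
  have gc: "h (?a p q) \<in> carrier G" if "1 \<le> p" "p < q" "q \<le> 4" for p q using ac[OF that] by simp
  have cross': "h (?a 1 3) \<otimes>\<^bsub>G\<^esub> h (?a 2 4) = h (?a 2 4) \<otimes>\<^bsub>G\<^esub> h (?a 1 3)"
    if "h (?a 3 4) = \<one>\<^bsub>G\<^esub> \<or> h (?a 2 3) = \<one>\<^bsub>G\<^esub> \<or>
       h (?a 1 2) \<otimes>\<^bsub>G\<^esub> h (?a 2 4) = h (?a 2 4) \<otimes>\<^bsub>G\<^esub> h (?a 1 2)"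
    using that
  proof (elim disjE)
    assume "h (?a 3 4) = \<one>\<^bsub>G\<^esub>"
    then show ?thesis using cross[OF insertI1] ac gc by simp
  next
    assume "h (?a 2 3) = \<one>\<^bsub>G\<^esub>"
    then show ?thesis using cross[OF insertI2[OF insertI1]] ac gc by simp
  next
    assume eq: "h (?a 1 2) \<otimes>\<^bsub>G\<^esub> h (?a 2 4) = h (?a 2 4) \<otimes>\<^bsub>G\<^esub> h (?a 1 2)"
    have "h (inv\<^bsub>?P\<^esub> ?a 1 2 \<otimes>\<^bsub>?P\<^esub> ?a 2 4 \<otimes>\<^bsub>?P\<^esub> ?a 1 2) = h (?a 2 4)"
      using ac gc eq[symmetric] by (simp add: m_assoc)
    then show ?thesis using cross[OF insertI2[OF insertI2[OF insertI1]]] by simp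
  qed
  assume "\<not> {{i, j}, {j, k}, {k, l}, {i, l}} \<subseteq> E"
  then consider "{i, j} \<notin> E" | "{j, k} \<notin> E" | "{k, l} \<notin> E" | "{i, l} \<notin> E" by auto
  then have "h (?a 3 4) = \<one>\<^bsub>G\<^esub> \<or> h (?a 2 3) = \<one>\<^bsub>G\<^esub> \<or>
       h (?a 1 2) \<otimes>\<^bsub>G\<^esub> h (?a 2 4) = h (?a 2 4) \<otimes>\<^bsub>G\<^esub> h (?a 1 2)"
  proof cases
    case 1
    then have "h (?a 1 2) = \<one>\<^bsub>G\<^esub>" unfolding hv G_def using ijkl by (intro graphic_gen_eq_one) auto
    then show ?thesis using gc[of 2 4] by simp
  next
    case 2
    then have "h (?a 2 3) = \<one>\<^bsub>G\<^esub>" unfolding hv G_def using ijkl by (intro graphic_gen_eq_one) auto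
    then show ?thesis by simp
  next
    case 3
    then have "h (?a 3 4) = \<one>\<^bsub>G\<^esub>" unfolding hv G_def using ijkl by (intro graphic_gen_eq_one) auto
    then show ?thesis by simp
  next
    case 4
    then have "h (?a 1 2) \<otimes>\<^bsub>G\<^esub> h (?a 2 4) = h (?a 2 4) \<otimes>\<^bsub>G\<^esub> h (?a 1 2)"
      unfolding hv G_def using triangle_commute(2)[of i j l n E] ijkl by simp
    then show ?thesis by simp
  qed
  from cross'[OF this] show ?cross
    unfolding hv .
qed

section \<open>Maximal cliques with almost disjoint 4-cliques\<close>

definition edge_gen :: "nat \<Rightarrow> nat set set \<Rightarrow> nat set \<Rightarrow> nat word set set" where
  "edge_gen n E e = graphic_gen n E (Min e) (Max e)"

lemma edge_gen_pair: "i < j \<Longrightarrow> edge_gen n E {i, j} = graphic_gen n E i j"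
  by (simp add: edge_gen_def)

lemma edge_cases:
  fixes e :: "nat set"
  assumes "e \<in> [{1..n}]\<^bsup>2\<^esup>"
  obtains i j where "1 \<le> i" "i < j" "j \<le> n" "e = {i, j}"
proof -
  obtain x y where xy: "e = {x, y}" "x \<in> {1..n}" "y \<in> {1..n}" "x \<noteq> y"
    using assms unfolding nsets_2_eq by blast
  have yx: "e = {y, x}" using xy(1) by blast
  show ?thesis
  proof (cases "x < y")
    case True
    then show ?thesis using that[OF _ _ _ xy(1)] xy(2,3) by simp
  next
    case False
    then have "y < x" using xy(4) by simp
    then show ?thesis using that[OF _ _ _ yx] xy(2,3) by simp
  qed
qed

lemma edge_props:
  assumes "E \<subseteq> [{1..n}]\<^bsup>2\<^esup>" "e \<in> E"
  shows "e \<subseteq> {1..n}" "finite e" "card e = 2"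
proof -
  have "e \<in> [{1..n}]\<^bsup>2\<^esup>" using assms by (rule subsetD)
  then show "e \<subseteq> {1..n}" "finite e" "card e = 2" unfolding nsets_def by blast+
qed

lemma edge_gen_closed: "e \<in> [{1..n}]\<^bsup>2\<^esup> \<Longrightarrow> edge_gen n E e \<in> carrier (graphic_pure_braid_group n E)"
  by (erule edge_cases) (simp add: edge_gen_pair graphic_gen_closed)

text \<open>
  A case distinction on how the two pairs lie on the line. If they are disjoint and not interleaved, they
  commute in the pure braid group already. Otherwise the non-clique condition says that a side of the
  triangle or of the quadrilateral formed by them is missing.
\<close>

lemma edge_gens_commute_aux:
  fixes n :: nat and E :: "nat set set"
  defines "G \<equiv> graphic_pure_braid_group n E"
  assumes ab: "1 \<le> a" "a < b" "b \<le> n" "{a, b} \<in> E" and cd: "1 \<le> c" "c < d" "d \<le> n" "{c, d} \<in> E"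
    and le: "a \<le> c" and nc: "\<not> clique ({a, b} \<union> {c, d}) E"
  shows "graphic_gen n E a b \<otimes>\<^bsub>G\<^esub> graphic_gen n E c d = graphic_gen n E c d \<otimes>\<^bsub>G\<^esub> graphic_gen n E a b"
proof -
  note tri = triangle_commute[where n = n and E = E, folded G_def]
  note quad = quadruple_commute[where n = n and E = E, folded G_def]
  have clI: "clique {x, y, z} E" if "{x, y} \<in> E" "{x, z} \<in> E" "{y, z} \<in> E" for x y z
    using that unfolding clique_def by (auto simp: insert_commute)
  consider "a = c" "b = d" | "a = c" "b < d" | "a = c" "d < b" | "a < c" "b < c" | "a < c" "b = c"
    | "a < c" "c < b" "b < d" | "a < c" "c < b" "b = d" | "a < c" "d < b"
    using le by linarith
  then show ?thesis
  proof cases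
    case 2
    have "{b, d} \<notin> E" using clI[of a b d] ab cd nc 2 by (auto simp: insert_commute)
    then show ?thesis using tri(3)[of a b d] ab cd 2 by simp
  next
    case 3
    have "{d, b} \<notin> E" using clI[of a d b] ab cd nc 3 by (auto simp: insert_commute)
    then show ?thesis using tri(3)[of a d b] ab cd 3 by simp
  next
    case 4
    then show ?thesis using quad(1)[of a b c d] ab cd by simp
  next
    case 5
    have "{a, d} \<notin> E" using clI[of a b d] ab cd nc 5 by (auto simp: insert_commute)
    then show ?thesis using tri(2)[of a b d] ab cd 5 by simp
  next
    case 6
    have "\<not> {{a, c}, {c, b}, {b, d}, {a, d}} \<subseteq> E"
    proof
      assume "{{a, c}, {c, b}, {b, d}, {a, d}} \<subseteq> E"
      then have "clique {a, b, c, d} E" using ab(4) cd(4) unfolding clique_def by (auto simp: insert_commute)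
      then show False using nc by (simp add: insert_commute)
    qed
    then show ?thesis using quad(3)[of a c b d] ab cd 6 by simp
  next
    case 7
    have "{a, c} \<notin> E" using clI[of a c b] ab cd nc 7 by (auto simp: insert_commute)
    then show ?thesis using tri(1)[of a c b] ab cd 7 by simp
  next
    case 8
    then show ?thesis using quad(2)[of a c d b] ab cd by simp
  qed simp
qed

lemma edge_gens_commute:
  fixes n :: nat and E :: "nat set set"
  defines "G \<equiv> graphic_pure_braid_group n E"
  assumes E: "E \<subseteq> [{1..n}]\<^bsup>2\<^esup>" and e: "e \<in> E" and f: "f \<in> E" and nc: "\<not> clique (e \<union> f) E"
  shows "edge_gen n E e \<otimes>\<^bsub>G\<^esub> edge_gen n E f = edge_gen n E f \<otimes>\<^bsub>G\<^esub> edge_gen n E e"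
proof -
  obtain a b where ab: "1 \<le> a" "a < b" "b \<le> n" "e = {a, b}" using E e by (blast elim: edge_cases)
  obtain c d where cd: "1 \<le> c" "c < d" "d \<le> n" "f = {c, d}" using E f by (blast elim: edge_cases)
  note g = edge_gen_pair[OF ab(2), of n E] edge_gen_pair[OF cd(2), of n E]
  show ?thesis
  proof (cases "a \<le> c")
    case True
    show ?thesis unfolding ab(4) cd(4) g G_def
      by (rule edge_gens_commute_aux[OF ab(1-3) _ cd(1-3) _ True]) (use e f nc ab(4) cd(4) in simp_all)
  next
    case False
    then have "c \<le> a" by simp
    have "\<not> clique ({c, d} \<union> {a, b}) E" using nc ab(4) cd(4) by (simp add: Un_commute)
    then show ?thesis unfolding ab(4) cd(4) g G_def
      by (intro edge_gens_commute_aux[OF cd(1-3) _ ab(1-3) _ \<open>c \<le> a\<close>, symmetric])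
        (use e f ab(4) cd(4) in simp_all)
  qed
qed

lemma clique_subset: "clique K E \<Longrightarrow> L \<subseteq> K \<Longrightarrow> clique L E"
  by (auto simp: clique_def)

lemma ex_maximal_clique:
  assumes "K \<in> cliques n E"
  obtains L where "L \<in> maximal_cliques n E" "K \<subseteq> L"
proof -
  have "finite (cliques n E)" by (rule finite_subset[of _ "Pow {1..n}"]) (auto simp: cliques_def)
  from finite_has_maximal2[OF this assms] show ?thesis
    using that unfolding maximal_cliques_def by blast
qed

lemma three_clique_in_Un:
  assumes "card e = 2" "card e' = 2" "e \<noteq> e'" "e \<union> e' \<subseteq> K" "K \<in> cliques n E"
  obtains T where "T \<subseteq> e \<union> e'" "T \<in> k_cliques 3 n E"
proof -
  have fin: "finite e" "finite e'" using assms(1,2) card.infinite by fastforce+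
  have "e \<subset> e \<union> e'"
  proof (rule psubsetI)
    show "e \<noteq> e \<union> e'" using card_subset_eq[of e e'] fin assms by auto
  qed simp
  then have "card e < card (e \<union> e')" using fin by (intro psubset_card_mono) auto
  then obtain T where T: "T \<subseteq> e \<union> e'" "card T = 3"
    using obtain_subset_with_card_n[of 3 "e \<union> e'"] assms(1) by auto
  moreover have "T \<in> cliques n E" using T assms(4,5) clique_subset[of K E T] by (auto simp: cliques_def)
  ultimately show ?thesis using that by (simp add: k_cliques_def)
qed

text \<open>
  Two extensions of a triangle to a 4-clique would meet in this triangle.
\<close>

lemma three_clique_extends_uniquely:
  assumes disj: "\<And>K L. K \<in> k_cliques 4 n E \<Longrightarrow> L \<in> k_cliques 4 n E \<Longrightarrow> K \<noteq> L \<Longrightarrow> K \<inter> L \<notin> k_cliques 3 n E"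
    and T: "T \<in> k_cliques 3 n E" and u: "u \<notin> T" "insert u T \<in> cliques n E" and v: "v \<notin> T" "insert v T \<in> cliques n E"
  shows "u = v"
proof (rule ccontr)
  assume "u \<noteq> v"
  have "finite T" "card T = 3" using T card.infinite by (fastforce simp: k_cliques_def)+
  then have "insert u T \<in> k_cliques 4 n E" "insert v T \<in> k_cliques 4 n E"
    using u v by (simp_all add: k_cliques_def)
  moreover have "insert u T \<noteq> insert v T" "insert u T \<inter> insert v T = T" using \<open>u \<noteq> v\<close> u v by auto
  ultimately show False using disj[of "insert u T" "insert v T"] T by simp
qed

lemma maximal_clique_in_cliques: "K \<in> maximal_cliques n E \<Longrightarrow> K \<in> cliques n E"
  by (simp add: maximal_cliques_def)

text \<open>
  Two common edges contain a common triangle, and each of the cliques extends it by a vertex that the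
  other one lacks.
\<close>

lemma maximal_cliques_share_edge:
  assumes E: "E \<subseteq> [{1..n}]\<^bsup>2\<^esup>"
    and disj: "\<And>K L. K \<in> k_cliques 4 n E \<Longrightarrow> L \<in> k_cliques 4 n E \<Longrightarrow> K \<noteq> L \<Longrightarrow> K \<inter> L \<notin> k_cliques 3 n E"
    and K: "K \<in> maximal_cliques n E" and L: "L \<in> maximal_cliques n E" and KL: "K \<noteq> L"
    and e: "e \<in> E" "e \<subseteq> K \<inter> L" "e' \<in> E" "e' \<subseteq> K \<inter> L"
  shows "e = e'"
proof (rule ccontr)
  assume "e \<noteq> e'"
  have card: "card e = 2" "card e' = 2" using edge_props(3)[OF E] e by auto
  note Kc = maximal_clique_in_cliques[OF K] and Lc = maximal_clique_in_cliques[OF L]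
  obtain T where T: "T \<subseteq> e \<union> e'" "T \<in> k_cliques 3 n E"
    by (rule three_clique_in_Un[OF card \<open>e \<noteq> e'\<close> _ Kc]) (use e in auto)
  have "\<not> K \<subseteq> L" "\<not> L \<subseteq> K" using K L KL Kc Lc by (auto simp: maximal_cliques_def)
  then obtain u v where uv: "u \<in> K" "u \<notin> L" "v \<in> L" "v \<notin> K" by blast
  have sub: "insert u T \<subseteq> K" "insert v T \<subseteq> L" using T e uv by auto
  have "insert u T \<in> cliques n E" "insert v T \<in> cliques n E"
    using sub Kc Lc clique_subset[OF _ sub(1)] clique_subset[OF _ sub(2)] by (auto simp: cliques_def)
  then have "u = v"
    using three_clique_extends_uniquely[OF disj T(2)] T e uv by blast
  then show False using uv by simp
qed

text \<open>
  Two such edges of \<open>K\<close> contain a triangle that is joined completely to a vertex \<open>p\<close> of \<open>f\<close> outside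
  \<open>K\<close>. As \<open>K\<close> is maximal it is larger than the triangle, and so provides a second extension of it.
\<close>

lemma outside_edge_linked_to_one_edge:
  assumes E: "E \<subseteq> [{1..n}]\<^bsup>2\<^esup>"
    and disj: "\<And>K L. K \<in> k_cliques 4 n E \<Longrightarrow> L \<in> k_cliques 4 n E \<Longrightarrow> K \<noteq> L \<Longrightarrow> K \<inter> L \<notin> k_cliques 3 n E"
    and K: "K \<in> maximal_cliques n E" and f: "f \<in> E" "\<not> f \<subseteq> K"
    and e: "e \<in> E" "e \<subseteq> K" "e' \<in> E" "e' \<subseteq> K"
    and cl: "clique (e \<union> f) E" "clique (e' \<union> f) E"
  shows "e = e'"
proof (rule ccontr)
  assume "e \<noteq> e'"
  have card: "card e = 2" "card e' = 2" using edge_props(3)[OF E] e by auto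
  note Kc = maximal_clique_in_cliques[OF K]
  obtain T where T: "T \<subseteq> e \<union> e'" "T \<in> k_cliques 3 n E"
    by (rule three_clique_in_Un[OF card \<open>e \<noteq> e'\<close> _ Kc]) (use e in auto)
  have TK: "T \<subseteq> K" using T e by auto
  obtain p where p: "p \<in> f" "p \<notin> K" using f by blast
  have pn: "p \<in> {1..n}" using edge_props(1)[OF E f(1)] p(1) by blast
  have "{t, p} \<in> E" if t: "t \<in> T" for t
  proof -
    have "t \<noteq> p" using t TK p by auto
    moreover have "t \<in> e \<or> t \<in> e'" using t T(1) by auto
    ultimately show ?thesis using cl p(1) by (auto simp: clique_def)
  qed
  moreover have "T \<in> cliques n E" using T(2) by (simp add: k_cliques_def)
  ultimately have pT: "insert p T \<in> cliques n E"
    using pn unfolding cliques_def clique_def by (auto simp: insert_commute[of p])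
  have "K \<noteq> T" using pT K p by (auto simp: maximal_cliques_def)
  then obtain u where u: "u \<in> K" "u \<notin> T" using TK by blast
  have "insert u T \<subseteq> K" using u TK by auto
  then have "insert u T \<in> cliques n E" using Kc clique_subset[of K E "insert u T"] by (auto simp: cliques_def)
  then have "u = p" using three_clique_extends_uniquely[OF disj T(2) u(2) _ _ pT] p TK by blast
  then show False using u p by simp
qed

definition edges_in :: "nat set set \<Rightarrow> nat set \<Rightarrow> nat set set" where
  "edges_in E K = {e \<in> E. e \<subseteq> K}"

text \<open>
  On the edges this is the retraction onto the span of \<open>X\<close>; indexing by edge sets instead of vertex
  sets also covers single edges uniformly.
\<close>

definition is_retraction where
  "is_retraction n E X p \<longleftrightarrow> p \<in> hom (graphic_pure_braid_group n E) (graphic_pure_braid_group n E) \<and>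
    (\<forall>e\<in>E. p (edge_gen n E e) = (if e \<in> X then edge_gen n E e else \<one>\<^bsub>graphic_pure_braid_group n E\<^esub>))"

lemma clique_edges_retraction:
  assumes E: "E \<subseteq> [{1..n}]\<^bsup>2\<^esup>" and K: "K \<in> cliques n E"
  obtains p where "is_retraction n E (edges_in E K) p"
    "\<And>g. rho n E K g = \<one>\<^bsub>induced_pure_braid_group E K\<^esub> \<Longrightarrow> p g = \<one>\<^bsub>graphic_pure_braid_group n E\<^esub>"
proof -
  let ?G = "graphic_pure_braid_group n E"
  obtain p where p: "p \<in> hom (?G) (?G)"
    and pg: "\<And>i j. 1 \<le> i \<Longrightarrow> i < j \<Longrightarrow> j \<le> n \<Longrightarrow> p (graphic_gen n E i j) =
       (if {i, j} \<subseteq> K then graphic_gen n E i j else \<one>\<^bsub>?G\<^esub>)"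
    and p1: "\<And>g. rho n E K g = \<one>\<^bsub>induced_pure_braid_group E K\<^esub> \<Longrightarrow> p g = \<one>\<^bsub>?G\<^esub>"
    by (rule clique_retraction[OF K]) blast
  have "p (edge_gen n E e) = (if e \<in> edges_in E K then edge_gen n E e else \<one>\<^bsub>?G\<^esub>)"
    if e: "e \<in> E" for e
  proof -
    obtain i j where ij: "1 \<le> i" "i < j" "j \<le> n" "e = {i, j}" using E e by (blast elim: edge_cases)
    then show ?thesis using pg[OF ij(1-3)] e by (simp add: edge_gen_pair edges_in_def)
  qed
  then show ?thesis using that[of p] p p1 by (simp add: is_retraction_def)
qed

lemma generate_edge_gens:
  assumes E: "E \<subseteq> [{1..n}]\<^bsup>2\<^esup>"
  shows "generate (graphic_pure_braid_group n E) (edge_gen n E ` E) = carrier (graphic_pure_braid_group n E)"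
proof -
  let ?G = "graphic_pure_braid_group n E"
  interpret group "?G" by (rule group_graphic_pure_braid_group)
  have sub: "edge_gen n E ` E \<subseteq> carrier (?G)" using E edge_gen_closed by blast
  have "graphic_gen n E i j \<in> generate (?G) (edge_gen n E ` E)"
    if ij: "1 \<le> i" "i < j" "j \<le> n" for i j
  proof (cases "{i, j} \<in> E")
    case True
    then have "edge_gen n E {i, j} \<in> edge_gen n E ` E" by blast
    then show ?thesis using ij by (simp add: edge_gen_pair generate.incl)
  next
    case False
    then show ?thesis using graphic_gen_eq_one[OF ij] by (simp add: generate.one)
  qed
  then have "{graphic_gen n E i j | i j. 1 \<le> i \<and> i < j \<and> j \<le> n} \<subseteq>
      generate (?G) (edge_gen n E ` E)" by blast
  then have "carrier (?G) \<subseteq> generate (?G) (edge_gen n E ` E)"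
    unfolding generate_graphic_gen[symmetric] by (rule generate_subgroup_incl[OF _ generate_is_subgroup[OF sub]])
  then show ?thesis using generate_incl[OF sub] by blast
qed

lemma retraction_eq:
  assumes E: "E \<subseteq> [{1..n}]\<^bsup>2\<^esup>" and "is_retraction n E X p" "is_retraction n E X p'"
    and g: "g \<in> carrier (graphic_pure_braid_group n E)"
  shows "p g = p' g"
proof (rule hom_eq_on_generate[where f = p and f' = p' and S = "edge_gen n E ` E",
    OF group_graphic_pure_braid_group group_graphic_pure_braid_group])
  show "p \<in> hom (graphic_pure_braid_group n E) (graphic_pure_braid_group n E)"
    "p' \<in> hom (graphic_pure_braid_group n E) (graphic_pure_braid_group n E)"
    using assms(2,3) by (simp_all add: is_retraction_def)
  show "edge_gen n E ` E \<subseteq> carrier (graphic_pure_braid_group n E)" using E edge_gen_closed by blast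
  show "p s = p' s" if "s \<in> edge_gen n E ` E" for s
    using that assms(2,3) by (auto simp: is_retraction_def)
  show "g \<in> generate (graphic_pure_braid_group n E) (edge_gen n E ` E)"
    using g generate_edge_gens[OF E] by simp
qed

text \<open>
  The abstract result on retractions applies with the edge sets of the maximal cliques. Single edges
  are cliques as well, and provide the retractions onto single generators.
\<close>

theorem joint_kernel_rho_trivial:
  fixes n :: nat and E :: "nat set set"
  assumes E: "E \<subseteq> [{1..n}]\<^bsup>2\<^esup>"
    and disj: "\<And>K L. K \<in> k_cliques 4 n E \<Longrightarrow> L \<in> k_cliques 4 n E \<Longrightarrow> K \<noteq> L \<Longrightarrow> K \<inter> L \<notin> k_cliques 3 n E"
    and g: "g \<in> carrier (graphic_pure_braid_group n E)"
    and rho1: "\<And>K. K \<in> maximal_cliques n E \<Longrightarrow> rho n E K g = \<one>\<^bsub>induced_pure_braid_group E K\<^esub>"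
  shows "g = \<one>\<^bsub>graphic_pure_braid_group n E\<^esub>"
proof -
  let ?G = "graphic_pure_braid_group n E" and ?X = "edges_in E ` maximal_cliques n E"
  define p where "p X = (SOME p. is_retraction n E X p)" for X
  have edge_clique: "e \<in> cliques n E" "edges_in E e = {e}" if e: "e \<in> E" for e
  proof -
    obtain i j where ij: "1 \<le> i" "i < j" "j \<le> n" "e = {i, j}" using E e by (blast elim: edge_cases)
    then show "e \<in> cliques n E" using e by (auto simp: cliques_def clique_def insert_commute)
    have "f = e" if "f \<in> E" "f \<subseteq> e" for f
      using card_subset_eq[OF edge_props(2)[OF E e] that(2)] edge_props(3)[OF E] e that(1) by simp
    then show "edges_in E e = {e}" using e by (auto simp: edges_in_def)
  qed
  have p_clique: "is_retraction n E (edges_in E K) (p (edges_in E K))" if K: "K \<in> cliques n E" for K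
  proof -
    obtain q where "is_retraction n E (edges_in E K) q" by (rule clique_edges_retraction[OF E K])
    then show ?thesis unfolding p_def by (rule someI[of "is_retraction n E (edges_in E K)" q])
  qed
  have p: "is_retraction n E X (p X)" if X: "X \<in> ?X \<union> (\<lambda>e. {e}) ` E" for X
  proof -
    obtain K where "K \<in> cliques n E" "X = edges_in E K"
      using X maximal_clique_in_cliques edge_clique by (elim UnE imageE) metis+
    then show ?thesis using p_clique by simp
  qed
  interpret retract_cover ?G E "edge_gen n E" ?X p
  proof (intro retract_cover.intro retract_cover_axioms.intro group_graphic_pure_braid_group)
    show "finite E" by (rule finite_subset[OF E]) (simp add: finite_imp_finite_nsets)
    show "edge_gen n E e \<in> carrier ?G" if "e \<in> E" for e using that E edge_gen_closed by blast
    show "generate ?G (edge_gen n E ` E) = carrier ?G" by (rule generate_edge_gens[OF E])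
    show "\<Union> ?X = E"
    proof (intro equalityI subsetI)
      fix e assume e: "e \<in> E"
      obtain L where "L \<in> maximal_cliques n E" "e \<subseteq> L" by (rule ex_maximal_clique[OF edge_clique(1)[OF e]])
      then show "e \<in> \<Union> ?X" using e by (auto simp: edges_in_def)
    qed (auto simp: edges_in_def)
    show "p X \<in> hom ?G ?G" if "X \<in> ?X \<union> (\<lambda>e. {e}) ` E" for X
      using p[OF that] by (simp add: is_retraction_def)
    show "p X (edge_gen n E e) = (if e \<in> X then edge_gen n E e else \<one>\<^bsub>?G\<^esub>)"
      if "X \<in> ?X \<union> (\<lambda>e. {e}) ` E" "e \<in> E" for X e
      using p[OF that(1)] that(2) by (simp add: is_retraction_def)
    show "edge_gen n E e \<otimes>\<^bsub>?G\<^esub> edge_gen n E f = edge_gen n E f \<otimes>\<^bsub>?G\<^esub> edge_gen n E e"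
      if e: "e \<in> E" and f: "f \<in> E" and no: "\<And>X. X \<in> ?X \<Longrightarrow> \<not> {e, f} \<subseteq> X" for e f
    proof (rule edge_gens_commute[OF E e f], rule notI)
      assume "clique (e \<union> f) E"
      moreover have "e \<union> f \<subseteq> {1..n}" using edge_props(1)[OF E e] edge_props(1)[OF E f] by blast
      ultimately have "e \<union> f \<in> cliques n E" by (simp add: cliques_def)
      then obtain L where L: "L \<in> maximal_cliques n E" "e \<union> f \<subseteq> L" by (rule ex_maximal_clique)
      then show False using no[of "edges_in E L"] e f by (simp add: edges_in_def)
    qed
    show "\<exists>e. \<forall>e'\<in>X - {e}. edge_gen n E f \<otimes>\<^bsub>?G\<^esub> edge_gen n E e' = edge_gen n E e' \<otimes>\<^bsub>?G\<^esub> edge_gen n E f"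
      if X: "X \<in> ?X" and f: "f \<in> E - X" for X f
    proof -
      obtain K where K: "K \<in> maximal_cliques n E" "X = edges_in E K" using X by blast
      have fK: "f \<in> E" "\<not> f \<subseteq> K" using f K by (auto simp: edges_in_def)
      have comm: "edge_gen n E f \<otimes>\<^bsub>?G\<^esub> edge_gen n E e' = edge_gen n E e' \<otimes>\<^bsub>?G\<^esub> edge_gen n E f"
        if "e' \<in> X" "\<not> clique (e' \<union> f) E" for e'
        using edge_gens_commute[OF E _ fK(1) that(2)] that(1) K by (simp add: edges_in_def)
      show ?thesis
      proof (cases "\<exists>e\<in>X. clique (e \<union> f) E")
        case True
        then obtain e where e: "e \<in> X" "clique (e \<union> f) E" by blast
        have "\<not> clique (e' \<union> f) E" if "e' \<in> X - {e}" for e'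
          using outside_edge_linked_to_one_edge[OF E disj K(1) fK, of e e'] e that K(2)
          by (auto simp: edges_in_def)
        then show ?thesis using comm by blast
      next
        case False
        then show ?thesis using comm by blast
      qed
    qed
    show "\<exists>z\<in>carrier ?G. (\<forall>e'\<in>X. z \<otimes>\<^bsub>?G\<^esub> edge_gen n E e' = edge_gen n E e' \<otimes>\<^bsub>?G\<^esub> z) \<and>
        edge_gen n E e \<in> generate ?G (insert z (edge_gen n E ` (X - {e})))"
      if X: "X \<in> ?X" and e: "e \<in> X" for X e
    proof -
      obtain K where K: "K \<in> maximal_cliques n E" "X = edges_in E K" using X by blast
      have Kn: "K \<subseteq> {1..n}" and cl: "clique K E"
        using maximal_clique_in_cliques[OF K(1)] by (auto simp: cliques_def)
      have eE: "e \<in> E" "e \<subseteq> K" using e K by (auto simp: edges_in_def)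
      obtain i j where ij: "1 \<le> i" "i < j" "j \<le> n" "e = {i, j}" using E eE by (blast elim: edge_cases)
      have ijK: "i \<in> K" "j \<in> K" using ij eE by auto
      obtain z where z: "z \<in> carrier ?G"
        and zc: "\<And>k l. k \<in> K \<Longrightarrow> l \<in> K \<Longrightarrow> k < l \<Longrightarrow> z \<otimes>\<^bsub>?G\<^esub> graphic_gen n E k l = graphic_gen n E k l \<otimes>\<^bsub>?G\<^esub> z"
        and zg: "graphic_gen n E i j \<in> generate ?G
            (insert z {graphic_gen n E k l | k l. k \<in> K \<and> l \<in> K \<and> k < l \<and> (k, l) \<noteq> (i, j)})"
        by (rule clique_center_generates[OF Kn ijK ij(2), of E]) blast
      have "z \<otimes>\<^bsub>?G\<^esub> edge_gen n E e' = edge_gen n E e' \<otimes>\<^bsub>?G\<^esub> z" if "e' \<in> X" for e'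
      proof -
        have e': "e' \<in> E" "e' \<subseteq> K" using that K by (auto simp: edges_in_def)
        obtain k l where kl: "1 \<le> k" "k < l" "l \<le> n" "e' = {k, l}" using E e' by (blast elim: edge_cases)
        then show ?thesis using zc[of k l] e' by (simp add: edge_gen_pair)
      qed
      moreover have "graphic_gen n E k l \<in> edge_gen n E ` (X - {e})"
        if kl: "k \<in> K" "l \<in> K" "k < l" "(k, l) \<noteq> (i, j)" for k l
      proof (rule image_eqI[of _ _ "{k, l}"])
        show "graphic_gen n E k l = edge_gen n E {k, l}" using kl by (simp add: edge_gen_pair)
        have "{k, l} \<in> X" using cl kl K by (auto simp: clique_def edges_in_def)
        then show "{k, l} \<in> X - {e}" using kl ij by (auto simp: doubleton_eq_iff)
      qed
      then have "insert z {graphic_gen n E k l | k l. k \<in> K \<and> l \<in> K \<and> k < l \<and> (k, l) \<noteq> (i, j)} \<subseteq>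
          insert z (edge_gen n E ` (X - {e}))" by blast
      then have "graphic_gen n E i j \<in> generate ?G (insert z (edge_gen n E ` (X - {e})))"
        using zg group.mono_generate[OF group_graphic_pure_braid_group] by (meson subsetD)
      then have "edge_gen n E e \<in> generate ?G (insert z (edge_gen n E ` (X - {e})))"
        using ij by (simp add: edge_gen_pair)
      ultimately show ?thesis using z by blast
    qed
    show "\<exists>e. X \<inter> Y \<subseteq> {e}" if X: "X \<in> ?X" and Y: "Y \<in> ?X" and XY: "X \<noteq> Y" for X Y
    proof -
      obtain K L where KL: "K \<in> maximal_cliques n E" "X = edges_in E K"
        "L \<in> maximal_cliques n E" "Y = edges_in E L" using X Y by blast
      have "e = e'" if "e \<in> X \<inter> Y" "e' \<in> X \<inter> Y" for e e'
        by (rule maximal_cliques_share_edge[OF E disj KL(1,3)]) (use that KL XY in \<open>auto simp: edges_in_def\<close>)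
      then show ?thesis by blast
    qed
  qed
  show ?thesis
  proof (rule joint_kernel_trivial[OF g])
    fix X assume "X \<in> ?X"
    then obtain K where K: "K \<in> maximal_cliques n E" "X = edges_in E K" by blast
    note Kc = maximal_clique_in_cliques[OF K(1)]
    obtain p' where p': "is_retraction n E X p'"
      "\<And>g. rho n E K g = \<one>\<^bsub>induced_pure_braid_group E K\<^esub> \<Longrightarrow> p' g = \<one>\<^bsub>?G\<^esub>"
      unfolding K(2) by (rule clique_edges_retraction[OF E Kc]) blast
    have "p X g = p' g" using retraction_eq[OF E _ p'(1) g] p_clique[OF Kc] K(2) by simp
    then show "p X g = \<one>\<^bsub>?G\<^esub>" using p'(2) rho1[OF K(1)] by simp
  qed
qed

theorem theorem5p9:
  fixes n :: nat and E :: "nat set set"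
  assumes "E \<subseteq> [{1..n}]\<^bsup>2\<^esup>"
    and "\<And>K L. K \<in> k_cliques 4 n E \<Longrightarrow> L \<in> k_cliques 4 n E \<Longrightarrow> K \<noteq> L \<Longrightarrow> K \<inter> L \<notin> k_cliques 3 n E"
  shows "rho_family n E (maximal_cliques n E) \<in>
    mon (graphic_pure_braid_group n E)
        (product_group (maximal_cliques n E) (induced_pure_braid_group E))"
proof -
  let ?G = "graphic_pure_braid_group n E" and ?M = "maximal_cliques n E"
  have hom: "rho n E K \<in> hom ?G (induced_pure_braid_group E K)" if "K \<in> ?M" for K
    using rho_hom maximal_clique_in_cliques[OF that] by (simp add: cliques_def)
  have "rho_family n E ?M \<in> hom ?G (product_group ?M (induced_pure_braid_group E))"
    using hom by (auto simp: hom_def rho_family_def Pi_iff intro!: restrict_ext)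
  moreover have "g = \<one>\<^bsub>?G\<^esub>"
    if g: "g \<in> carrier ?G" and one: "rho_family n E ?M g = \<one>\<^bsub>product_group ?M (induced_pure_braid_group E)\<^esub>" for g
  proof (rule joint_kernel_rho_trivial[OF assms g])
    fix K assume "K \<in> ?M"
    then show "rho n E K g = \<one>\<^bsub>induced_pure_braid_group E K\<^esub>"
      using fun_cong[OF one, of K] by (simp add: rho_family_def)
  qed
  moreover have "group (product_group ?M (induced_pure_braid_group E))"
    by (rule product_group) (rule group_graphic_pure_braid_group)
  ultimately show ?thesis
    unfolding mon_iff_hom_one[OF group_graphic_pure_braid_group \<open>group (product_group _ _)\<close>] by blast
qed

end
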